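(* Let $R$ be a commutative ring and let $\mathscr F$ be a category with a proper factorization system $(\mathscr E,\mathscr M)$ and groupoid $\mathscr G=\mathscr E\cap\mathscr M$, such that the Idempotent Axiom holds, with chosen idempotents $p_A$. Let $E:R\mathscr G\to R\mathscr F$ and $M:R\mathscr F\to R\mathscr G$ be the modules defined in the context, and consider the adjunction $E\dashv M$ in the bicategory $\mathfrak R$ described in the context. If each object $A$ of $\mathscr F$ has only finitely many $\mathscr M$-subobjects (that is, each slice category $\mathscr M/A$ has only finitely many isomorphism classes of objects), then the adjunction $E\dashv M$ is an equivalence $R\mathscr F\simeq R\mathscr G$ in $\mathfrak R$ (that is, its unit and counit are invertible).
   Context: $\mathscr V$ is the monoidal category of modules over the commutative ring $R$; $RX$ is the free $R$-module on a set $X$; for a category $\mathscr C$, $R\mathscr C$ is the $R$-linear category with the same objects and homs $R\mathscr C(A,B)=R(\mathscr C(A,B))$. Factorization system: $\mathscr E,\mathscr M$ are sets of morphisms of $\mathscr F$ with: (FS0) $mw\in\mathscr M$ if $m\in\mathscr M$ and $w$ is invertible, $we\in\mathscr E$ if $e\in\mathscr E$ and $w$ is invertible; (FS1) if $mh=ke$ with $e\in\mathscr E$, $m\in\mathscr M$, there is a unique $\ell$ with $\ell e=h$, $m\ell=k$; (FS2) every $f$ factors as $f=me$ with $m\in\mathscr M$, $e\in\mathscr E$. It is proper when every member of $\mathscr E$ is an epimorphism and every member of $\mathscr M$ is a monomorphism. Then $\mathscr G=\mathscr E\cap\mathscr M$ is the set of invertible morphisms; $\mathscr E,\mathscr M,\mathscr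 G$ are regarded as subcategories with all objects. $\mathscr M',\mathscr E',\mathscr G'$ denote the sets of morphisms of $\mathscr F$ not in $\mathscr M,\mathscr E,\mathscr G$ respectively; $\mathscr M(A,B)$ etc. denotes the set of morphisms $A\to B$ in $\mathscr M$ etc. The slice category $\mathscr M/A$ has objects the morphisms in $\mathscr M$ with codomain $A$. Idempotent Axiom: for each object $A\in\mathscr F$ there is a morphism $p_A:A\to A$ in $R\mathscr F$ such that (p0) $p_Ap_A=p_A$; (p1) if $f\in\mathscr F(A,B)$ and $f\in\mathscr M'$ then $fp_A=0$; (p2) if $f\in\mathscr F(A,B)$ and $f\in\mathscr E'$ then $p_Bf=0$; (p3) if $g\in\mathscr G(A,B)$ then $gp_A=p_Bg$; (p4) $1_A-p_A\in R(\mathscr E'(A,A)\cap\mathscr M'(A,A))$. Bicategory $\mathfrak R=\mathscr V\text{-}\mathrm{Mod}$: objects are $R$-linear categories; a morphism (module) $H:\mathscr A\to\mathscr B$ is a $\mathscr V$-functor $\mathscr B^{\mathrm{op}}\otimes\mathscr A\to\mathscr V$, with values $H(B,A)$; 2-morphisms are natural transformations; composition is $(K\circ H)(C,A)=\int^B H(B,A)\otimes K(C,B)$; identities are the hom functors. The module $M:R\mathscr F\to R\mathscr G$ has $M(A,B)=R\mathscr M(A,B)$ for $A\in\mathscr G$, $B\in\mathscr F$, with action $M(g,f)(m)=fmg$ if $fmg\in\mathscr M$ and $0$ otherwise ($g\in\mathscr G(A',A)$, $m\in\mathscr M(A,B)$, $f\in\mathscr F(B,B')$). The module $E:R\mathscr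 G\to R\mathscr F$ has $E(B,A)=R\mathscr E(B,A)$ for $B\in\mathscr F$, $A\in\mathscr G$, with action $E(f,g)(e)=gef$ if $gef\in\mathscr E$ and $0$ otherwise. The adjunction $E\dashv M$ has unit $1_{R\mathscr G}\Rightarrow M\circ E$ with components $R\mathscr G(C,D)\to\int^{B\in\mathscr F}E(B,D)\otimes M(C,B)$, $g\mapsto[g\otimes 1_C]$, and counit $E\circ M\Rightarrow 1_{R\mathscr F}$ with components $\int^{C\in\mathscr G}M(C,B)\otimes E(A,C)\to R\mathscr F(A,B)$, $[m\otimes e]\mapsto mp_Ce$. *)

theory Defs
  imports "HOL-Algebra.Module" "HOL-Algebra.AbelCoset"
begin

section \<open>Categories and factorization systems\<close>

record ('o, 'm) cat =
  Ob :: "'o set"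
  Ar :: "'m set"
  Src :: "'m \<Rightarrow> 'o"
  Trg :: "'m \<Rightarrow> 'o"
  Idn :: "'o \<Rightarrow> 'm"
  Cmp :: "'m \<Rightarrow> 'm \<Rightarrow> 'm"

definition Arr :: "('o, 'm) cat \<Rightarrow> 'o \<Rightarrow> 'o \<Rightarrow> 'm set" where
  "Arr C A B = {f \<in> Ar C. Src C f = A \<and> Trg C f = B}"

locale category =
  fixes C :: "('o, 'm) cat"
  assumes src_ob: "f \<in> Ar C \<Longrightarrow> Src C f \<in> Ob C"
    and trg_ob: "f \<in> Ar C \<Longrightarrow> Trg C f \<in> Ob C"
    and idn_arr: "A \<in> Ob C \<Longrightarrow> Idn C A \<in> Arr C A A"
    and cmp_arr: "\<lbrakk>f \<in> Arr C A B; g \<in> Arr C B D\<rbrakk> \<Longrightarrow> Cmp C g f \<in> Arr C A D"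
    and idn_left: "f \<in> Arr C A B \<Longrightarrow> Cmp C (Idn C B) f = f"
    and idn_right: "f \<in> Arr C A B \<Longrightarrow> Cmp C f (Idn C A) = f"
    and cmp_assoc: "\<lbrakk>f \<in> Arr C A B; g \<in> Arr C B D; h \<in> Arr C D D'\<rbrakk>
      \<Longrightarrow> Cmp C h (Cmp C g f) = Cmp C (Cmp C h g) f"

definition invertible :: "('o, 'm) cat \<Rightarrow> 'm \<Rightarrow> bool" where
  "invertible C f \<longleftrightarrow> f \<in> Ar C \<and>
     (\<exists>g \<in> Arr C (Trg C f) (Src C f).
        Cmp C g f = Idn C (Src C f) \<and> Cmp C f g = Idn C (Trg C f))"

definition monomorphism :: "('o, 'm) cat \<Rightarrow> 'm \<Rightarrow> bool" where
  "monomorphism C f \<longleftrightarrow> f \<in> Ar C \<and>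
     (\<forall>X \<in> Ob C. \<forall>u \<in> Arr C X (Src C f). \<forall>v \<in> Arr C X (Src C f).
        Cmp C f u = Cmp C f v \<longrightarrow> u = v)"

definition epimorphism :: "('o, 'm) cat \<Rightarrow> 'm \<Rightarrow> bool" where
  "epimorphism C f \<longleftrightarrow> f \<in> Ar C \<and>
     (\<forall>X \<in> Ob C. \<forall>u \<in> Arr C (Trg C f) X. \<forall>v \<in> Arr C (Trg C f) X.
        Cmp C u f = Cmp C v f \<longrightarrow> u = v)"

definition isomorphic_in :: "('o, 'm) cat \<Rightarrow> 'o \<Rightarrow> 'o \<Rightarrow> bool" where
  "isomorphic_in C A B \<longleftrightarrow> (\<exists>f \<in> Arr C A B. invertible C f)"

definition iso_classes :: "('o, 'm) cat \<Rightarrow> 'o set set" where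
  "iso_classes C = Ob C // {(A, B). A \<in> Ob C \<and> B \<in> Ob C \<and> isomorphic_in C A B}"

text \<open>The subcategory with all objects whose set of morphisms is \<open>S\<close>.\<close>

definition wide_subcat :: "('o, 'm) cat \<Rightarrow> 'm set \<Rightarrow> ('o, 'm) cat" where
  "wide_subcat C S = C\<lparr>Ar := S\<rparr>"

text \<open>
  A morphism \<open>m \<rightarrow> m'\<close> of the slice is a triple \<open>(m, h, m')\<close> with \<open>m' h = m\<close>.
\<close>

definition slice_cat :: "('o, 'm) cat \<Rightarrow> 'o \<Rightarrow> ('m, 'm \<times> 'm \<times> 'm) cat" where
  "slice_cat C A =
     \<lparr>Ob = {m \<in> Ar C. Trg C m = A},
      Ar = {(m, h, m'). m \<in> Ar C \<and> Trg C m = A \<and> m' \<in> Ar C \<and> Trg C m' = A \<and>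
              h \<in> Arr C (Src C m) (Src C m') \<and> Cmp C m' h = m},
      Src = (\<lambda>(m, h, m'). m),
      Trg = (\<lambda>(m, h, m'). m'),
      Idn = (\<lambda>m. (m, Idn C (Src C m), m)),
      Cmp = (\<lambda>(m', k, m'') (m, h, n). (m, Cmp C k h, m''))\<rparr>"

locale factorization_system =
  fixes F :: "('o, 'm) cat" and Es Ms :: "'m set"
  assumes Es_arr: "Es \<subseteq> Ar F" and Ms_arr: "Ms \<subseteq> Ar F"
    and FS0_M: "\<lbrakk>m \<in> Ms; invertible F w; Trg F w = Src F m\<rbrakk> \<Longrightarrow> Cmp F m w \<in> Ms"
    and FS0_E: "\<lbrakk>e \<in> Es; invertible F w; Src F w = Trg F e\<rbrakk> \<Longrightarrow> Cmp F w e \<in> Es"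
    and FS1: "\<lbrakk>e \<in> Es; e \<in> Arr F A B; h \<in> Arr F A D; m \<in> Ms; m \<in> Arr F D D'; k \<in> Arr F B D';
        Cmp F m h = Cmp F k e\<rbrakk>
      \<Longrightarrow> \<exists>!l. l \<in> Arr F B D \<and> Cmp F l e = h \<and> Cmp F m l = k"
    and FS2: "f \<in> Ar F \<Longrightarrow> \<exists>m \<in> Ms. \<exists>e \<in> Es.
        Src F e = Src F f \<and> Trg F e = Src F m \<and> Trg F m = Trg F f \<and> f = Cmp F m e"

locale proper_factorization_system = factorization_system +
  assumes Es_epi: "e \<in> Es \<Longrightarrow> epimorphism F e"
    and Ms_mono: "m \<in> Ms \<Longrightarrow> monomorphism F m"

section \<open>Modules over a commutative ring\<close>

text \<open>
  In the \<open>module\<close> record inherited from rings the fields \<open>mult\<close> and \<open>one\<close>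
  play no role and are left undefined.
  \<open>R X\<close> consists of the finitely supported functions, required to vanish outside \<open>X\<close>;
  in particular \<open>R X\<close> is a submodule of \<open>R Y\<close> whenever \<open>X \<subseteq> Y\<close>.
\<close>

definition free_mod :: "('r, 'x) ring_scheme \<Rightarrow> 'a set \<Rightarrow> ('r, 'a \<Rightarrow> 'r) module" where
  "free_mod R X =
     \<lparr>carrier = {x. (\<forall>a. x a \<in> carrier R) \<and> (\<forall>a. a \<notin> X \<longrightarrow> x a = \<zero>\<^bsub>R\<^esub>) \<and>
                  finite {a. x a \<noteq> \<zero>\<^bsub>R\<^esub>}},
      monoid.mult = undefined, one = undefined,
      zero = (\<lambda>a. \<zero>\<^bsub>R\<^esub>),
      add = (\<lambda>x y a. x a \<oplus>\<^bsub>R\<^esub> y a),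
      smult = (\<lambda>r x a. r \<otimes>\<^bsub>R\<^esub> x a)\<rparr>"

definition gen :: "('r, 'x) ring_scheme \<Rightarrow> 'a \<Rightarrow> 'a \<Rightarrow> 'r" where
  "gen R a = (\<lambda>b. if b = a then \<one>\<^bsub>R\<^esub> else \<zero>\<^bsub>R\<^esub>)"

text \<open>The \<open>R\<close>-linear extension of \<open>\<phi>\<close> to the free module, with values in \<open>N\<close>.\<close>

definition lin_ext ::
  "('r, 'x) ring_scheme \<Rightarrow> ('r, 'n) module \<Rightarrow> ('a \<Rightarrow> 'n) \<Rightarrow> ('a \<Rightarrow> 'r) \<Rightarrow> 'n" where
  "lin_ext R N \<phi> x = (\<Oplus>\<^bsub>N\<^esub> a \<in> {a. x a \<noteq> \<zero>\<^bsub>R\<^esub>}. x a \<odot>\<^bsub>N\<^esub> \<phi> a)"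

definition linear_map ::
  "('r, 'x) ring_scheme \<Rightarrow> ('r, 'm) module \<Rightarrow> ('r, 'n) module \<Rightarrow> ('m \<Rightarrow> 'n) \<Rightarrow> bool" where
  "linear_map R M N f \<longleftrightarrow>
     (\<forall>x \<in> carrier M. f x \<in> carrier N) \<and>
     (\<forall>x \<in> carrier M. \<forall>y \<in> carrier M. f (x \<oplus>\<^bsub>M\<^esub> y) = f x \<oplus>\<^bsub>N\<^esub> f y) \<and>
     (\<forall>r \<in> carrier R. \<forall>x \<in> carrier M. f (r \<odot>\<^bsub>M\<^esub> x) = r \<odot>\<^bsub>N\<^esub> f x)"

definition submod_span :: "('r, 'x) ring_scheme \<Rightarrow> ('r, 'm) module \<Rightarrow> 'm set \<Rightarrow> 'm set" where
  "submod_span R M S = \<Inter> {N. submodule N R M \<and> S \<subseteq> N}"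

definition quot_mod :: "('r, 'm) module \<Rightarrow> 'm set \<Rightarrow> ('r, 'm set) module" where
  "quot_mod M N =
     \<lparr>carrier = a_rcosets\<^bsub>M\<^esub> N,
      monoid.mult = undefined, one = undefined,
      zero = N,
      add = set_add M,
      smult = (\<lambda>r X. \<Union>x \<in> X. N +>\<^bsub>M\<^esub> (r \<odot>\<^bsub>M\<^esub> x))\<rparr>"

section \<open>Linear categories and modules between them\<close>

record ('r, 'o, 'h) lincat =
  LOb :: "'o set"
  LHom :: "'o \<Rightarrow> 'o \<Rightarrow> ('r, 'h) module"
  LId :: "'o \<Rightarrow> 'h"
  LCmp :: "'o \<Rightarrow> 'o \<Rightarrow> 'o \<Rightarrow> 'h \<Rightarrow> 'h \<Rightarrow> 'h"

abbreviation LArr :: "('r, 'o, 'h) lincat \<Rightarrow> 'o \<Rightarrow> 'o \<Rightarrow> 'h set" where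
  "LArr \<A> A B \<equiv> carrier (LHom \<A> A B)"

text \<open>\<open>LCmp \<A> A B C g f\<close> is the composite of \<open>f : A \<rightarrow> B\<close> and \<open>g : B \<rightarrow> C\<close>.\<close>

locale linear_category =
  fixes R :: "('r, 'x) ring_scheme" and \<A> :: "('r, 'o, 'h) lincat"
  assumes hom_module: "\<lbrakk>A \<in> LOb \<A>; B \<in> LOb \<A>\<rbrakk> \<Longrightarrow> module R (LHom \<A> A B)"
    and id_hom: "A \<in> LOb \<A> \<Longrightarrow> LId \<A> A \<in> LArr \<A> A A"
    and cmp_linear_left:
      "\<lbrakk>A \<in> LOb \<A>; B \<in> LOb \<A>; C \<in> LOb \<A>; f \<in> LArr \<A> A B\<rbrakk>
        \<Longrightarrow> linear_map R (LHom \<A> B C) (LHom \<A> A C) (\<lambda>g. LCmp \<A> A B C g f)"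
    and cmp_linear_right:
      "\<lbrakk>A \<in> LOb \<A>; B \<in> LOb \<A>; C \<in> LOb \<A>; g \<in> LArr \<A> B C\<rbrakk>
        \<Longrightarrow> linear_map R (LHom \<A> A B) (LHom \<A> A C) (\<lambda>f. LCmp \<A> A B C g f)"
    and id_left: "\<lbrakk>A \<in> LOb \<A>; B \<in> LOb \<A>; f \<in> LArr \<A> A B\<rbrakk>
        \<Longrightarrow> LCmp \<A> A B B (LId \<A> B) f = f"
    and id_right: "\<lbrakk>A \<in> LOb \<A>; B \<in> LOb \<A>; f \<in> LArr \<A> A B\<rbrakk>
        \<Longrightarrow> LCmp \<A> A A B f (LId \<A> A) = f"
    and lcmp_assoc:
      "\<lbrakk>A \<in> LOb \<A>; B \<in> LOb \<A>; C \<in> LOb \<A>; D \<in> LOb \<A>;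
        f \<in> LArr \<A> A B; g \<in> LArr \<A> B C; h \<in> LArr \<A> C D\<rbrakk>
        \<Longrightarrow> LCmp \<A> A C D h (LCmp \<A> A B C g f) = LCmp \<A> A B D (LCmp \<A> B C D h g) f"

text \<open>
  A module \<open>H : \<A> \<rightarrow> \<B>\<close> has values \<open>H(B, A) = Val H B A\<close>, contravariant in \<open>B\<close> and
  covariant in \<open>A\<close>.  For \<open>b \<in> \<B>(B', B)\<close> and \<open>a \<in> \<A>(A, A')\<close> the map
  \<open>H(b, a) : H(B, A) \<rightarrow> H(B', A')\<close> is \<open>Act H B A B' A' b a\<close>.  The linear maps
  \<open>\<B>(B', B) \<otimes> \<A>(A, A') \<rightarrow> Hom(H(B, A), H(B', A'))\<close> of the enriched functor are given as
  trilinear maps.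
\<close>

record ('r, 'a, 'ah, 'b, 'bh, 'h) vmod =
  Val :: "'b \<Rightarrow> 'a \<Rightarrow> ('r, 'h) module"
  Act :: "'b \<Rightarrow> 'a \<Rightarrow> 'b \<Rightarrow> 'a \<Rightarrow> 'bh \<Rightarrow> 'ah \<Rightarrow> 'h \<Rightarrow> 'h"

locale vmodule =
  fixes R :: "('r, 'x) ring_scheme"
    and \<A> :: "('r, 'a, 'ah) lincat" and \<B> :: "('r, 'b, 'bh) lincat"
    and H :: "('r, 'a, 'ah, 'b, 'bh, 'h) vmod"
  assumes val_module: "\<lbrakk>B \<in> LOb \<B>; A \<in> LOb \<A>\<rbrakk> \<Longrightarrow> module R (Val H B A)"
    and act_linear:
      "\<lbrakk>B \<in> LOb \<B>; A \<in> LOb \<A>; B' \<in> LOb \<B>; A' \<in> LOb \<A>; b \<in> LArr \<B> B' B; a \<in> LArr \<A> A A'\<rbrakk>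
        \<Longrightarrow> linear_map R (Val H B A) (Val H B' A') (\<lambda>h. Act H B A B' A' b a h)"
    and act_linear_contra:
      "\<lbrakk>B \<in> LOb \<B>; A \<in> LOb \<A>; B' \<in> LOb \<B>; A' \<in> LOb \<A>; a \<in> LArr \<A> A A'; h \<in> carrier (Val H B A)\<rbrakk>
        \<Longrightarrow> linear_map R (LHom \<B> B' B) (Val H B' A') (\<lambda>b. Act H B A B' A' b a h)"
    and act_linear_co:
      "\<lbrakk>B \<in> LOb \<B>; A \<in> LOb \<A>; B' \<in> LOb \<B>; A' \<in> LOb \<A>; b \<in> LArr \<B> B' B; h \<in> carrier (Val H B A)\<rbrakk>
        \<Longrightarrow> linear_map R (LHom \<A> A A') (Val H B' A') (\<lambda>a. Act H B A B' A' b a h)"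
    and act_id:
      "\<lbrakk>B \<in> LOb \<B>; A \<in> LOb \<A>; h \<in> carrier (Val H B A)\<rbrakk>
        \<Longrightarrow> Act H B A B A (LId \<B> B) (LId \<A> A) h = h"
    and act_cmp:
      "\<lbrakk>B \<in> LOb \<B>; A \<in> LOb \<A>; B' \<in> LOb \<B>; A' \<in> LOb \<A>; B'' \<in> LOb \<B>; A'' \<in> LOb \<A>;
        b \<in> LArr \<B> B' B; b' \<in> LArr \<B> B'' B'; a \<in> LArr \<A> A A'; a' \<in> LArr \<A> A' A'';
        h \<in> carrier (Val H B A)\<rbrakk>
        \<Longrightarrow> Act H B A B'' A'' (LCmp \<B> B'' B' B b b') (LCmp \<A> A A' A'' a' a) h
          = Act H B' A' B'' A'' b' a' (Act H B A B' A' b a h)"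

locale two_cell =
  dom: vmodule R \<A> \<B> H + cod: vmodule R \<A> \<B> H'
  for R :: "('r, 'x) ring_scheme"
    and \<A> :: "('r, 'a, 'ah) lincat" and \<B> :: "('r, 'b, 'bh) lincat"
    and H :: "('r, 'a, 'ah, 'b, 'bh, 'h) vmod" and H' :: "('r, 'a, 'ah, 'b, 'bh, 'k) vmod" +
  fixes \<theta> :: "'b \<Rightarrow> 'a \<Rightarrow> 'h \<Rightarrow> 'k"
  assumes component_linear:
      "\<lbrakk>B \<in> LOb \<B>; A \<in> LOb \<A>\<rbrakk> \<Longrightarrow> linear_map R (Val H B A) (Val H' B A) (\<theta> B A)"
    and naturality:
      "\<lbrakk>B \<in> LOb \<B>; A \<in> LOb \<A>; B' \<in> LOb \<B>; A' \<in> LOb \<A>; b \<in> LArr \<B> B' B; a \<in> LArr \<A> A A';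
        h \<in> carrier (Val H B A)\<rbrakk>
        \<Longrightarrow> \<theta> B' A' (Act H B A B' A' b a h) = Act H' B A B' A' b a (\<theta> B A h)"

definition invertible_two_cell ::
  "('r, 'x) ring_scheme \<Rightarrow> ('r, 'a, 'ah) lincat \<Rightarrow> ('r, 'b, 'bh) lincat \<Rightarrow>
   ('r, 'a, 'ah, 'b, 'bh, 'h) vmod \<Rightarrow> ('r, 'a, 'ah, 'b, 'bh, 'k) vmod \<Rightarrow>
   ('b \<Rightarrow> 'a \<Rightarrow> 'h \<Rightarrow> 'k) \<Rightarrow> bool" where
  "invertible_two_cell R \<A> \<B> H H' \<theta> \<longleftrightarrow>
     two_cell R \<A> \<B> H H' \<theta> \<and>
     (\<exists>\<theta>'. two_cell R \<A> \<B> H' H \<theta>' \<and>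
        (\<forall>B \<in> LOb \<B>. \<forall>A \<in> LOb \<A>.
           (\<forall>h \<in> carrier (Val H B A). \<theta>' B A (\<theta> B A h) = h) \<and>
           (\<forall>k \<in> carrier (Val H' B A). \<theta> B A (\<theta>' B A k) = k)))"

definition id_mod :: "('r, 'a, 'ah) lincat \<Rightarrow> ('r, 'a, 'ah, 'a, 'ah, 'ah) vmod" where
  "id_mod \<A> =
     \<lparr>Val = LHom \<A>,
      Act = (\<lambda>B A B' A' b a h. LCmp \<A> B' A A' a (LCmp \<A> B' B A h b))\<rparr>"

text \<open>
  The coend \<open>\<integral>\<^sup>B H(B, A) \<otimes> K(C, B)\<close> for \<open>H : \<A> \<rightarrow> \<B>\<close> and \<open>K : \<B> \<rightarrow> \<C>\<close>, presented by
  generators and relations: it is the quotient of the free module on all triples \<open>(B, h, k)\<close>,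
  standing for \<open>h \<otimes> k\<close> in the \<open>B\<close>-th summand, by the relations of bilinearity of \<open>\<otimes>\<close> and the
  coend relations \<open>H(b, 1) h \<otimes> k = h \<otimes> K(1, b) k\<close> for \<open>b : B \<rightarrow> B'\<close>.
\<close>

definition coend_gens ::
  "('r, 'b, 'bh) lincat \<Rightarrow> ('r, 'b, 'bh, 'c, 'ch, 'k) vmod \<Rightarrow> ('r, 'a, 'ah, 'b, 'bh, 'h) vmod \<Rightarrow>
   'c \<Rightarrow> 'a \<Rightarrow> ('b \<times> 'h \<times> 'k) set" where
  "coend_gens \<B> K H C A =
     {(B, h, k). B \<in> LOb \<B> \<and> h \<in> carrier (Val H B A) \<and> k \<in> carrier (Val K C B)}"

inductive_set coend_rels ::
  "('r, 'x) ring_scheme \<Rightarrow> ('r, 'a, 'ah) lincat \<Rightarrow> ('r, 'b, 'bh) lincat \<Rightarrow> ('r, 'c, 'ch) lincat \<Rightarrow>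
   ('r, 'b, 'bh, 'c, 'ch, 'k) vmod \<Rightarrow> ('r, 'a, 'ah, 'b, 'bh, 'h) vmod \<Rightarrow>
   'c \<Rightarrow> 'a \<Rightarrow> ('b \<times> 'h \<times> 'k \<Rightarrow> 'r) set"
  for R \<A> \<B> \<C> K H C A where
  add_left:
    "\<lbrakk>B \<in> LOb \<B>; h \<in> carrier (Val H B A); h' \<in> carrier (Val H B A); k \<in> carrier (Val K C B)\<rbrakk>
     \<Longrightarrow> gen R (B, h \<oplus>\<^bsub>Val H B A\<^esub> h', k)
         \<ominus>\<^bsub>free_mod R (coend_gens \<B> K H C A)\<^esub>
         (gen R (B, h, k) \<oplus>\<^bsub>free_mod R (coend_gens \<B> K H C A)\<^esub> gen R (B, h', k))
       \<in> coend_rels R \<A> \<B> \<C> K H C A"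
| add_right:
    "\<lbrakk>B \<in> LOb \<B>; h \<in> carrier (Val H B A); k \<in> carrier (Val K C B); k' \<in> carrier (Val K C B)\<rbrakk>
     \<Longrightarrow> gen R (B, h, k \<oplus>\<^bsub>Val K C B\<^esub> k')
         \<ominus>\<^bsub>free_mod R (coend_gens \<B> K H C A)\<^esub>
         (gen R (B, h, k) \<oplus>\<^bsub>free_mod R (coend_gens \<B> K H C A)\<^esub> gen R (B, h, k'))
       \<in> coend_rels R \<A> \<B> \<C> K H C A"
| smult_left:
    "\<lbrakk>B \<in> LOb \<B>; r \<in> carrier R; h \<in> carrier (Val H B A); k \<in> carrier (Val K C B)\<rbrakk>
     \<Longrightarrow> gen R (B, r \<odot>\<^bsub>Val H B A\<^esub> h, k)
         \<ominus>\<^bsub>free_mod R (coend_gens \<B> K H C A)\<^esub>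
         (r \<odot>\<^bsub>free_mod R (coend_gens \<B> K H C A)\<^esub> gen R (B, h, k))
       \<in> coend_rels R \<A> \<B> \<C> K H C A"
| smult_right:
    "\<lbrakk>B \<in> LOb \<B>; r \<in> carrier R; h \<in> carrier (Val H B A); k \<in> carrier (Val K C B)\<rbrakk>
     \<Longrightarrow> gen R (B, h, r \<odot>\<^bsub>Val K C B\<^esub> k)
         \<ominus>\<^bsub>free_mod R (coend_gens \<B> K H C A)\<^esub>
         (r \<odot>\<^bsub>free_mod R (coend_gens \<B> K H C A)\<^esub> gen R (B, h, k))
       \<in> coend_rels R \<A> \<B> \<C> K H C A"
| balance:
    "\<lbrakk>B \<in> LOb \<B>; B' \<in> LOb \<B>; b \<in> LArr \<B> B B'; h \<in> carrier (Val H B' A); k \<in> carrier (Val K C B)\<rbrakk>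
     \<Longrightarrow> gen R (B, Act H B' A B A b (LId \<A> A) h, k)
         \<ominus>\<^bsub>free_mod R (coend_gens \<B> K H C A)\<^esub>
         gen R (B', h, Act K C B C B' (LId \<C> C) b k)
       \<in> coend_rels R \<A> \<B> \<C> K H C A"

definition coend_sub ::
  "('r, 'x) ring_scheme \<Rightarrow> ('r, 'a, 'ah) lincat \<Rightarrow> ('r, 'b, 'bh) lincat \<Rightarrow> ('r, 'c, 'ch) lincat \<Rightarrow>
   ('r, 'b, 'bh, 'c, 'ch, 'k) vmod \<Rightarrow> ('r, 'a, 'ah, 'b, 'bh, 'h) vmod \<Rightarrow>
   'c \<Rightarrow> 'a \<Rightarrow> ('b \<times> 'h \<times> 'k \<Rightarrow> 'r) set" where
  "coend_sub R \<A> \<B> \<C> K H C A =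
     submod_span R (free_mod R (coend_gens \<B> K H C A)) (coend_rels R \<A> \<B> \<C> K H C A)"

definition coend_mod ::
  "('r, 'x) ring_scheme \<Rightarrow> ('r, 'a, 'ah) lincat \<Rightarrow> ('r, 'b, 'bh) lincat \<Rightarrow> ('r, 'c, 'ch) lincat \<Rightarrow>
   ('r, 'b, 'bh, 'c, 'ch, 'k) vmod \<Rightarrow> ('r, 'a, 'ah, 'b, 'bh, 'h) vmod \<Rightarrow>
   'c \<Rightarrow> 'a \<Rightarrow> ('r, ('b \<times> 'h \<times> 'k \<Rightarrow> 'r) set) module" where
  "coend_mod R \<A> \<B> \<C> K H C A =
     quot_mod (free_mod R (coend_gens \<B> K H C A)) (coend_sub R \<A> \<B> \<C> K H C A)"

text \<open>The class \<open>[h \<otimes> k]\<close> of an element of the \<open>B\<close>-th summand.\<close>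

definition coend_tens ::
  "('r, 'x) ring_scheme \<Rightarrow> ('r, 'a, 'ah) lincat \<Rightarrow> ('r, 'b, 'bh) lincat \<Rightarrow> ('r, 'c, 'ch) lincat \<Rightarrow>
   ('r, 'b, 'bh, 'c, 'ch, 'k) vmod \<Rightarrow> ('r, 'a, 'ah, 'b, 'bh, 'h) vmod \<Rightarrow>
   'c \<Rightarrow> 'a \<Rightarrow> 'b \<Rightarrow> 'h \<Rightarrow> 'k \<Rightarrow> ('b \<times> 'h \<times> 'k \<Rightarrow> 'r) set" where
  "coend_tens R \<A> \<B> \<C> K H C A B h k =
     coend_sub R \<A> \<B> \<C> K H C A +>\<^bsub>free_mod R (coend_gens \<B> K H C A)\<^esub> gen R (B, h, k)"

text \<open>
  The linear map out of a coend with values in \<open>N\<close> determined by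
  \<open>[h \<otimes> k] \<mapsto> \<phi> (B, h, k)\<close>.  It is meaningful when \<open>\<phi>\<close> respects the relations, for then
  the image of a coset under the linear extension of \<open>\<phi>\<close> is a singleton.
\<close>

definition coend_map ::
  "('r, 'x) ring_scheme \<Rightarrow> ('r, 'n) module \<Rightarrow> ('b \<times> 'h \<times> 'k \<Rightarrow> 'n) \<Rightarrow>
   ('b \<times> 'h \<times> 'k \<Rightarrow> 'r) set \<Rightarrow> 'n" where
  "coend_map R N \<phi> X = the_elem (lin_ext R N \<phi> ` X)"

text \<open>The composite \<open>K \<circ> H : \<A> \<rightarrow> \<C>\<close>; its action is \<open>[h \<otimes> k] \<mapsto> [H(1, a) h \<otimes> K(c, 1) k]\<close>.\<close>

definition mod_comp ::
  "('r, 'x) ring_scheme \<Rightarrow> ('r, 'a, 'ah) lincat \<Rightarrow> ('r, 'b, 'bh) lincat \<Rightarrow> ('r, 'c, 'ch) lincat \<Rightarrow>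
   ('r, 'b, 'bh, 'c, 'ch, 'k) vmod \<Rightarrow> ('r, 'a, 'ah, 'b, 'bh, 'h) vmod \<Rightarrow>
   ('r, 'a, 'ah, 'c, 'ch, ('b \<times> 'h \<times> 'k \<Rightarrow> 'r) set) vmod" where
  "mod_comp R \<A> \<B> \<C> K H =
     \<lparr>Val = coend_mod R \<A> \<B> \<C> K H,
      Act = (\<lambda>C A C' A' c a. coend_map R (coend_mod R \<A> \<B> \<C> K H C' A')
        (\<lambda>(B, h, k). coend_tens R \<A> \<B> \<C> K H C' A' B
           (Act H B A B A' (LId \<B> B) a h) (Act K C B C' B c (LId \<B> B) k)))\<rparr>"

text \<open>
  Horizontal composition of \<open>\<phi> : H \<Rightarrow> H'\<close> and \<open>\<psi> : K \<Rightarrow> K'\<close>, a 2-cell \<open>K \<circ> H \<Rightarrow> K' \<circ> H'\<close>;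
  \<open>K'\<close> and \<open>H'\<close> are the arguments.
\<close>

definition hcomp ::
  "('r, 'x) ring_scheme \<Rightarrow> ('r, 'a, 'ah) lincat \<Rightarrow> ('r, 'b, 'bh) lincat \<Rightarrow> ('r, 'c, 'ch) lincat \<Rightarrow>
   ('r, 'b, 'bh, 'c, 'ch, 'k2) vmod \<Rightarrow> ('r, 'a, 'ah, 'b, 'bh, 'h2) vmod \<Rightarrow>
   ('c \<Rightarrow> 'b \<Rightarrow> 'k \<Rightarrow> 'k2) \<Rightarrow> ('b \<Rightarrow> 'a \<Rightarrow> 'h \<Rightarrow> 'h2) \<Rightarrow>
   'c \<Rightarrow> 'a \<Rightarrow> ('b \<times> 'h \<times> 'k \<Rightarrow> 'r) set \<Rightarrow> ('b \<times> 'h2 \<times> 'k2 \<Rightarrow> 'r) set" where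
  "hcomp R \<A> \<B> \<C> K' H' \<psi> \<phi> C A =
     coend_map R (coend_mod R \<A> \<B> \<C> K' H' C A)
       (\<lambda>(B, h, k). coend_tens R \<A> \<B> \<C> K' H' C A B (\<phi> B A h) (\<psi> C B k))"

definition id_two_cell :: "'b \<Rightarrow> 'a \<Rightarrow> 'h \<Rightarrow> 'h" where
  "id_two_cell B A h = h"

text \<open>The unit constraints \<open>1\<^sub>\<B> \<circ> H \<Rightarrow> H\<close> and \<open>H \<circ> 1\<^sub>\<A> \<Rightarrow> H\<close>.\<close>

definition left_unitor ::
  "('r, 'x) ring_scheme \<Rightarrow> ('r, 'a, 'ah) lincat \<Rightarrow> ('r, 'b, 'bh) lincat \<Rightarrow>
   ('r, 'a, 'ah, 'b, 'bh, 'h) vmod \<Rightarrow> 'b \<Rightarrow> 'a \<Rightarrow> ('b \<times> 'h \<times> 'bh \<Rightarrow> 'r) set \<Rightarrow> 'h" where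
  "left_unitor R \<A> \<B> H B A =
     coend_map R (Val H B A) (\<lambda>(B', h, b). Act H B' A B A b (LId \<A> A) h)"

definition right_unitor ::
  "('r, 'x) ring_scheme \<Rightarrow> ('r, 'a, 'ah) lincat \<Rightarrow> ('r, 'b, 'bh) lincat \<Rightarrow>
   ('r, 'a, 'ah, 'b, 'bh, 'h) vmod \<Rightarrow> 'b \<Rightarrow> 'a \<Rightarrow> ('a \<times> 'ah \<times> 'h \<Rightarrow> 'r) set \<Rightarrow> 'h" where
  "right_unitor R \<A> \<B> H B A =
     coend_map R (Val H B A) (\<lambda>(A', a, h). Act H B A' B A (LId \<B> B) a h)"

text \<open>
  The associativity constraint \<open>(L \<circ> K) \<circ> H \<Rightarrow> L \<circ> (K \<circ> H)\<close>, which is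
  \<open>[h \<otimes> [k \<otimes> l]] \<mapsto> [[h \<otimes> k] \<otimes> l]\<close>, and its inverse, for \<open>H : \<A> \<rightarrow> \<B>\<close>,
  \<open>K : \<B> \<rightarrow> \<C>\<close>, \<open>L : \<C> \<rightarrow> \<D>\<close>.
\<close>

definition associator ::
  "('r, 'x) ring_scheme \<Rightarrow> ('r, 'a, 'ah) lincat \<Rightarrow> ('r, 'b, 'bh) lincat \<Rightarrow> ('r, 'c, 'ch) lincat \<Rightarrow>
   ('r, 'd, 'dh) lincat \<Rightarrow> ('r, 'c, 'ch, 'd, 'dh, 'l) vmod \<Rightarrow> ('r, 'b, 'bh, 'c, 'ch, 'k) vmod \<Rightarrow>
   ('r, 'a, 'ah, 'b, 'bh, 'h) vmod \<Rightarrow> 'd \<Rightarrow> 'a \<Rightarrow>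
   ('b \<times> 'h \<times> ('c \<times> 'k \<times> 'l \<Rightarrow> 'r) set \<Rightarrow> 'r) set \<Rightarrow>
   ('c \<times> ('b \<times> 'h \<times> 'k \<Rightarrow> 'r) set \<times> 'l \<Rightarrow> 'r) set" where
  "associator R \<A> \<B> \<C> \<D> L K H D A =
     (let T = coend_mod R \<A> \<C> \<D> L (mod_comp R \<A> \<B> \<C> K H) D A in
      coend_map R T (\<lambda>(B, h, Y). coend_map R T (\<lambda>(C, k, l).
        coend_tens R \<A> \<C> \<D> L (mod_comp R \<A> \<B> \<C> K H) D A C
          (coend_tens R \<A> \<B> \<C> K H C A B h k) l) Y))"

definition associator_inv ::
  "('r, 'x) ring_scheme \<Rightarrow> ('r, 'a, 'ah) lincat \<Rightarrow> ('r, 'b, 'bh) lincat \<Rightarrow> ('r, 'c, 'ch) lincat \<Rightarrow>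
   ('r, 'd, 'dh) lincat \<Rightarrow> ('r, 'c, 'ch, 'd, 'dh, 'l) vmod \<Rightarrow> ('r, 'b, 'bh, 'c, 'ch, 'k) vmod \<Rightarrow>
   ('r, 'a, 'ah, 'b, 'bh, 'h) vmod \<Rightarrow> 'd \<Rightarrow> 'a \<Rightarrow>
   ('c \<times> ('b \<times> 'h \<times> 'k \<Rightarrow> 'r) set \<times> 'l \<Rightarrow> 'r) set \<Rightarrow>
   ('b \<times> 'h \<times> ('c \<times> 'k \<times> 'l \<Rightarrow> 'r) set \<Rightarrow> 'r) set" where
  "associator_inv R \<A> \<B> \<C> \<D> L K H D A =
     (let T = coend_mod R \<A> \<B> \<D> (mod_comp R \<B> \<C> \<D> L K) H D A in
      coend_map R T (\<lambda>(C, X, l). coend_map R T (\<lambda>(B, h, k).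
        coend_tens R \<A> \<B> \<D> (mod_comp R \<B> \<C> \<D> L K) H D A B
          h (coend_tens R \<B> \<C> \<D> L K D B C k l)) X))"

text \<open>
  Adjunctions \<open>H \<stileturn> K\<close> with \<open>H : \<A> \<rightarrow> \<B>\<close>, unit \<open>\<eta> : 1 \<Rightarrow> K \<circ> H\<close> and counit
  \<open>\<epsilon> : H \<circ> K \<Rightarrow> 1\<close>.  The triangle identities are stated as equalities of 2-cells
  \<open>H \<circ> 1 \<Rightarrow> H\<close> and \<open>1 \<circ> K \<Rightarrow> K\<close>.
\<close>

locale mod_adjunction =
  left: linear_category R \<A> + right: linear_category R \<B> +
  ladj: vmodule R \<A> \<B> H + radj: vmodule R \<B> \<A> K +
  unit: two_cell R \<A> \<A> "id_mod \<A>" "mod_comp R \<A> \<B> \<A> K H" \<eta> +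
  counit: two_cell R \<B> \<B> "mod_comp R \<B> \<A> \<B> H K" "id_mod \<B>" \<epsilon>
  for R :: "('r, 'x) ring_scheme"
    and \<A> :: "('r, 'a, 'ah) lincat" and \<B> :: "('r, 'b, 'bh) lincat"
    and H :: "('r, 'a, 'ah, 'b, 'bh, 'h) vmod" and K :: "('r, 'b, 'bh, 'a, 'ah, 'k) vmod"
    and \<eta> :: "'a \<Rightarrow> 'a \<Rightarrow> 'ah \<Rightarrow> ('b \<times> 'h \<times> 'k \<Rightarrow> 'r) set"
    and \<epsilon> :: "'b \<Rightarrow> 'b \<Rightarrow> ('a \<times> 'k \<times> 'h \<Rightarrow> 'r) set \<Rightarrow> 'bh" +
  assumes triangle_left:
      "\<lbrakk>B \<in> LOb \<B>; A \<in> LOb \<A>; x \<in> carrier (Val (mod_comp R \<A> \<A> \<B> H (id_mod \<A>)) B A)\<rbrakk>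
        \<Longrightarrow> left_unitor R \<A> \<B> H B A
             (hcomp R \<A> \<B> \<B> (id_mod \<B>) H \<epsilon> id_two_cell B A
               (associator_inv R \<A> \<B> \<A> \<B> H K H B A
                 (hcomp R \<A> \<A> \<B> H (mod_comp R \<A> \<B> \<A> K H) id_two_cell \<eta> B A x)))
          = right_unitor R \<A> \<B> H B A x"
    and triangle_right:
      "\<lbrakk>A \<in> LOb \<A>; B \<in> LOb \<B>; y \<in> carrier (Val (mod_comp R \<B> \<A> \<A> (id_mod \<A>) K) A B)\<rbrakk>
        \<Longrightarrow> right_unitor R \<B> \<A> K A B
             (hcomp R \<B> \<B> \<A> K (id_mod \<B>) id_two_cell \<epsilon> A B
               (associator R \<B> \<A> \<B> \<A> K H K A B
                 (hcomp R \<B> \<A> \<A> (mod_comp R \<A> \<B> \<A> K H) K \<eta> id_two_cell A B y)))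
          = left_unitor R \<B> \<A> K A B y"

locale mod_adjoint_equivalence = mod_adjunction +
  assumes unit_invertible:
      "invertible_two_cell R \<A> \<A> (id_mod \<A>) (mod_comp R \<A> \<B> \<A> K H) \<eta>"
    and counit_invertible:
      "invertible_two_cell R \<B> \<B> (mod_comp R \<B> \<A> \<B> H K) (id_mod \<B>) \<epsilon>"

section \<open>The modules associated with a factorization system\<close>

text \<open>The linear category \<open>R C\<close>.\<close>

definition linearize ::
  "('r, 'x) ring_scheme \<Rightarrow> ('o, 'm) cat \<Rightarrow> ('r, 'o, 'm \<Rightarrow> 'r) lincat" where
  "linearize R C =
     \<lparr>LOb = Ob C,
      LHom = (\<lambda>A B. free_mod R (Arr C A B)),
      LId = (\<lambda>A. gen R (Idn C A)),
      LCmp = (\<lambda>A B D y x. let N = free_mod R (Arr C A D) in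
        lin_ext R N (\<lambda>g. lin_ext R N (\<lambda>f. gen R (Cmp C g f)) x) y)\<rparr>"

definition groupoid_part :: "('o, 'm) cat \<Rightarrow> 'm set \<Rightarrow> 'm set \<Rightarrow> ('o, 'm) cat" where
  "groupoid_part F Es Ms = wide_subcat F (Es \<inter> Ms)"

locale idempotent_axiom =
  fixes R :: "('r, 'x) ring_scheme" and F :: "('o, 'm) cat" and Es Ms :: "'m set"
    and p :: "'o \<Rightarrow> 'm \<Rightarrow> 'r"
  assumes p_hom: "A \<in> Ob F \<Longrightarrow> p A \<in> LArr (linearize R F) A A"
    and p0: "A \<in> Ob F \<Longrightarrow> LCmp (linearize R F) A A A (p A) (p A) = p A"
    and p1: "\<lbrakk>A \<in> Ob F; B \<in> Ob F; f \<in> Arr F A B; f \<notin> Ms\<rbrakk>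
      \<Longrightarrow> LCmp (linearize R F) A A B (gen R f) (p A) = \<zero>\<^bsub>LHom (linearize R F) A B\<^esub>"
    and p2: "\<lbrakk>A \<in> Ob F; B \<in> Ob F; f \<in> Arr F A B; f \<notin> Es\<rbrakk>
      \<Longrightarrow> LCmp (linearize R F) A B B (p B) (gen R f) = \<zero>\<^bsub>LHom (linearize R F) A B\<^esub>"
    and p3: "\<lbrakk>A \<in> Ob F; B \<in> Ob F; g \<in> Arr F A B; g \<in> Es \<inter> Ms\<rbrakk>
      \<Longrightarrow> LCmp (linearize R F) A A B (gen R g) (p A)
        = LCmp (linearize R F) A B B (p B) (gen R g)"
    and p4: "A \<in> Ob F
      \<Longrightarrow> LId (linearize R F) A \<ominus>\<^bsub>LHom (linearize R F) A A\<^esub> p A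
        \<in> carrier (free_mod R {f \<in> Arr F A A. f \<notin> Es \<and> f \<notin> Ms})"

text \<open>
  \<open>M(A, B) = R \<M>(A, B)\<close>, where \<open>M(g, f)\<close> is the trilinear extension of \<open>m \<mapsto> f m g\<close>,
  the latter being replaced by \<open>0\<close> when it is not in \<open>\<M>\<close>; dually for \<open>E\<close>.
\<close>

definition M_mod ::
  "('r, 'x) ring_scheme \<Rightarrow> ('o, 'm) cat \<Rightarrow> 'm set \<Rightarrow>
   ('r, 'o, 'm \<Rightarrow> 'r, 'o, 'm \<Rightarrow> 'r, 'm \<Rightarrow> 'r) vmod" where
  "M_mod R F Ms =
     \<lparr>Val = (\<lambda>A B. free_mod R (Arr F A B \<inter> Ms)),
      Act = (\<lambda>A B A' B' y x z. let N = free_mod R (Arr F A' B' \<inter> Ms) in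
        lin_ext R N (\<lambda>g. lin_ext R N (\<lambda>f. lin_ext R N (\<lambda>m.
          if Cmp F f (Cmp F m g) \<in> Ms then gen R (Cmp F f (Cmp F m g)) else \<zero>\<^bsub>N\<^esub>) z) x) y)\<rparr>"

definition E_mod ::
  "('r, 'x) ring_scheme \<Rightarrow> ('o, 'm) cat \<Rightarrow> 'm set \<Rightarrow>
   ('r, 'o, 'm \<Rightarrow> 'r, 'o, 'm \<Rightarrow> 'r, 'm \<Rightarrow> 'r) vmod" where
  "E_mod R F Es =
     \<lparr>Val = (\<lambda>B A. free_mod R (Arr F B A \<inter> Es)),
      Act = (\<lambda>B A B' A' y x z. let N = free_mod R (Arr F B' A' \<inter> Es) in
        lin_ext R N (\<lambda>f. lin_ext R N (\<lambda>g. lin_ext R N (\<lambda>e.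
          if Cmp F g (Cmp F e f) \<in> Es then gen R (Cmp F g (Cmp F e f)) else \<zero>\<^bsub>N\<^esub>) z) x) y)\<rparr>"

text \<open>The unit \<open>g \<mapsto> [g \<otimes> 1\<^sub>C]\<close> of \<open>E \<stileturn> M\<close> on \<open>g : C \<rightarrow> D\<close> in \<open>\<G>\<close>.\<close>

definition EM_unit ::
  "('r, 'x) ring_scheme \<Rightarrow> ('o, 'm) cat \<Rightarrow> 'm set \<Rightarrow> 'm set \<Rightarrow>
   'o \<Rightarrow> 'o \<Rightarrow> ('m \<Rightarrow> 'r) \<Rightarrow> ('o \<times> ('m \<Rightarrow> 'r) \<times> ('m \<Rightarrow> 'r) \<Rightarrow> 'r) set" where
  "EM_unit R F Es Ms C D =
     (let \<F> = linearize R F; \<G> = linearize R (groupoid_part F Es Ms);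
          M = M_mod R F Ms; E = E_mod R F Es
      in lin_ext R (coend_mod R \<G> \<F> \<G> M E C D)
           (\<lambda>g. coend_tens R \<G> \<F> \<G> M E C D C (gen R g) (gen R (Idn F C))))"

text \<open>
  The counit \<open>[m \<otimes> e] \<mapsto> m p\<^sub>C e\<close> of \<open>E \<stileturn> M\<close>; the composite is formed in \<open>R \<F>\<close>,
  which contains the elements of \<open>R \<M>\<close> and \<open>R \<E>\<close>.
\<close>

definition EM_counit ::
  "('r, 'x) ring_scheme \<Rightarrow> ('o, 'm) cat \<Rightarrow> ('o \<Rightarrow> 'm \<Rightarrow> 'r) \<Rightarrow>
   'o \<Rightarrow> 'o \<Rightarrow> ('o \<times> ('m \<Rightarrow> 'r) \<times> ('m \<Rightarrow> 'r) \<Rightarrow> 'r) set \<Rightarrow> ('m \<Rightarrow> 'r)" where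
  "EM_counit R F p A B =
     (let \<F> = linearize R F
      in coend_map R (LHom \<F> A B)
           (\<lambda>(C, m, e). LCmp \<F> A C B m (LCmp \<F> A C C (p C) e)))"

end

theory Submission
  imports Defs
begin

text \<open>
  The inverse of the unit sends \<open>[e \<otimes> m]\<close> to \<open>em\<close> if this composite is in \<open>\<G>\<close>, and to \<open>0\<close> otherwise:
  the coend relation for \<open>m\<close> (respectively \<open>e\<close>), seen as a morphism of \<open>\<F>\<close>, gives
  \<open>[e \<otimes> m] = [em \<otimes> 1]\<close> if \<open>em \<in> \<E>\<close> and \<open>0\<close> if not (respectively \<open>[1 \<otimes> em]\<close> if \<open>em \<in> \<M>\<close> and \<open>0\<close> if not).

  For the counit, choose a factorization \<open>f = m\<^sub>f e\<^sub>f\<close> of every morphism.  The map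
  \<open>\<sigma> : f \<mapsto> [m\<^sub>f \<otimes> e\<^sub>f]\<close> from \<open>R\<F>(A, B)\<close> is onto the coend because factorizations are unique up to \<open>\<G>\<close>.
  Composing it with the counit gives \<open>T : f \<mapsto> m\<^sub>f p e\<^sub>f\<close>.  As \<open>1 - p\<close> is a combination of
  morphisms \<open>h \<notin> \<E>\<close>, \<open>f - T f\<close> is a combination of morphisms \<open>m\<^sub>f h e\<^sub>f\<close> whose image is a
  strictly smaller \<open>\<M>\<close>-subobject of \<open>B\<close>.  These are finite in number, so \<open>T\<close> is
  unipotent, hence bijective, and so is the counit.
\<close>

section \<open>Linear maps\<close>

text \<open>The idempotent enters in three ways. (p3) makes m p e depend only on the class
  [m \<otimes> e]; (p1) and (p2) make the counit natural although \<open>M\<close> and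
  \<open>E\<close> drop composites that leave their class; (p4), besides unipotence, proves the
  triangle identities. The obstacle is that coends are quotients of free modules and maps out of
  them are taken with \<open>the_elem\<close>. Everything about them passes through the universal
  property (\<open>coend_map_tens\<close>, \<open>coend_map_linear\<close>,
  \<open>coend_ext\<close>), and then, as \<open>M\<close>, \<open>E\<close> and the homs have free
  values, through identities between single morphisms (\<open>bilinear_free_ext\<close>,
  \<open>trilinear_free_ext\<close>). The map \<sigma> rests on arbitrary choices and no naturality
  is proved for it. It serves to make the components of the counit bijective; a 2-cell with
  bijective components has a natural inverse (\<open>invertible_two_cellI\<close>). Strict descent
  of subobjects is measured by a natural number, the count of subobjects contained in an image,
  which gives a filtration with finitely many levels.\<close>

lemma abelian_group_minus_eq_zeroD:
  assumes "abelian_group G" "x \<in> carrier G" "y \<in> carrier G" "x \<ominus>\<^bsub>G\<^esub> y = \<zero>\<^bsub>G\<^esub>"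
  shows "x = y"
proof -
  interpret abelian_group G by fact
  show ?thesis
    using assms by (metis a_inv_closed minus_eq minus_equality minus_minus)
qed

lemma linear_mapI:
  assumes "\<And>x. x \<in> carrier M \<Longrightarrow> f x \<in> carrier N"
    and "\<And>x y. \<lbrakk>x \<in> carrier M; y \<in> carrier M\<rbrakk> \<Longrightarrow> f (x \<oplus>\<^bsub>M\<^esub> y) = f x \<oplus>\<^bsub>N\<^esub> f y"
    and "\<And>r x. \<lbrakk>r \<in> carrier R; x \<in> carrier M\<rbrakk> \<Longrightarrow> f (r \<odot>\<^bsub>M\<^esub> x) = r \<odot>\<^bsub>N\<^esub> f x"
  shows "linear_map R M N f"
  using assms unfolding linear_map_def by blast

lemma linear_map_closed: "\<lbrakk>linear_map R M N f; x \<in> carrier M\<rbrakk> \<Longrightarrow> f x \<in> carrier N"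
  unfolding linear_map_def by blast

lemma linear_map_add:
  "\<lbrakk>linear_map R M N f; x \<in> carrier M; y \<in> carrier M\<rbrakk> \<Longrightarrow> f (x \<oplus>\<^bsub>M\<^esub> y) = f x \<oplus>\<^bsub>N\<^esub> f y"
  unfolding linear_map_def by blast

lemma linear_map_smult:
  "\<lbrakk>linear_map R M N f; r \<in> carrier R; x \<in> carrier M\<rbrakk> \<Longrightarrow> f (r \<odot>\<^bsub>M\<^esub> x) = r \<odot>\<^bsub>N\<^esub> f x"
  unfolding linear_map_def by blast

lemma linear_map_zero:
  assumes "module R M" "module R N" "linear_map R M N f"
  shows "f \<zero>\<^bsub>M\<^esub> = \<zero>\<^bsub>N\<^esub>"
proof -
  interpret M: module R M by fact
  interpret N: module R N by fact
  have "f (\<zero>\<^bsub>R\<^esub> \<odot>\<^bsub>M\<^esub> \<zero>\<^bsub>M\<^esub>) = \<zero>\<^bsub>R\<^esub> \<odot>\<^bsub>N\<^esub> f \<zero>\<^bsub>M\<^esub>"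
    using assms(3) by (rule linear_map_smult) simp_all
  with linear_map_closed[OF assms(3) M.zero_closed] show ?thesis by simp
qed

lemma linear_map_minus:
  assumes "module R M" "module R N" "linear_map R M N f" "x \<in> carrier M" "y \<in> carrier M"
  shows "f (x \<ominus>\<^bsub>M\<^esub> y) = f x \<ominus>\<^bsub>N\<^esub> f y"
proof -
  interpret M: module R M by fact
  interpret N: module R N by fact
  have fy: "f y \<in> carrier N" "f (\<ominus>\<^bsub>M\<^esub> y) \<in> carrier N"
    using assms by (auto intro: linear_map_closed)
  have "f (\<ominus>\<^bsub>M\<^esub> y) \<oplus>\<^bsub>N\<^esub> f y = f (\<ominus>\<^bsub>M\<^esub> y \<oplus>\<^bsub>M\<^esub> y)"
    using assms by (simp add: linear_map_add)
  also have "\<dots> = \<zero>\<^bsub>N\<^esub>"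
    using assms by (simp add: M.l_neg linear_map_zero)
  finally have "f (\<ominus>\<^bsub>M\<^esub> y) = \<ominus>\<^bsub>N\<^esub> f y"
    using fy by (simp add: N.minus_equality)
  then show ?thesis
    using assms by (simp add: a_minus_def linear_map_add)
qed

lemma linear_map_comp:
  "\<lbrakk>linear_map R M N f; linear_map R N P g\<rbrakk> \<Longrightarrow> linear_map R M P (\<lambda>x. g (f x))"
  unfolding linear_map_def by simp

lemma linear_map_ident: "linear_map R M M (\<lambda>x. x)"
  unfolding linear_map_def by simp

text \<open>\<open>linear_map\<close> looks only at values on the carrier, and the module hypothesis
  keeps sums and multiples there. Needed because formulas such as \<open>comp_act_tens\<close> hold
  only for arguments in the carrier.\<close>

lemma linear_map_cong:
  assumes "module R M" "\<And>x. x \<in> carrier M \<Longrightarrow> f x = g x"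
  shows "linear_map R M N f \<longleftrightarrow> linear_map R M N g"
proof -
  interpret M: module R M by fact
  show ?thesis
    unfolding linear_map_def using assms(2) by auto
qed

lemma linear_map_add_fun:
  assumes "module R N" "linear_map R M N f" "linear_map R M N g"
  shows "linear_map R M N (\<lambda>x. f x \<oplus>\<^bsub>N\<^esub> g x)"
proof -
  interpret N: module R N by fact
  note cl = assms(2,3)[THEN linear_map_closed]
  show ?thesis
    using assms(2,3)
    by (intro linear_mapI)
      (simp_all add: cl linear_map_add linear_map_smult N.smult_r_distr N.a_ac)
qed

lemma linear_map_smult_fun:
  assumes "module R N" "linear_map R M N f" "r \<in> carrier R"
  shows "linear_map R M N (\<lambda>x. r \<odot>\<^bsub>N\<^esub> f x)"
proof -
  interpret N: module R N by fact
  note cl = assms(2)[THEN linear_map_closed]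
  show ?thesis
    using assms(2,3)
    by (intro linear_mapI)
      (simp_all add: cl linear_map_add linear_map_smult N.smult_r_distr N.m_comm
        flip: N.smult_assoc1)
qed

lemma linear_map_zero_fun:
  assumes "module R N"
  shows "linear_map R M N (\<lambda>x. \<zero>\<^bsub>N\<^esub>)"
proof -
  interpret N: module R N by fact
  show ?thesis by (intro linear_mapI) simp_all
qed

lemma kernel_submodule:
  assumes "module R M" "module R N" "linear_map R M N f"
  shows "submodule {x \<in> carrier M. f x = \<zero>\<^bsub>N\<^esub>} R M"
proof -
  interpret M: module R M by fact
  interpret N: module R N by fact
  have "f (\<ominus>\<^bsub>M\<^esub> a) = \<zero>\<^bsub>N\<^esub>" if "a \<in> carrier M" "f a = \<zero>\<^bsub>N\<^esub>" for a
    using linear_map_minus[OF assms M.zero_closed that(1)] linear_map_zero[OF assms] that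
    by (simp add: a_minus_def)
  then show ?thesis
    using assms
    by (intro M.submoduleI) (auto simp: linear_map_zero linear_map_add linear_map_smult)
qed

lemma linear_map_minus_fun:
  assumes "module R N" "linear_map R M N f" "linear_map R M N g"
  shows "linear_map R M N (\<lambda>x. f x \<ominus>\<^bsub>N\<^esub> g x)"
proof -
  interpret N: module R N by fact
  note cl = assms(2,3)[THEN linear_map_closed]
  show ?thesis
    using assms(2,3)
    by (intro linear_mapI)
      (simp_all add: cl linear_map_add linear_map_smult N.smult_r_distr N.smult_r_minus
        N.minus_eq N.minus_add N.a_ac)
qed

lemma image_submodule:
  assumes "module R M" "module R N" "linear_map R M N f"
  shows "submodule (f ` carrier M) R N"
proof -
  interpret M: module R M by fact
  interpret N: module R N by fact
  note cl = linear_map_closed[OF assms(3)]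
  show ?thesis
  proof (rule N.submoduleI)
    show "\<zero>\<^bsub>N\<^esub> \<in> f ` carrier M"
      using linear_map_zero[OF assms] M.zero_closed by (metis imageI)
    show "\<ominus>\<^bsub>N\<^esub> a \<in> f ` carrier M" if "a \<in> f ` carrier M" for a
    proof -
      from that obtain x where x: "x \<in> carrier M" "a = f x" by blast
      then have "\<ominus>\<^bsub>N\<^esub> a = f (\<ominus>\<^bsub>M\<^esub> x)"
        using linear_map_minus[OF assms M.zero_closed x(1)] linear_map_zero[OF assms] cl
        by (simp add: M.minus_eq N.minus_eq)
      with x show ?thesis by blast
    qed
  qed (use cl linear_map_add[OF assms(3), symmetric] linear_map_smult[OF assms(3), symmetric] in auto)
qed

lemma linear_map_inverse:
  assumes "module R M" "module R N" "linear_map R M N f" "bij_betw f (carrier M) (carrier N)"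
  shows "linear_map R N M (inv_into (carrier M) f)"
proof -
  interpret M: module R M by fact
  interpret N: module R N by fact
  let ?g = "inv_into (carrier M) f"
  have inj: "inj_on f (carrier M)" and im: "f ` carrier M = carrier N"
    using assms(4) by (auto simp: bij_betw_def)
  have g: "?g y \<in> carrier M" "f (?g y) = y" if "y \<in> carrier N" for y
    using that im by (auto intro: inv_into_into f_inv_into_f)
  show ?thesis
  proof (rule linear_mapI)
    fix x y assume xy: "x \<in> carrier N" "y \<in> carrier N"
    then show "?g (x \<oplus>\<^bsub>N\<^esub> y) = ?g x \<oplus>\<^bsub>M\<^esub> ?g y"
      by (intro inj_onD[OF inj]) (simp_all add: g linear_map_add[OF assms(3)])
  next
    fix r x assume "r \<in> carrier R" "x \<in> carrier N"
    then show "?g (r \<odot>\<^bsub>N\<^esub> x) = r \<odot>\<^bsub>M\<^esub> ?g x"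
      by (intro inj_onD[OF inj]) (simp_all add: g linear_map_smult[OF assms(3)])
  qed (rule g)
qed

text \<open>\<open>D\<close> lowers the filtration by one level, so it is nilpotent and 1 +
  \<open>D\<close> is invertible. In place of a geometric series, injectivity and surjectivity are
  each shown by climbing the levels \<open>V k\<close>.\<close>

lemma filtered_unipotent_bij:
  assumes N: "module R N" and D: "linear_map R N N D"
    and sub: "\<And>k. submodule (V k) R N"
    and up: "\<And>k. V k \<subseteq> V (Suc k)"
    and V0: "V 0 = {\<zero>\<^bsub>N\<^esub>}" and Vn: "V n = carrier N"
    and lower: "\<And>k x. x \<in> V (Suc k) \<Longrightarrow> D x \<in> V k"
  shows "bij_betw (\<lambda>x. x \<oplus>\<^bsub>N\<^esub> D x) (carrier N) (carrier N)"
proof -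
  interpret N: module R N by fact
  let ?T = "\<lambda>x. x \<oplus>\<^bsub>N\<^esub> D x"
  have T: "linear_map R N N ?T"
    using N linear_map_ident D by (rule linear_map_add_fun)
  note VE = N.submoduleE[OF sub]
  have mono: "V k \<subseteq> carrier N" for k
    by (rule VE(1))
  have zeroV: "\<zero>\<^bsub>N\<^esub> \<in> V k" for k
    using VE(2)[of k] VE(4)[of "\<zero>\<^bsub>R\<^esub>"] mono[of k] by force
  have ker: "x = \<zero>\<^bsub>N\<^esub>" if "x \<in> V k" "?T x = \<zero>\<^bsub>N\<^esub>" for k x
    using that
  proof (induction k)
    case 0
    then show ?case using V0 by simp
  next
    case (Suc k)
    have x: "x \<in> carrier N" "D x \<in> carrier N"
      using Suc.prems mono D by (auto intro: linear_map_closed)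
    \<comment> \<open>A kernel element equals -\<open>D x\<close>, so it already lies one level
      lower.\<close>
    then have "x = \<ominus>\<^bsub>N\<^esub> D x"
      using Suc.prems(2) by (metis N.minus_equality)
    with lower[OF Suc.prems(1)] VE(3) have "x \<in> V k" by metis
    with Suc show ?case by blast
  qed
  have onto: "\<exists>z \<in> V k. ?T z = x" if "x \<in> V k" for k x
    using that
  proof (induction k arbitrary: x)
    case 0
    have "?T \<zero>\<^bsub>N\<^esub> = \<zero>\<^bsub>N\<^esub>" using linear_map_zero[OF N N T] .
    with 0 V0 show ?case by auto
  next
    case (Suc k)
    \<comment> \<open>The candidate \<open>x\<close> is corrected by a preimage \<open>z\<close> of
      \<open>D x\<close> from the lower level: (1 + D)(x - z) = x + D x - D x = x.\<close>
    obtain z where z: "z \<in> V k" "?T z = D x"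
      using Suc.IH[OF lower[OF Suc.prems]] by blast
    have c: "x \<in> carrier N" "z \<in> carrier N" "D x \<in> carrier N"
      using Suc.prems z(1) mono D by (auto intro: linear_map_closed)
    have "?T (x \<ominus>\<^bsub>N\<^esub> z) = ?T x \<ominus>\<^bsub>N\<^esub> ?T z"
      using linear_map_minus[OF N N T c(1,2)] .
    also have "\<dots> = x"
      using c by (simp add: z(2) N.minus_eq N.a_assoc N.r_neg)
    finally show ?case
      using Suc.prems z(1) up[of k] VE(5)[of x "Suc k"] VE(3)[of z "Suc k"]
      by (auto simp: a_minus_def)
  qed
  have "inj_on ?T (carrier N)"
  proof (rule inj_onI)
    fix x y assume xy: "x \<in> carrier N" "y \<in> carrier N" "?T x = ?T y"
    then have "?T (x \<ominus>\<^bsub>N\<^esub> y) = \<zero>\<^bsub>N\<^esub>"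
      using linear_map_minus[OF N N T xy(1,2)] linear_map_closed[OF T xy(2)]
      by (simp add: N.minus_eq N.r_neg)
    then have "x \<ominus>\<^bsub>N\<^esub> y = \<zero>\<^bsub>N\<^esub>"
      using ker[of "x \<ominus>\<^bsub>N\<^esub> y" n] Vn xy by simp
    then show "x = y"
      using abelian_group_minus_eq_zeroD[OF N.abelian_group_axioms] xy(1,2) by blast
  qed
  moreover have "?T ` carrier N = carrier N"
    using onto[where k = n] Vn linear_map_closed[OF T] by auto
  ultimately show ?thesis by (simp add: bij_betw_def)
qed

section \<open>Free modules\<close>

lemma free_mod_sel:
  "zero (free_mod R X) = (\<lambda>a. \<zero>\<^bsub>R\<^esub>)"
  "add (free_mod R X) = (\<lambda>x y a. x a \<oplus>\<^bsub>R\<^esub> y a)"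
  "smult (free_mod R X) = (\<lambda>r x a. r \<otimes>\<^bsub>R\<^esub> x a)"
  by (simp_all add: free_mod_def)

lemma free_mod_carrier:
  "x \<in> carrier (free_mod R X) \<longleftrightarrow>
     (\<forall>a. x a \<in> carrier R) \<and> (\<forall>a. a \<notin> X \<longrightarrow> x a = \<zero>\<^bsub>R\<^esub>) \<and> finite {a. x a \<noteq> \<zero>\<^bsub>R\<^esub>}"
  by (simp add: free_mod_def)

lemma free_module:
  fixes R (structure)
  assumes "cring R"
  shows "module R (free_mod R X)"
proof -
  interpret cring R by fact
  have fin_add: "finite {a. x a \<oplus> y a \<noteq> \<zero>}"
    if "finite {a. x a \<noteq> \<zero>}" "finite {a. y a \<noteq> \<zero>}" "\<forall>a. x a \<in> carrier R" "\<forall>a. y a \<in> carrier R"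
    for x y :: "'c \<Rightarrow> 'a"
    by (rule finite_subset[OF _ finite_UnI[OF that(1,2)]]) auto
  have fin_smult: "finite {a. r \<otimes> x a \<noteq> \<zero>}"
    if "finite {a. x a \<noteq> \<zero>}" "r \<in> carrier R" for x :: "'c \<Rightarrow> 'a" and r
    by (rule finite_subset[OF _ that(1)]) (use that in auto)
  show ?thesis
  proof (rule moduleI)
    show "abelian_group (free_mod R X)"
    proof (rule abelian_groupI)
      fix x assume x: "x \<in> carrier (free_mod R X)"
      have "{a. \<ominus> x a \<noteq> \<zero>} \<subseteq> {a. x a \<noteq> \<zero>}" by auto
      with x have "(\<lambda>a. \<ominus> x a) \<in> carrier (free_mod R X)"
        by (auto simp: free_mod_carrier intro: finite_subset)
      moreover have "(\<lambda>a. \<ominus> x a) \<oplus>\<^bsub>free_mod R X\<^esub> x = \<zero>\<^bsub>free_mod R X\<^esub>"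
        using x by (simp add: free_mod_carrier free_mod_sel l_neg)
      ultimately show "\<exists>y \<in> carrier (free_mod R X). y \<oplus>\<^bsub>free_mod R X\<^esub> x = \<zero>\<^bsub>free_mod R X\<^esub>"
        by blast
    qed (simp_all add: free_mod_carrier free_mod_sel fin_add a_ac)
  qed (simp_all add: assms free_mod_carrier free_mod_sel fin_smult l_distr r_distr m_assoc)
qed

lemma free_mod_mono: "X \<subseteq> Y \<Longrightarrow> carrier (free_mod R X) \<subseteq> carrier (free_mod R Y)"
  by (auto simp: free_mod_carrier subset_iff)

lemma free_mod_submodule:
  assumes "cring R" "X \<subseteq> Y"
  shows "submodule (carrier (free_mod R X)) R (free_mod R Y)"
proof -
  interpret cring R by fact
  interpret X: module R "free_mod R X" by (rule free_module) fact
  interpret Y: module R "free_mod R Y" by (rule free_module) fact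
  \<comment> \<open>Negation is defined with reference to the carrier, unlike addition and scaling,
    so its agreement in the two modules needs uniqueness of inverses.\<close>
  have "\<ominus>\<^bsub>free_mod R Y\<^esub> x = \<ominus>\<^bsub>free_mod R X\<^esub> x" if "x \<in> carrier (free_mod R X)" for x
    using that free_mod_mono[OF assms(2), of R] X.l_neg[OF that]
    by (intro Y.minus_equality) (auto simp: free_mod_sel)
  then show ?thesis
    using free_mod_mono[OF assms(2), of R]
      X.zero_closed X.a_closed X.smult_closed
    by (intro Y.submoduleI) (auto simp: free_mod_sel)
qed

text \<open>\<open>X\<close> is arbitrary because the zero of a free module is the same function for
  every generating set. This will be level 0 of the filtration by rank.\<close>

lemma free_mod_empty: "cring R \<Longrightarrow> carrier (free_mod R {}) = {\<zero>\<^bsub>free_mod R X\<^esub>}"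
  using cring.cring_simprules(2)[of R] by (auto simp: free_mod_carrier free_mod_sel)

lemma gen_closed:
  fixes R (structure)
  assumes "cring R" "a \<in> X"
  shows "gen R a \<in> carrier (free_mod R X)"
proof -
  interpret cring R by fact
  have "{b. gen R a b \<noteq> \<zero>} \<subseteq> {a}" by (auto simp: gen_def)
  with assms show ?thesis
    by (auto simp: free_mod_carrier gen_def intro: finite_subset)
qed

text \<open>Induction on the finite support: setting one coordinate to zero splits off a multiple of
  a generator.\<close>

lemma free_mod_induct [consumes 2, case_names zero gen add smult]:
  fixes R (structure)
  assumes "cring R" "x \<in> carrier (free_mod R X)"
    and zero: "P \<zero>\<^bsub>free_mod R X\<^esub>"
    and gen: "\<And>a. a \<in> X \<Longrightarrow> P (gen R a)"
    and add: "\<And>x y. \<lbrakk>x \<in> carrier (free_mod R X); y \<in> carrier (free_mod R X); P x; P y\<rbrakk>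
      \<Longrightarrow> P (x \<oplus>\<^bsub>free_mod R X\<^esub> y)"
    and smult: "\<And>r x. \<lbrakk>r \<in> carrier R; x \<in> carrier (free_mod R X); P x\<rbrakk>
      \<Longrightarrow> P (r \<odot>\<^bsub>free_mod R X\<^esub> x)"
  shows "P x"
proof -
  interpret cring R by fact
  interpret X: module R "free_mod R X" by (rule free_module) fact
  have "finite {a. x a \<noteq> \<zero>}" using assms(2) by (simp add: free_mod_carrier)
  then show ?thesis
    using assms(2)
  proof (induction "{a. x a \<noteq> \<zero>}" arbitrary: x rule: finite_induct)
    case empty
    then have "x = \<zero>\<^bsub>free_mod R X\<^esub>" by (auto simp: free_mod_sel)
    with zero show ?case by simp
  next
    case (insert a S)
    let ?y = "x(a := \<zero>)" and ?z = "x a \<odot>\<^bsub>free_mod R X\<^esub> gen R a"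
    have a: "a \<in> X" "x a \<in> carrier R"
      using insert by (auto simp: free_mod_carrier)
    have S: "S = {b. ?y b \<noteq> \<zero>}" using insert by auto
    have y: "?y \<in> carrier (free_mod R X)"
      using insert.prems insert.hyps(1) S by (auto simp: free_mod_carrier)
    have z: "?z \<in> carrier (free_mod R X)" "gen R a \<in> carrier (free_mod R X)"
      using a gen_closed[OF assms(1) a(1)] by simp_all
    have "x = ?z \<oplus>\<^bsub>free_mod R X\<^esub> ?y"
      using insert.prems by (auto simp: free_mod_sel free_mod_carrier gen_def fun_eq_iff)
    moreover have "P ?z" using a z gen by (intro smult)
    moreover have "P ?y" using insert.hyps(3)[OF S y] .
    ultimately show ?case using add[OF z(1) y] by simp
  qed
qed

lemma linear_map_free_ext:
  assumes "cring R" "module R N"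
    and "linear_map R (free_mod R X) N f" "linear_map R (free_mod R X) N g"
    and "\<And>a. a \<in> X \<Longrightarrow> f (gen R a) = g (gen R a)"
    and "x \<in> carrier (free_mod R X)"
  shows "f x = g x"
  using assms(1,6)
proof (induction rule: free_mod_induct)
  case zero
  show ?case
    using linear_map_zero[OF free_module[OF assms(1)] assms(2)] assms(3,4) by metis
qed (use assms(3-5) in \<open>simp_all add: linear_map_add linear_map_smult\<close>)

lemma linear_map_free_mono:
  "\<lbrakk>linear_map R (free_mod R Y) N f; X \<subseteq> Y\<rbrakk> \<Longrightarrow> linear_map R (free_mod R X) N f"
  using free_mod_mono[of X Y R]
  by (auto simp: linear_map_def free_mod_sel subset_iff)

lemma linear_map_free_image:
  assumes "cring R" "module R N" "linear_map R (free_mod R X) N f" "submodule V R N"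
    and "\<And>a. a \<in> X \<Longrightarrow> f (gen R a) \<in> V" and "x \<in> carrier (free_mod R X)"
  shows "f x \<in> V"
proof -
  interpret N: module R N by fact
  note V = N.submoduleE[OF assms(4)]
  show ?thesis
    using assms(1,6)
  proof (induction rule: free_mod_induct)
    case zero
    have "\<zero>\<^bsub>N\<^esub> \<in> V"
      using V(2) V(4)[of "\<zero>\<^bsub>R\<^esub>"] V(1) by force
    then show ?case
      using linear_map_zero[OF free_module[OF assms(1)] assms(2,3)] by simp
  qed (use assms(3,5) V(4,5) in \<open>simp_all add: linear_map_add linear_map_smult\<close>)
qed

lemma bilinear_free_ext:
  assumes R: "cring R" and N: "module R N"
    and "\<And>y. y \<in> carrier (free_mod R Y) \<Longrightarrow> linear_map R (free_mod R X) N (\<lambda>x. f x y)"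
    and "\<And>x. x \<in> carrier (free_mod R X) \<Longrightarrow> linear_map R (free_mod R Y) N (\<lambda>y. f x y)"
    and "\<And>y. y \<in> carrier (free_mod R Y) \<Longrightarrow> linear_map R (free_mod R X) N (\<lambda>x. g x y)"
    and "\<And>x. x \<in> carrier (free_mod R X) \<Longrightarrow> linear_map R (free_mod R Y) N (\<lambda>y. g x y)"
    and eq: "\<And>a b. \<lbrakk>a \<in> X; b \<in> Y\<rbrakk> \<Longrightarrow> f (gen R a) (gen R b) = g (gen R a) (gen R b)"
    and x: "x \<in> carrier (free_mod R X)" and y: "y \<in> carrier (free_mod R Y)"
  shows "f x y = g x y"
proof (rule linear_map_free_ext[OF R N assms(3)[OF y] assms(5)[OF y] _ x])
  fix a assume a: "a \<in> X"
  note ga = gen_closed[OF R a]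
  show "f (gen R a) y = g (gen R a) y"
    by (rule linear_map_free_ext[OF R N assms(4)[OF ga] assms(6)[OF ga] eq[OF a] y])
qed

text \<open>Reduces identities between composites and actions to single morphisms. In the later uses
  the two functions are given explicitly, because a goal of this shape does not determine how it
  depends on each variable.\<close>

lemma trilinear_free_ext:
  assumes R: "cring R" and N: "module R N"
    and "\<And>y z. \<lbrakk>y \<in> carrier (free_mod R Y); z \<in> carrier (free_mod R Z)\<rbrakk>
      \<Longrightarrow> linear_map R (free_mod R X) N (\<lambda>x. f x y z)"
    and "\<And>x z. \<lbrakk>x \<in> carrier (free_mod R X); z \<in> carrier (free_mod R Z)\<rbrakk>
      \<Longrightarrow> linear_map R (free_mod R Y) N (\<lambda>y. f x y z)"
    and "\<And>x y. \<lbrakk>x \<in> carrier (free_mod R X); y \<in> carrier (free_mod R Y)\<rbrakk>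
      \<Longrightarrow> linear_map R (free_mod R Z) N (\<lambda>z. f x y z)"
    and "\<And>y z. \<lbrakk>y \<in> carrier (free_mod R Y); z \<in> carrier (free_mod R Z)\<rbrakk>
      \<Longrightarrow> linear_map R (free_mod R X) N (\<lambda>x. g x y z)"
    and "\<And>x z. \<lbrakk>x \<in> carrier (free_mod R X); z \<in> carrier (free_mod R Z)\<rbrakk>
      \<Longrightarrow> linear_map R (free_mod R Y) N (\<lambda>y. g x y z)"
    and "\<And>x y. \<lbrakk>x \<in> carrier (free_mod R X); y \<in> carrier (free_mod R Y)\<rbrakk>
      \<Longrightarrow> linear_map R (free_mod R Z) N (\<lambda>z. g x y z)"
    and eq: "\<And>a b c. \<lbrakk>a \<in> X; b \<in> Y; c \<in> Z\<rbrakk>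
      \<Longrightarrow> f (gen R a) (gen R b) (gen R c) = g (gen R a) (gen R b) (gen R c)"
    and x: "x \<in> carrier (free_mod R X)" and y: "y \<in> carrier (free_mod R Y)"
    and z: "z \<in> carrier (free_mod R Z)"
  shows "f x y z = g x y z"
proof (rule linear_map_free_ext[OF R N assms(3)[OF y z] assms(6)[OF y z] _ x])
  fix a assume a: "a \<in> X"
  note ga = gen_closed[OF R a]
  show "f (gen R a) y z = g (gen R a) y z"
    by (rule bilinear_free_ext[OF R N assms(4)[OF ga] assms(5)[OF ga] assms(7)[OF ga] assms(8)[OF ga]
          eq[OF a] y z])
qed

text \<open>The support changes under addition and scaling. Over a common finite superset the
  additional terms vanish, and sums for different vectors become comparable term by term.\<close>

lemma lin_ext_superset:
  assumes "module R N" "\<And>a. a \<in> S \<Longrightarrow> \<phi> a \<in> carrier N" "\<forall>a. x a \<in> carrier R"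
    and "finite S" "{a. x a \<noteq> \<zero>\<^bsub>R\<^esub>} \<subseteq> S"
  shows "lin_ext R N \<phi> x = (\<Oplus>\<^bsub>N\<^esub> a \<in> S. x a \<odot>\<^bsub>N\<^esub> \<phi> a)"
proof -
  interpret N: module R N by fact
  show ?thesis
    unfolding lin_ext_def
    by (rule N.add.finprod_mono_neutral_cong_left) (use assms in auto)
qed

lemma lin_ext_linear:
  assumes "module R N" "\<And>a. a \<in> X \<Longrightarrow> \<phi> a \<in> carrier N"
  shows "linear_map R (free_mod R X) N (lin_ext R N \<phi>)"
proof -
  interpret N: module R N by fact
  interpret X: module R "free_mod R X" by (rule free_module) (rule N.is_cring)
  note sup = lin_ext_superset[OF assms(1)]
  show ?thesis
  proof (rule linear_mapI)
    fix x assume "x \<in> carrier (free_mod R X)"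
    then show "lin_ext R N \<phi> x \<in> carrier N"
      unfolding lin_ext_def using assms(2)
      by (intro N.finsum_closed) (auto simp: free_mod_carrier)
  next
    fix x y assume xy: "x \<in> carrier (free_mod R X)" "y \<in> carrier (free_mod R X)"
    define S where "S = {a. x a \<noteq> \<zero>\<^bsub>R\<^esub>} \<union> {a. y a \<noteq> \<zero>\<^bsub>R\<^esub>}"
    have S: "finite S" "S \<subseteq> X" "\<forall>a. x a \<in> carrier R" "\<forall>a. y a \<in> carrier R"
      using xy by (auto simp: S_def free_mod_carrier)
    have \<phi>: "\<phi> a \<in> carrier N" if "a \<in> S" for a using that S(2) assms(2) by blast
    have "lin_ext R N \<phi> (x \<oplus>\<^bsub>free_mod R X\<^esub> y) = (\<Oplus>\<^bsub>N\<^esub> a \<in> S. (x a \<oplus>\<^bsub>R\<^esub> y a) \<odot>\<^bsub>N\<^esub> \<phi> a)"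
      unfolding free_mod_sel by (rule sup) (use S \<phi> in \<open>auto simp: S_def\<close>)
    also have "\<dots> = (\<Oplus>\<^bsub>N\<^esub> a \<in> S. x a \<odot>\<^bsub>N\<^esub> \<phi> a \<oplus>\<^bsub>N\<^esub> y a \<odot>\<^bsub>N\<^esub> \<phi> a)"
      by (rule N.finsum_cong') (use S \<phi> in \<open>auto simp: N.smult_l_distr\<close>)
    also have "\<dots> = (\<Oplus>\<^bsub>N\<^esub> a \<in> S. x a \<odot>\<^bsub>N\<^esub> \<phi> a) \<oplus>\<^bsub>N\<^esub> (\<Oplus>\<^bsub>N\<^esub> a \<in> S. y a \<odot>\<^bsub>N\<^esub> \<phi> a)"
      by (rule N.finsum_addf) (use S \<phi> in auto)
    also have "(\<Oplus>\<^bsub>N\<^esub> a \<in> S. x a \<odot>\<^bsub>N\<^esub> \<phi> a) = lin_ext R N \<phi> x"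
      by (rule sup[symmetric]) (use S \<phi> in \<open>auto simp: S_def\<close>)
    also have "(\<Oplus>\<^bsub>N\<^esub> a \<in> S. y a \<odot>\<^bsub>N\<^esub> \<phi> a) = lin_ext R N \<phi> y"
      by (rule sup[symmetric]) (use S \<phi> in \<open>auto simp: S_def\<close>)
    finally show "lin_ext R N \<phi> (x \<oplus>\<^bsub>free_mod R X\<^esub> y) = lin_ext R N \<phi> x \<oplus>\<^bsub>N\<^esub> lin_ext R N \<phi> y" .
  next
    fix r x assume rx: "r \<in> carrier R" "x \<in> carrier (free_mod R X)"
    define S where "S = {a. x a \<noteq> \<zero>\<^bsub>R\<^esub>}"
    have S: "finite S" "S \<subseteq> X" "\<forall>a. x a \<in> carrier R"
      using rx by (auto simp: S_def free_mod_carrier)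
    have \<phi>: "\<phi> a \<in> carrier N" if "a \<in> S" for a using that S(2) assms(2) by blast
    have "lin_ext R N \<phi> (r \<odot>\<^bsub>free_mod R X\<^esub> x) = (\<Oplus>\<^bsub>N\<^esub> a \<in> S. (r \<otimes>\<^bsub>R\<^esub> x a) \<odot>\<^bsub>N\<^esub> \<phi> a)"
      unfolding free_mod_sel by (rule sup) (use S \<phi> rx in \<open>auto simp: S_def\<close>)
    also have "\<dots> = (\<Oplus>\<^bsub>N\<^esub> a \<in> S. r \<odot>\<^bsub>N\<^esub> (x a \<odot>\<^bsub>N\<^esub> \<phi> a))"
      by (rule N.finsum_cong') (use S \<phi> rx in \<open>auto simp: N.smult_assoc1\<close>)
    also have "\<dots> = r \<odot>\<^bsub>N\<^esub> (\<Oplus>\<^bsub>N\<^esub> a \<in> S. x a \<odot>\<^bsub>N\<^esub> \<phi> a)"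
      by (rule N.finsum_smult_ldistr[symmetric]) (use S \<phi> rx in auto)
    finally show "lin_ext R N \<phi> (r \<odot>\<^bsub>free_mod R X\<^esub> x) = r \<odot>\<^bsub>N\<^esub> lin_ext R N \<phi> x"
      by (simp add: lin_ext_def S_def)
  qed
qed

lemma lin_ext_gen:
  assumes "module R N" "\<phi> a \<in> carrier N"
  shows "lin_ext R N \<phi> (gen R a) = \<phi> a"
proof -
  interpret N: module R N by fact
  have "lin_ext R N \<phi> (gen R a) = (\<Oplus>\<^bsub>N\<^esub> b \<in> {a}. gen R a b \<odot>\<^bsub>N\<^esub> \<phi> b)"
    by (rule lin_ext_superset[OF assms(1)]) (use assms in \<open>auto simp: gen_def\<close>)
  then show ?thesis using assms by (simp add: gen_def)
qed

text \<open>A nested \<open>lin_ext\<close> is linear in its outermost vector by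
  \<open>lin_ext_linear\<close>. This gives linearity in the inner vectors, on which the summand
  \<open>\<psi> a z\<close> depends.\<close>

lemma lin_ext_linear_param:
  assumes "module R M" "module R N" "\<And>a. a \<in> X \<Longrightarrow> linear_map R M N (\<lambda>z. \<psi> a z)"
    and "x \<in> carrier (free_mod R X)"
  shows "linear_map R M N (\<lambda>z. lin_ext R N (\<lambda>a. \<psi> a z) x)"
proof -
  interpret N: module R N by fact
  let ?S = "{a. x a \<noteq> \<zero>\<^bsub>R\<^esub>}"
  have x: "finite ?S" "?S \<subseteq> X" "\<And>a. x a \<in> carrier R"
    using assms(4) by (auto simp: free_mod_carrier)
  have lin: "linear_map R M N (\<lambda>z. x a \<odot>\<^bsub>N\<^esub> \<psi> a z)" if "a \<in> ?S" for a
    using assms(2,3) x that by (intro linear_map_smult_fun) auto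
  \<comment> \<open>Generalized from the support to its subsets, so that finite induction
    applies.\<close>
  have "linear_map R M N (\<lambda>z. \<Oplus>\<^bsub>N\<^esub> a \<in> S. x a \<odot>\<^bsub>N\<^esub> \<psi> a z)" if "finite S" "S \<subseteq> ?S" for S
    using that
  proof (induction rule: finite_induct)
    case empty
    then show ?case using linear_map_zero_fun[OF assms(2)] by simp
  next
    case (insert a S)
    have "linear_map R M N (\<lambda>z. x a \<odot>\<^bsub>N\<^esub> \<psi> a z \<oplus>\<^bsub>N\<^esub> (\<Oplus>\<^bsub>N\<^esub> a \<in> S. x a \<odot>\<^bsub>N\<^esub> \<psi> a z))"
      using insert lin assms(2) by (intro linear_map_add_fun) auto
    moreover have "(\<Oplus>\<^bsub>N\<^esub> a \<in> insert a S. x a \<odot>\<^bsub>N\<^esub> \<psi> a z)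
        = x a \<odot>\<^bsub>N\<^esub> \<psi> a z \<oplus>\<^bsub>N\<^esub> (\<Oplus>\<^bsub>N\<^esub> a \<in> S. x a \<odot>\<^bsub>N\<^esub> \<psi> a z)" if "z \<in> carrier M" for z
      using insert linear_map_closed[OF lin that] by (intro N.finsum_insert) auto
    ultimately show ?case
      using linear_map_cong[OF assms(1)] by (metis (no_types, lifting))
  qed
  from this[OF x(1) subset_refl] show ?thesis by (simp add: lin_ext_def)
qed

section \<open>Quotient modules\<close>

lemma submod_span_submodule:
  assumes "module R M" "S \<subseteq> carrier M"
  shows "submodule (submod_span R M S) R M"
proof -
  interpret M: module R M by fact
  \<comment> \<open>The carrier itself is in the family, so the intersection defining the span stays
    inside \<open>M\<close>.\<close>
  have car: "submodule (carrier M) R M"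
    by (rule M.submoduleI) auto
  have zero: "\<zero>\<^bsub>M\<^esub> \<in> N" if "submodule N R M" for N
    using that unfolding submodule_def subgroup_def by simp
  show ?thesis
  proof (rule M.submoduleI)
    show "submod_span R M S \<subseteq> carrier M"
      unfolding submod_span_def using car assms(2) by blast
  qed (auto simp: submod_span_def zero M.submoduleE)
qed

lemma submod_span_superset: "S \<subseteq> submod_span R M S"
  by (auto simp: submod_span_def)

lemma submod_span_least: "\<lbrakk>submodule N R M; S \<subseteq> N\<rbrakk> \<Longrightarrow> submod_span R M S \<subseteq> N"
  by (auto simp: submod_span_def)

text \<open>\<open>quot_mod\<close> is built from additive cosets; the sublocale below opens up the
  coset calculus of \<open>abelian_subgroup\<close>.\<close>

locale quotient_module = module R M for R (structure) and M :: "('a, 'c) module" (structure) +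
  fixes N
  assumes sub: "submodule N R M"
begin

sublocale abelian_subgroup N M
  by (rule abelian_subgroupI3)
    (use sub in \<open>simp_all add: submodule_def additive_subgroup_def M.abelian_group_axioms\<close>)

lemma quot_carrier: "carrier (quot_mod M N) = (\<lambda>x. N +>\<^bsub>M\<^esub> x) ` carrier M"
  by (auto simp: quot_mod_def A_RCOSETS_def')

lemma quot_add:
  "\<lbrakk>x \<in> carrier M; y \<in> carrier M\<rbrakk>
    \<Longrightarrow> (N +>\<^bsub>M\<^esub> x) \<oplus>\<^bsub>quot_mod M N\<^esub> (N +>\<^bsub>M\<^esub> y) = N +>\<^bsub>M\<^esub> (x \<oplus>\<^bsub>M\<^esub> y)"
  by (simp add: quot_mod_def a_rcos_sum)

lemma quot_eqI:
  assumes "x \<in> carrier M" "y \<in> carrier M" "x \<ominus>\<^bsub>M\<^esub> y \<in> N"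
  shows "N +>\<^bsub>M\<^esub> x = N +>\<^bsub>M\<^esub> y"
  using assms a_rcos_module_rev[of y x] a_repr_independence'[of x y]
  by (simp add: a_minus_def)

text \<open>All representatives of a coset contribute the same coset to the union that defines
  scalar multiplication, and \<open>x\<close> itself is one of them.\<close>

lemma quot_smult:
  assumes "r \<in> carrier R" "x \<in> carrier M"
  shows "r \<odot>\<^bsub>quot_mod M N\<^esub> (N +>\<^bsub>M\<^esub> x) = N +>\<^bsub>M\<^esub> (r \<odot>\<^bsub>M\<^esub> x)"
proof -
  have "N +>\<^bsub>M\<^esub> (r \<odot>\<^bsub>M\<^esub> y) = N +>\<^bsub>M\<^esub> (r \<odot>\<^bsub>M\<^esub> x)" if y: "y \<in> N +>\<^bsub>M\<^esub> x" for y
  proof -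
    have yc: "y \<in> carrier M" using a_elemrcos_carrier[OF assms(2) y] .
    have "y \<ominus>\<^bsub>M\<^esub> x \<in> N" using a_rcos_module_imp[OF assms(2) y] by (simp add: a_minus_def)
    then have "r \<odot>\<^bsub>M\<^esub> (y \<ominus>\<^bsub>M\<^esub> x) \<in> N"
      using sub assms(1) by (simp add: submodule.smult_closed)
    moreover have "r \<odot>\<^bsub>M\<^esub> (y \<ominus>\<^bsub>M\<^esub> x) = r \<odot>\<^bsub>M\<^esub> y \<ominus>\<^bsub>M\<^esub> r \<odot>\<^bsub>M\<^esub> x"
      using assms yc by (simp add: a_minus_def smult_r_distr smult_r_minus)
    ultimately show ?thesis
      using assms yc by (intro quot_eqI) auto
  qed
  then have "(\<Union>y \<in> N +>\<^bsub>M\<^esub> x. N +>\<^bsub>M\<^esub> (r \<odot>\<^bsub>M\<^esub> y)) = (\<Union>y \<in> N +>\<^bsub>M\<^esub> x. N +>\<^bsub>M\<^esub> (r \<odot>\<^bsub>M\<^esub> x))"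
    by (intro SUP_cong refl)
  also have "\<dots> = N +>\<^bsub>M\<^esub> (r \<odot>\<^bsub>M\<^esub> x)"
    using a_rcos_self[OF assms(2)] by blast
  finally show ?thesis by (simp add: quot_mod_def)
qed

lemma quot_zero: "\<zero>\<^bsub>quot_mod M N\<^esub> = N +>\<^bsub>M\<^esub> \<zero>\<^bsub>M\<^esub>"
  using a_rcos_const[OF zero_closed] by (simp add: quot_mod_def)

lemma quot_rep: "X \<in> carrier (quot_mod M N) \<Longrightarrow> \<exists>x \<in> carrier M. X = N +>\<^bsub>M\<^esub> x"
  by (auto simp: quot_carrier)

lemma quot_carrierI: "x \<in> carrier M \<Longrightarrow> N +>\<^bsub>M\<^esub> x \<in> carrier (quot_mod M N)"
  by (auto simp: quot_carrier)

lemma quot_module: "module R (quot_mod M N)"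
proof (rule moduleI)
  show "abelian_group (quot_mod M N)"
  proof (rule abelian_groupI)
    fix X assume "X \<in> carrier (quot_mod M N)"
    then obtain x where x: "x \<in> carrier M" "X = N +>\<^bsub>M\<^esub> x" by (blast dest: quot_rep)
    then show "\<zero>\<^bsub>quot_mod M N\<^esub> \<oplus>\<^bsub>quot_mod M N\<^esub> X = X"
      by (simp add: quot_add quot_zero)
    have "(N +>\<^bsub>M\<^esub> (\<ominus>\<^bsub>M\<^esub> x)) \<oplus>\<^bsub>quot_mod M N\<^esub> X = \<zero>\<^bsub>quot_mod M N\<^esub>"
      using x by (simp add: quot_add quot_zero M.l_neg)
    with x show "\<exists>Y \<in> carrier (quot_mod M N). Y \<oplus>\<^bsub>quot_mod M N\<^esub> X = \<zero>\<^bsub>quot_mod M N\<^esub>"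
      by (meson M.a_inv_closed quot_carrierI)
  next
    fix X Y assume "X \<in> carrier (quot_mod M N)" "Y \<in> carrier (quot_mod M N)"
    then obtain x y where xy: "x \<in> carrier M" "X = N +>\<^bsub>M\<^esub> x" "y \<in> carrier M" "Y = N +>\<^bsub>M\<^esub> y"
      by (blast dest: quot_rep)
    have eq: "X \<oplus>\<^bsub>quot_mod M N\<^esub> Y = N +>\<^bsub>M\<^esub> (x \<oplus>\<^bsub>M\<^esub> y)" "Y \<oplus>\<^bsub>quot_mod M N\<^esub> X = N +>\<^bsub>M\<^esub> (y \<oplus>\<^bsub>M\<^esub> x)"
      unfolding xy(2,4) by (intro quot_add xy(1,3))+
    show "X \<oplus>\<^bsub>quot_mod M N\<^esub> Y \<in> carrier (quot_mod M N)"
      unfolding eq using xy(1,3) by (intro quot_carrierI M.a_closed)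
    show "X \<oplus>\<^bsub>quot_mod M N\<^esub> Y = Y \<oplus>\<^bsub>quot_mod M N\<^esub> X"
      unfolding eq using M.a_comm[OF xy(1,3)] by (rule arg_cong)
  next
    fix X Y Z
    assume XYZ: "X \<in> carrier (quot_mod M N)" "Y \<in> carrier (quot_mod M N)" "Z \<in> carrier (quot_mod M N)"
    from XYZ[THEN quot_rep] obtain x y z where "x \<in> carrier M" "X = N +>\<^bsub>M\<^esub> x" "y \<in> carrier M" "Y = N +>\<^bsub>M\<^esub> y"
      "z \<in> carrier M" "Z = N +>\<^bsub>M\<^esub> z"
      by blast
    then show "X \<oplus>\<^bsub>quot_mod M N\<^esub> Y \<oplus>\<^bsub>quot_mod M N\<^esub> Z = X \<oplus>\<^bsub>quot_mod M N\<^esub> (Y \<oplus>\<^bsub>quot_mod M N\<^esub> Z)"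
      by (simp add: quot_add M.a_assoc)
  qed (simp add: quot_zero quot_carrierI)
next
  fix r X assume "r \<in> carrier R" "X \<in> carrier (quot_mod M N)"
  then show "r \<odot>\<^bsub>quot_mod M N\<^esub> X \<in> carrier (quot_mod M N)"
    by (auto dest!: quot_rep simp: quot_smult quot_carrierI)
next
  fix r s X assume rs: "r \<in> carrier R" "s \<in> carrier R" and "X \<in> carrier (quot_mod M N)"
  then obtain x where x: "x \<in> carrier M" "X = N +>\<^bsub>M\<^esub> x" by (blast dest: quot_rep)
  show "(r \<oplus>\<^bsub>R\<^esub> s) \<odot>\<^bsub>quot_mod M N\<^esub> X
      = r \<odot>\<^bsub>quot_mod M N\<^esub> X \<oplus>\<^bsub>quot_mod M N\<^esub> s \<odot>\<^bsub>quot_mod M N\<^esub> X"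
    using rs x by (simp add: quot_add quot_smult smult_l_distr)
  show "(r \<otimes>\<^bsub>R\<^esub> s) \<odot>\<^bsub>quot_mod M N\<^esub> X = r \<odot>\<^bsub>quot_mod M N\<^esub> (s \<odot>\<^bsub>quot_mod M N\<^esub> X)"
    using rs x by (simp add: quot_smult smult_assoc1)
next
  fix r X Y
  assume r: "r \<in> carrier R" and XY: "X \<in> carrier (quot_mod M N)" "Y \<in> carrier (quot_mod M N)"
  from XY[THEN quot_rep] obtain x y where "x \<in> carrier M" "X = N +>\<^bsub>M\<^esub> x" "y \<in> carrier M" "Y = N +>\<^bsub>M\<^esub> y"
    by blast
  then show "r \<odot>\<^bsub>quot_mod M N\<^esub> (X \<oplus>\<^bsub>quot_mod M N\<^esub> Y)
      = r \<odot>\<^bsub>quot_mod M N\<^esub> X \<oplus>\<^bsub>quot_mod M N\<^esub> r \<odot>\<^bsub>quot_mod M N\<^esub> Y"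
    using r by (simp add: quot_add quot_smult smult_r_distr)
next
  fix X assume "X \<in> carrier (quot_mod M N)"
  then show "\<one>\<^bsub>R\<^esub> \<odot>\<^bsub>quot_mod M N\<^esub> X = X"
    by (auto dest!: quot_rep simp: quot_smult)
qed (rule R.cring_axioms)

lemma quot_linear: "linear_map R M (quot_mod M N) (\<lambda>x. N +>\<^bsub>M\<^esub> x)"
  by (rule linear_mapI) (simp_all add: quot_carrierI quot_add quot_smult)

text \<open>Two representatives differ by an element of \<open>N\<close>, which \<open>f\<close>
  kills. So the image of a coset is a singleton and \<open>the_elem\<close> reads off its
  value.\<close>

lemma quot_lift:
  assumes "module R P" "linear_map R M P f" "\<And>x. x \<in> N \<Longrightarrow> f x = \<zero>\<^bsub>P\<^esub>" "x \<in> carrier M"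
  shows "the_elem (f ` (N +>\<^bsub>M\<^esub> x)) = f x"
proof -
  interpret P: module R P by fact
  have "f y = f x" if y: "y \<in> N +>\<^bsub>M\<^esub> x" for y
  proof -
    have yc: "y \<in> carrier M" using a_elemrcos_carrier[OF assms(4) y] .
    have "f (y \<ominus>\<^bsub>M\<^esub> x) = \<zero>\<^bsub>P\<^esub>"
      using a_rcos_module_imp[OF assms(4) y] assms(3) by (simp add: a_minus_def)
    then have "f y \<ominus>\<^bsub>P\<^esub> f x = \<zero>\<^bsub>P\<^esub>"
      using linear_map_minus[OF module_axioms assms(1,2) yc assms(4)] by simp
    then show ?thesis
      using linear_map_closed[OF assms(2)] yc assms(4)
        abelian_group_minus_eq_zeroD[OF P.abelian_group_axioms, of "f y" "f x"] by blast
  qed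
  then have "f ` (N +>\<^bsub>M\<^esub> x) = (\<lambda>_. f x) ` (N +>\<^bsub>M\<^esub> x)"
    by (rule image_cong[OF refl])
  also have "\<dots> = {f x}"
    using a_rcos_self[OF assms(4)] by (rule image_constant)
  finally show ?thesis by simp
qed

end

section \<open>Coends\<close>

text \<open>The data that the coend represents: families bilinear on each summand and dinatural in
  \<open>B\<close>. These are the \<open>\<phi>\<close> for which \<open>coend_map\<close> is well
  defined.\<close>

definition balanced ::
  "('r, 'x) ring_scheme \<Rightarrow> ('r, 'a, 'ah) lincat \<Rightarrow> ('r, 'b, 'bh) lincat \<Rightarrow> ('r, 'c, 'ch) lincat \<Rightarrow>
   ('r, 'b, 'bh, 'c, 'ch, 'k) vmod \<Rightarrow> ('r, 'a, 'ah, 'b, 'bh, 'h) vmod \<Rightarrow> 'c \<Rightarrow> 'a \<Rightarrow>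
   ('r, 'n) module \<Rightarrow> ('b \<times> 'h \<times> 'k \<Rightarrow> 'n) \<Rightarrow> bool" where
  "balanced R \<A> \<B> \<C> K H C A N \<phi> \<longleftrightarrow>
     (\<forall>B \<in> LOb \<B>. \<forall>k \<in> carrier (Val K C B). linear_map R (Val H B A) N (\<lambda>h. \<phi> (B, h, k))) \<and>
     (\<forall>B \<in> LOb \<B>. \<forall>h \<in> carrier (Val H B A). linear_map R (Val K C B) N (\<lambda>k. \<phi> (B, h, k))) \<and>
     (\<forall>B \<in> LOb \<B>. \<forall>B' \<in> LOb \<B>. \<forall>b \<in> LArr \<B> B B'.
        \<forall>h \<in> carrier (Val H B' A). \<forall>k \<in> carrier (Val K C B).
        \<phi> (B, Act H B' A B A b (LId \<A> A) h, k) = \<phi> (B', h, Act K C B C B' (LId \<C> C) b k))"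

lemma balancedI:
  assumes "\<And>B k. \<lbrakk>B \<in> LOb \<B>; k \<in> carrier (Val K C B)\<rbrakk>
      \<Longrightarrow> linear_map R (Val H B A) N (\<lambda>h. \<phi> (B, h, k))"
    and "\<And>B h. \<lbrakk>B \<in> LOb \<B>; h \<in> carrier (Val H B A)\<rbrakk>
      \<Longrightarrow> linear_map R (Val K C B) N (\<lambda>k. \<phi> (B, h, k))"
    and "\<And>B B' b h k. \<lbrakk>B \<in> LOb \<B>; B' \<in> LOb \<B>; b \<in> LArr \<B> B B';
        h \<in> carrier (Val H B' A); k \<in> carrier (Val K C B)\<rbrakk>
      \<Longrightarrow> \<phi> (B, Act H B' A B A b (LId \<A> A) h, k) = \<phi> (B', h, Act K C B C B' (LId \<C> C) b k)"
  shows "balanced R \<A> \<B> \<C> K H C A N \<phi>"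
  unfolding balanced_def using assms by blast

lemma balanced_linear_left:
  "\<lbrakk>balanced R \<A> \<B> \<C> K H C A N \<phi>; B \<in> LOb \<B>; k \<in> carrier (Val K C B)\<rbrakk>
    \<Longrightarrow> linear_map R (Val H B A) N (\<lambda>h. \<phi> (B, h, k))"
  unfolding balanced_def by blast

lemma balanced_linear_right:
  "\<lbrakk>balanced R \<A> \<B> \<C> K H C A N \<phi>; B \<in> LOb \<B>; h \<in> carrier (Val H B A)\<rbrakk>
    \<Longrightarrow> linear_map R (Val K C B) N (\<lambda>k. \<phi> (B, h, k))"
  unfolding balanced_def by blast

lemma balanced_balance:
  "\<lbrakk>balanced R \<A> \<B> \<C> K H C A N \<phi>; B \<in> LOb \<B>; B' \<in> LOb \<B>; b \<in> LArr \<B> B B';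
      h \<in> carrier (Val H B' A); k \<in> carrier (Val K C B)\<rbrakk>
    \<Longrightarrow> \<phi> (B, Act H B' A B A b (LId \<A> A) h, k) = \<phi> (B', h, Act K C B C B' (LId \<C> C) b k)"
  unfolding balanced_def by blast

lemma balanced_closed:
  "\<lbrakk>balanced R \<A> \<B> \<C> K H C A N \<phi>; B \<in> LOb \<B>; h \<in> carrier (Val H B A); k \<in> carrier (Val K C B)\<rbrakk>
    \<Longrightarrow> \<phi> (B, h, k) \<in> carrier N"
  by (rule linear_map_closed[OF balanced_linear_left])

locale composable_modules =
  A: linear_category R \<A> + B: linear_category R \<B> + C: linear_category R \<C> +
  H: vmodule R \<A> \<B> H + K: vmodule R \<B> \<C> K
  for R :: "('r, 'x) ring_scheme"
    and \<A> :: "('r, 'a, 'ah) lincat" and \<B> :: "('r, 'b, 'bh) lincat"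
    and \<C> :: "('r, 'c, 'ch) lincat"
    and H :: "('r, 'a, 'ah, 'b, 'bh, 'h) vmod" and K :: "('r, 'b, 'bh, 'c, 'ch, 'k) vmod" +
  assumes cring: "cring R"
begin

abbreviation "T \<equiv> coend_mod R \<A> \<B> \<C> K H"
abbreviation "tens \<equiv> coend_tens R \<A> \<B> \<C> K H"
abbreviation "bal \<equiv> balanced R \<A> \<B> \<C> K H"

lemma act_left_closed:
  "\<lbrakk>A \<in> LOb \<A>; B \<in> LOb \<B>; B' \<in> LOb \<B>; b \<in> LArr \<B> B B'; h \<in> carrier (Val H B' A)\<rbrakk>
    \<Longrightarrow> Act H B' A B A b (LId \<A> A) h \<in> carrier (Val H B A)"
  by (rule linear_map_closed[OF H.act_linear]) (simp_all add: A.id_hom)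

lemma act_right_closed:
  "\<lbrakk>C \<in> LOb \<C>; B \<in> LOb \<B>; B' \<in> LOb \<B>; b \<in> LArr \<B> B B'; k \<in> carrier (Val K C B)\<rbrakk>
    \<Longrightarrow> Act K C B C B' (LId \<C> C) b k \<in> carrier (Val K C B')"
  by (rule linear_map_closed[OF K.act_linear]) (simp_all add: C.id_hom)

context
  fixes C A
  assumes C: "C \<in> LOb \<C>" and A: "A \<in> LOb \<A>"
begin

abbreviation "FM \<equiv> free_mod R (coend_gens \<B> K H C A)"
abbreviation "Sub \<equiv> coend_sub R \<A> \<B> \<C> K H C A"

abbreviation "qm x \<equiv> Sub +>\<^bsub>FM\<^esub> x"

lemma gens_closed:
  "\<lbrakk>B \<in> LOb \<B>; h \<in> carrier (Val H B A); k \<in> carrier (Val K C B)\<rbrakk> \<Longrightarrow> gen R (B, h, k) \<in> carrier FM"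
  by (rule gen_closed[OF cring]) (simp add: coend_gens_def)

lemma Val_ops:
  assumes "B \<in> LOb \<B>"
  shows "\<lbrakk>h \<in> carrier (Val H B A); h' \<in> carrier (Val H B A)\<rbrakk> \<Longrightarrow> h \<oplus>\<^bsub>Val H B A\<^esub> h' \<in> carrier (Val H B A)"
    and "\<lbrakk>r \<in> carrier R; h \<in> carrier (Val H B A)\<rbrakk> \<Longrightarrow> r \<odot>\<^bsub>Val H B A\<^esub> h \<in> carrier (Val H B A)"
    and "\<lbrakk>k \<in> carrier (Val K C B); k' \<in> carrier (Val K C B)\<rbrakk> \<Longrightarrow> k \<oplus>\<^bsub>Val K C B\<^esub> k' \<in> carrier (Val K C B)"
    and "\<lbrakk>r \<in> carrier R; k \<in> carrier (Val K C B)\<rbrakk> \<Longrightarrow> r \<odot>\<^bsub>Val K C B\<^esub> k \<in> carrier (Val K C B)"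
  using H.val_module[OF assms A] K.val_module[OF C assms]
  by (auto intro: module.smult_closed abelian_monoid.a_closed abelian_group.axioms(1) module.axioms(2))

lemma coend_rels_carrier: "coend_rels R \<A> \<B> \<C> K H C A \<subseteq> carrier FM"
proof
  interpret FM: module R FM by (rule free_module[OF cring])
  fix x assume "x \<in> coend_rels R \<A> \<B> \<C> K H C A"
  then show "x \<in> carrier FM"
    by cases
      (simp_all add: gens_closed Val_ops act_left_closed act_right_closed A C)
qed

lemma quotient_FM: "quotient_module R FM Sub"
  unfolding quotient_module_def quotient_module_axioms_def coend_sub_def
  by (intro conjI submod_span_submodule free_module cring coend_rels_carrier)

lemma coend_module: "module R (T C A)"
  unfolding coend_mod_def by (rule quotient_module.quot_module[OF quotient_FM])

lemma quotient_map_linear: "linear_map R FM (T C A) (\<lambda>x. qm x)"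
  unfolding coend_mod_def by (rule quotient_module.quot_linear[OF quotient_FM])

lemma quotient_map_rel:
  assumes "x \<ominus>\<^bsub>FM\<^esub> y \<in> coend_rels R \<A> \<B> \<C> K H C A" "x \<in> carrier FM" "y \<in> carrier FM"
  shows "qm x = qm y"
proof (rule quotient_module.quot_eqI[OF quotient_FM assms(2,3)])
  show "x \<ominus>\<^bsub>FM\<^esub> y \<in> Sub"
    using assms(1) submod_span_superset unfolding coend_sub_def by (rule rev_subsetD)
qed

text \<open>The universal balanced family. Each rule of \<open>coend_rels\<close> supplies one of
  the required equations in the quotient.\<close>

lemma balanced_tens: "bal C A (T C A) (\<lambda>(B, h, k). tens C A B h k)"
proof -
  interpret FM: module R FM by (rule free_module[OF cring])
  note q = quotient_map_linear
  show ?thesis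
  proof (rule balancedI)
    fix B k assume B: "B \<in> LOb \<B>" and k: "k \<in> carrier (Val K C B)"
    show "linear_map R (Val H B A) (T C A) (\<lambda>h. case (B, h, k) of (B, h, k) \<Rightarrow> tens C A B h k)"
      unfolding prod.case coend_tens_def
    proof (rule linear_mapI)
      fix h assume "h \<in> carrier (Val H B A)"
      then show "qm (gen R (B, h, k)) \<in> carrier (T C A)"
        using linear_map_closed[OF q] gens_closed B k by blast
    next
      fix h h' assume h: "h \<in> carrier (Val H B A)" "h' \<in> carrier (Val H B A)"
      note g = gens_closed[OF B h(1) k] gens_closed[OF B h(2) k]
      have "qm (gen R (B, h \<oplus>\<^bsub>Val H B A\<^esub> h', k)) = qm (gen R (B, h, k) \<oplus>\<^bsub>FM\<^esub> gen R (B, h', k))"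
        using coend_rels.add_left[OF B h k] by (rule quotient_map_rel)
          (use g gens_closed[OF B Val_ops(1)[OF B h] k] in simp_all)
      then show "qm (gen R (B, h \<oplus>\<^bsub>Val H B A\<^esub> h', k))
          = (qm (gen R (B, h, k))) \<oplus>\<^bsub>T C A\<^esub> (qm (gen R (B, h', k)))"
        using linear_map_add[OF q g] by simp
    next
      fix r h assume r: "r \<in> carrier R" and h: "h \<in> carrier (Val H B A)"
      note g = gens_closed[OF B h k]
      have "qm (gen R (B, r \<odot>\<^bsub>Val H B A\<^esub> h, k)) = qm (r \<odot>\<^bsub>FM\<^esub> gen R (B, h, k))"
        using coend_rels.smult_left[OF B r h k] by (rule quotient_map_rel)
          (use r g gens_closed[OF B Val_ops(2)[OF B r h] k] in simp_all)
      then show "qm (gen R (B, r \<odot>\<^bsub>Val H B A\<^esub> h, k))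
          = r \<odot>\<^bsub>T C A\<^esub> (qm (gen R (B, h, k)))"
        using linear_map_smult[OF q r g] by simp
    qed
  next
    fix B h assume B: "B \<in> LOb \<B>" and h: "h \<in> carrier (Val H B A)"
    show "linear_map R (Val K C B) (T C A) (\<lambda>k. case (B, h, k) of (B, h, k) \<Rightarrow> tens C A B h k)"
      unfolding prod.case coend_tens_def
    proof (rule linear_mapI)
      fix k assume "k \<in> carrier (Val K C B)"
      then show "qm (gen R (B, h, k)) \<in> carrier (T C A)"
        using linear_map_closed[OF q] gens_closed B h by blast
    next
      fix k k' assume k: "k \<in> carrier (Val K C B)" "k' \<in> carrier (Val K C B)"
      note g = gens_closed[OF B h k(1)] gens_closed[OF B h k(2)]
      have "qm (gen R (B, h, k \<oplus>\<^bsub>Val K C B\<^esub> k')) = qm (gen R (B, h, k) \<oplus>\<^bsub>FM\<^esub> gen R (B, h, k'))"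
        using coend_rels.add_right[OF B h k] by (rule quotient_map_rel)
          (use g gens_closed[OF B h Val_ops(3)[OF B k]] in simp_all)
      then show "qm (gen R (B, h, k \<oplus>\<^bsub>Val K C B\<^esub> k'))
          = (qm (gen R (B, h, k))) \<oplus>\<^bsub>T C A\<^esub> (qm (gen R (B, h, k')))"
        using linear_map_add[OF q g] by simp
    next
      fix r k assume r: "r \<in> carrier R" and k: "k \<in> carrier (Val K C B)"
      note g = gens_closed[OF B h k]
      have "qm (gen R (B, h, r \<odot>\<^bsub>Val K C B\<^esub> k)) = qm (r \<odot>\<^bsub>FM\<^esub> gen R (B, h, k))"
        using coend_rels.smult_right[OF B r h k] by (rule quotient_map_rel)
          (use r g gens_closed[OF B h Val_ops(4)[OF B r k]] in simp_all)
      then show "qm (gen R (B, h, r \<odot>\<^bsub>Val K C B\<^esub> k))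
          = r \<odot>\<^bsub>T C A\<^esub> (qm (gen R (B, h, k)))"
        using linear_map_smult[OF q r g] by simp
    qed
  next
    fix B B' b h k
    assume BB: "B \<in> LOb \<B>" "B' \<in> LOb \<B>" and b: "b \<in> LArr \<B> B B'"
      and h: "h \<in> carrier (Val H B' A)" and k: "k \<in> carrier (Val K C B)"
    show "(case (B, Act H B' A B A b (LId \<A> A) h, k) of (B, h, k) \<Rightarrow> tens C A B h k)
        = (case (B', h, Act K C B C B' (LId \<C> C) b k) of (B, h, k) \<Rightarrow> tens C A B h k)"
      unfolding prod.case coend_tens_def
      using coend_rels.balance[where R = R and \<A> = \<A> and \<C> = \<C>, OF BB b h k]
      by (rule quotient_map_rel)
        (simp_all add: gens_closed act_left_closed[OF A] act_right_closed[OF C] BB b h k)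
  qed
qed

lemmas tens_linear_left = balanced_linear_left[OF balanced_tens, unfolded prod.case]
lemmas tens_linear_right = balanced_linear_right[OF balanced_tens, unfolded prod.case]
lemmas tens_balance = balanced_balance[OF balanced_tens, unfolded prod.case]
lemmas tens_closed = balanced_closed[OF balanced_tens, unfolded prod.case]

lemma coend_induct [consumes 1, case_names zero tens add smult]:
  assumes "x \<in> carrier (T C A)"
    and zero: "P \<zero>\<^bsub>T C A\<^esub>"
    and tens: "\<And>B h k. \<lbrakk>B \<in> LOb \<B>; h \<in> carrier (Val H B A); k \<in> carrier (Val K C B)\<rbrakk>
      \<Longrightarrow> P (tens C A B h k)"
    and add: "\<And>x y. \<lbrakk>x \<in> carrier (T C A); y \<in> carrier (T C A); P x; P y\<rbrakk> \<Longrightarrow> P (x \<oplus>\<^bsub>T C A\<^esub> y)"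
    and smult: "\<And>r x. \<lbrakk>r \<in> carrier R; x \<in> carrier (T C A); P x\<rbrakk> \<Longrightarrow> P (r \<odot>\<^bsub>T C A\<^esub> x)"
  shows "P x"
proof -
  note q = quotient_map_linear
  from quotient_module.quot_rep[OF quotient_FM, folded coend_mod_def, OF assms(1)]
  obtain y where y: "y \<in> carrier FM" "x = qm y" by blast
  have "P (qm y)"
    using cring y(1)
  proof (induction rule: free_mod_induct)
    case zero
    show ?case
      using linear_map_zero[OF free_module[OF cring] coend_module q] assms(2) by simp
  next
    case (gen t)
    then show ?case
      using tens by (cases t) (auto simp: coend_gens_def coend_tens_def)
  next
    case (add x y)
    then show ?case
      using linear_map_add[OF q] linear_map_closed[OF q] assms(4) by simp
  next
    case (smult r x)
    then show ?case
      using linear_map_smult[OF q] linear_map_closed[OF q] assms(5) by simp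
  qed
  with y show ?thesis by simp
qed

lemma coend_ext:
  assumes "module R N" "linear_map R (T C A) N f" "linear_map R (T C A) N g"
    and "\<And>B h k. \<lbrakk>B \<in> LOb \<B>; h \<in> carrier (Val H B A); k \<in> carrier (Val K C B)\<rbrakk>
      \<Longrightarrow> f (tens C A B h k) = g (tens C A B h k)"
    and "x \<in> carrier (T C A)"
  shows "f x = g x"
  using assms(5)
proof (induction rule: coend_induct)
  case zero
  show ?case
    using linear_map_zero[OF coend_module assms(1)] assms(2,3) by metis
qed (use assms(2-4) in \<open>simp_all add: linear_map_add linear_map_smult\<close>)

context
  fixes N :: "('r, 'n) module" and \<phi>
  assumes N: "module R N" and \<phi>: "bal C A N \<phi>"
begin

interpretation N: module R N by (rule N)

lemma lin_ext_balanced: "linear_map R FM N (lin_ext R N \<phi>)"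
  by (rule lin_ext_linear[OF N]) (auto simp: coend_gens_def intro: balanced_closed[OF \<phi>])

text \<open>The kernel of the linear extension is a submodule containing every relation, hence it
  contains their span. This is what makes \<open>the_elem\<close> in \<open>coend_map\<close>
  legitimate.\<close>

lemma lin_ext_balanced_Sub:
  assumes "x \<in> Sub"
  shows "lin_ext R N \<phi> x = \<zero>\<^bsub>N\<^esub>"
proof -
  interpret FM: module R FM by (rule free_module[OF cring])
  let ?L = "lin_ext R N \<phi>"
  note L = lin_ext_balanced
  note minus = linear_map_minus[OF FM.module_axioms N L]
  note pc = balanced_closed[OF \<phi>]
  have gen: "?L (gen R (B, h, k)) = \<phi> (B, h, k)"
    if "B \<in> LOb \<B>" "h \<in> carrier (Val H B A)" "k \<in> carrier (Val K C B)" for B h k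
    using that by (intro lin_ext_gen N pc)
  note gc = gens_closed
  have "coend_rels R \<A> \<B> \<C> K H C A \<subseteq> {x \<in> carrier FM. ?L x = \<zero>\<^bsub>N\<^esub>}"
  proof
    fix x assume x: "x \<in> coend_rels R \<A> \<B> \<C> K H C A"
    then have "?L x = \<zero>\<^bsub>N\<^esub>"
    proof cases
      case (add_left B h h' k)
      then show ?thesis
        using linear_map_add[OF balanced_linear_left[OF \<phi>]]
        by (simp add: minus gc gen Val_ops linear_map_add[OF L] pc N.r_neg N.minus_eq)
    next
      case (add_right B h k k')
      then show ?thesis
        using linear_map_add[OF balanced_linear_right[OF \<phi>]]
        by (simp add: minus gc gen Val_ops linear_map_add[OF L] pc N.r_neg N.minus_eq)
    next
      case (smult_left B r h k)
      then show ?thesis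
        using linear_map_smult[OF balanced_linear_left[OF \<phi>]]
        by (simp add: minus gc gen Val_ops linear_map_smult[OF L] pc N.r_neg N.minus_eq)
    next
      case (smult_right B r h k)
      then show ?thesis
        using linear_map_smult[OF balanced_linear_right[OF \<phi>]]
        by (simp add: minus gc gen Val_ops linear_map_smult[OF L] pc N.r_neg N.minus_eq)
    next
      case (balance B B' b h k)
      then show ?thesis
        using balanced_balance[OF \<phi>]
        by (simp add: minus gc gen act_left_closed[OF A] act_right_closed[OF C] pc N.r_neg N.minus_eq)
    qed
    with x coend_rels_carrier show "x \<in> {x \<in> carrier FM. ?L x = \<zero>\<^bsub>N\<^esub>}" by blast
  qed
  with kernel_submodule[OF FM.module_axioms N L]
  have "Sub \<subseteq> {x \<in> carrier FM. ?L x = \<zero>\<^bsub>N\<^esub>}"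
    unfolding coend_sub_def by (rule submod_span_least)
  with assms show ?thesis by blast
qed

lemma coend_map_coset:
  "x \<in> carrier FM \<Longrightarrow> coend_map R N \<phi> (qm x) = lin_ext R N \<phi> x"
  unfolding coend_map_def
  by (rule quotient_module.quot_lift[OF quotient_FM N lin_ext_balanced lin_ext_balanced_Sub])

lemma coend_map_tens:
  "\<lbrakk>B \<in> LOb \<B>; h \<in> carrier (Val H B A); k \<in> carrier (Val K C B)\<rbrakk>
    \<Longrightarrow> coend_map R N \<phi> (tens C A B h k) = \<phi> (B, h, k)"
  by (simp add: coend_tens_def coend_map_coset gens_closed lin_ext_gen N balanced_closed[OF \<phi>])

lemma coend_map_linear: "linear_map R (T C A) N (coend_map R N \<phi>)"
proof -
  interpret FM: module R FM by (rule free_module[OF cring])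
  note q = quotient_map_linear
  have rep: "\<exists>y \<in> carrier FM. X = qm y" if "X \<in> carrier (T C A)" for X
    using quotient_module.quot_rep[OF quotient_FM] that unfolding coend_mod_def .
  show ?thesis
  proof (rule linear_mapI)
    fix X assume "X \<in> carrier (T C A)"
    with rep obtain x where "x \<in> carrier FM" "X = qm x" by blast
    then show "coend_map R N \<phi> X \<in> carrier N"
      by (simp add: coend_map_coset linear_map_closed[OF lin_ext_balanced])
  next
    fix X Y assume "X \<in> carrier (T C A)" "Y \<in> carrier (T C A)"
    with rep obtain x y where x: "x \<in> carrier FM" "X = qm x"
      and y: "y \<in> carrier FM" "Y = qm y" by meson
    have "X \<oplus>\<^bsub>T C A\<^esub> Y = qm (x \<oplus>\<^bsub>FM\<^esub> y)"
      using linear_map_add[OF q x(1) y(1)] x y by simp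
    then show "coend_map R N \<phi> (X \<oplus>\<^bsub>T C A\<^esub> Y) = coend_map R N \<phi> X \<oplus>\<^bsub>N\<^esub> coend_map R N \<phi> Y"
      using x y by (simp add: coend_map_coset linear_map_add[OF lin_ext_balanced])
  next
    fix r X assume r: "r \<in> carrier R" and "X \<in> carrier (T C A)"
    with rep obtain x where x: "x \<in> carrier FM" "X = qm x" by blast
    have "r \<odot>\<^bsub>T C A\<^esub> X = qm (r \<odot>\<^bsub>FM\<^esub> x)"
      using linear_map_smult[OF q r x(1)] x by simp
    then show "coend_map R N \<phi> (r \<odot>\<^bsub>T C A\<^esub> X) = r \<odot>\<^bsub>N\<^esub> coend_map R N \<phi> X"
      using r x by (simp add: coend_map_coset linear_map_smult[OF lin_ext_balanced])
  qed
qed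

end

end

end

section \<open>Composition of modules and the constraints of the bicategory\<close>

context vmodule
begin

context
  fixes A A' B B'
  assumes cats: "linear_category R \<A>" "linear_category R \<B>"
    and ob: "A \<in> LOb \<A>" "A' \<in> LOb \<A>" "B \<in> LOb \<B>" "B' \<in> LOb \<B>"
begin

interpretation A: linear_category R \<A> by (rule cats)
interpretation B: linear_category R \<B> by (rule cats)

text \<open>Functoriality with identities inserted in each variable. Together with
  \<open>act_contra_co\<close> it interchanges the two one-sided actions.\<close>

lemma act_co_contra:
  assumes "a \<in> LArr \<A> A A'" "b \<in> LArr \<B> B' B" "h \<in> carrier (Val H B A)"
  shows "Act H B' A B' A' (LId \<B> B') a (Act H B A B' A b (LId \<A> A) h) = Act H B A B' A' b a h"
  using act_cmp[of B A B' A B' A' b "LId \<B> B'" "LId \<A> A" a h] assms ob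
  by (simp add: A.id_hom B.id_hom A.id_right B.id_right)

lemma act_contra_co:
  assumes "a \<in> LArr \<A> A A'" "b \<in> LArr \<B> B' B" "h \<in> carrier (Val H B A)"
  shows "Act H B A' B' A' b (LId \<A> A') (Act H B A B A' (LId \<B> B) a h) = Act H B A B' A' b a h"
  using act_cmp[of B A B A' B' A' "LId \<B> B" b a "LId \<A> A'" h] assms ob
  by (simp add: A.id_hom B.id_hom A.id_left B.id_left)

end

end

lemma mod_comp_sel:
  "Val (mod_comp R \<A> \<B> \<C> K H) = coend_mod R \<A> \<B> \<C> K H"
  "Act (mod_comp R \<A> \<B> \<C> K H) C A C' A' c a = coend_map R (coend_mod R \<A> \<B> \<C> K H C' A')
    (\<lambda>(B, h, k). coend_tens R \<A> \<B> \<C> K H C' A' B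
      (Act H B A B A' (LId \<B> B) a h) (Act K C B C' B c (LId \<B> B) k))"
  by (simp_all add: mod_comp_def)

lemma id_mod_sel:
  "Val (id_mod \<A>) = LHom \<A>"
  "Act (id_mod \<A>) B A B' A' b a h = LCmp \<A> B' A A' a (LCmp \<A> B' B A h b)"
  by (simp_all add: id_mod_def)

context linear_category
begin

lemma cmp_closed:
  "\<lbrakk>A \<in> LOb \<A>; B \<in> LOb \<A>; C \<in> LOb \<A>; f \<in> LArr \<A> A B; g \<in> LArr \<A> B C\<rbrakk>
    \<Longrightarrow> LCmp \<A> A B C g f \<in> LArr \<A> A C"
  by (rule linear_map_closed[OF cmp_linear_left])

lemma id_mod_vmodule: "vmodule R \<A> \<A> (id_mod \<A>)"
proof (rule vmodule.intro; (unfold id_mod_sel)?)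
  fix B A B' A' B'' A'' b b' a a' h
  assume ob: "B \<in> LOb \<A>" "A \<in> LOb \<A>" "B' \<in> LOb \<A>" "A' \<in> LOb \<A>" "B'' \<in> LOb \<A>" "A'' \<in> LOb \<A>"
    and b: "b \<in> LArr \<A> B' B" "b' \<in> LArr \<A> B'' B'"
    and a: "a \<in> LArr \<A> A A'" "a' \<in> LArr \<A> A' A''" and h: "h \<in> LArr \<A> B A"
  have "LCmp \<A> B'' B' A' (LCmp \<A> B' A A' a (LCmp \<A> B' B A h b)) b'
      = LCmp \<A> B'' A A' a (LCmp \<A> B'' B A h (LCmp \<A> B'' B' B b b'))"
    using ob b a h by (simp add: lcmp_assoc cmp_closed)
  then show "LCmp \<A> B'' A A'' (LCmp \<A> A A' A'' a' a) (LCmp \<A> B'' B A h (LCmp \<A> B'' B' B b b'))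
      = LCmp \<A> B'' A' A'' a' (LCmp \<A> B'' B' A' (LCmp \<A> B' A A' a (LCmp \<A> B' B A h b)) b')"
    using ob b a h by (simp add: lcmp_assoc cmp_closed)
qed ((rule hom_module; assumption),
    (rule linear_map_comp[OF cmp_linear_left cmp_linear_right]; assumption),
    (rule linear_map_comp[OF cmp_linear_right cmp_linear_right]; assumption),
    (rule cmp_linear_left[OF _ _ _ cmp_closed]; assumption), simp add: id_left id_right)

end

section \<open>Composites of modules are modules\<close>

context composable_modules
begin

text \<open>The coend counterpart of \<open>lin_ext_linear_param\<close>. Linearity in
  \<open>c\<close> is known on simple tensors only and is carried to arbitrary \<open>x\<close> by
  \<open>coend_induct\<close>, using that each \<open>f c\<close> is linear.\<close>

lemma coend_linear_param:
  assumes "C \<in> LOb \<C>" "A \<in> LOb \<A>" "module R M" "module R N"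
    and "\<And>c. c \<in> carrier M \<Longrightarrow> linear_map R (T C A) N (f c)"
    and "\<And>B h k. \<lbrakk>B \<in> LOb \<B>; h \<in> carrier (Val H B A); k \<in> carrier (Val K C B)\<rbrakk>
      \<Longrightarrow> linear_map R M N (\<lambda>c. f c (tens C A B h k))"
    and "x \<in> carrier (T C A)"
  shows "linear_map R M N (\<lambda>c. f c x)"
proof (rule coend_induct[OF assms(1,2,7)], goal_cases zero tens add smult)
  case zero
  have eq: "f c \<zero>\<^bsub>T C A\<^esub> = \<zero>\<^bsub>N\<^esub>" if "c \<in> carrier M" for c
    using coend_module[OF assms(1,2)] assms(4) assms(5)[OF that] by (rule linear_map_zero)
  then show ?case
    using linear_map_zero_fun[OF assms(4)] by (subst linear_map_cong[OF assms(3) eq])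
next
  case (tens B h k)
  then show ?case by (rule assms(6))
next
  case (add x y)
  have eq: "f c (x \<oplus>\<^bsub>T C A\<^esub> y) = f c x \<oplus>\<^bsub>N\<^esub> f c y" if "c \<in> carrier M" for c
    using assms(5)[OF that] add(1,2) by (rule linear_map_add)
  have "linear_map R M N (\<lambda>c. f c x \<oplus>\<^bsub>N\<^esub> f c y)"
    using assms(4) add(3,4) by (rule linear_map_add_fun)
  then show ?case
    by (subst linear_map_cong[OF assms(3) eq])
next
  case (smult r x)
  have eq: "f c (r \<odot>\<^bsub>T C A\<^esub> x) = r \<odot>\<^bsub>N\<^esub> f c x" if "c \<in> carrier M" for c
    using assms(5)[OF that] smult(1,2) by (rule linear_map_smult)
  have "linear_map R M N (\<lambda>c. r \<odot>\<^bsub>N\<^esub> f c x)"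
    using assms(4) smult(3,1) by (rule linear_map_smult_fun)
  then show ?case
    by (subst linear_map_cong[OF assms(3) eq])
qed

abbreviation "KH \<equiv> mod_comp R \<A> \<B> \<C> K H"

lemma comp_act_closed_left:
  "\<lbrakk>A \<in> LOb \<A>; A' \<in> LOb \<A>; a \<in> LArr \<A> A A'; B \<in> LOb \<B>; h \<in> carrier (Val H B A)\<rbrakk>
    \<Longrightarrow> Act H B A B A' (LId \<B> B) a h \<in> carrier (Val H B A')"
  by (rule linear_map_closed[OF H.act_linear]) (simp_all add: B.id_hom)

lemma comp_act_closed_right:
  "\<lbrakk>C \<in> LOb \<C>; C' \<in> LOb \<C>; c \<in> LArr \<C> C' C; B \<in> LOb \<B>; k \<in> carrier (Val K C B)\<rbrakk>
    \<Longrightarrow> Act K C B C' B c (LId \<B> B) k \<in> carrier (Val K C' B)"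
  by (rule linear_map_closed[OF K.act_linear]) (simp_all add: B.id_hom)

context
  fixes C A C' A' c a
  assumes ob: "C \<in> LOb \<C>" "A \<in> LOb \<A>" "C' \<in> LOb \<C>" "A' \<in> LOb \<A>"
    and c: "c \<in> LArr \<C> C' C" and a: "a \<in> LArr \<A> A A'"
begin

text \<open>Morphisms of \<B> act independently of those of \<A> and \<C>, so the balance relation
  can be applied after the outer actions.\<close>

lemma comp_act_balanced:
  "bal C A (T C' A') (\<lambda>(B, h, k). tens C' A' B
      (Act H B A B A' (LId \<B> B) a h) (Act K C B C' B c (LId \<B> B) k))"
proof (rule balancedI; unfold prod.case)
  fix B k assume B: "B \<in> LOb \<B>" and k: "k \<in> carrier (Val K C B)"
  have k': "Act K C B C' B c (LId \<B> B) k \<in> carrier (Val K C' B)"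
    using K.act_linear[OF ob(1) B ob(3) B c B.id_hom[OF B]] k by (rule linear_map_closed)
  show "linear_map R (Val H B A) (T C' A')
      (\<lambda>h. tens C' A' B (Act H B A B A' (LId \<B> B) a h) (Act K C B C' B c (LId \<B> B) k))"
    using H.act_linear[OF B ob(2) B ob(4) B.id_hom[OF B] a] tens_linear_left[OF ob(3,4) B k']
    by (rule linear_map_comp)
next
  fix B h assume B: "B \<in> LOb \<B>" and h: "h \<in> carrier (Val H B A)"
  have h': "Act H B A B A' (LId \<B> B) a h \<in> carrier (Val H B A')"
    using H.act_linear[OF B ob(2) B ob(4) B.id_hom[OF B] a] h by (rule linear_map_closed)
  show "linear_map R (Val K C B) (T C' A')
      (\<lambda>k. tens C' A' B (Act H B A B A' (LId \<B> B) a h) (Act K C B C' B c (LId \<B> B) k))"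
    using K.act_linear[OF ob(1) B ob(3) B c B.id_hom[OF B]] tens_linear_right[OF ob(3,4) B h']
    by (rule linear_map_comp)
next
  fix B B' b h k
  assume B: "B \<in> LOb \<B>" "B' \<in> LOb \<B>" and b: "b \<in> LArr \<B> B B'"
    and h: "h \<in> carrier (Val H B' A)" and k: "k \<in> carrier (Val K C B)"
  have h': "Act H B' A B' A' (LId \<B> B') a h \<in> carrier (Val H B' A')"
    using H.act_linear[OF B(2) ob(2) B(2) ob(4) B.id_hom[OF B(2)] a] h by (rule linear_map_closed)
  have k': "Act K C B C' B c (LId \<B> B) k \<in> carrier (Val K C' B)"
    using K.act_linear[OF ob(1) B(1) ob(3) B(1) c B.id_hom[OF B(1)]] k by (rule linear_map_closed)
  have "Act H B A B A' (LId \<B> B) a (Act H B' A B A b (LId \<A> A) h)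
      = Act H B' A' B A' b (LId \<A> A') (Act H B' A B' A' (LId \<B> B') a h)"
    using A.linear_category_axioms B.linear_category_axioms ob B a b h
    by (simp add: H.act_co_contra H.act_contra_co)
  moreover have "Act K C' B C' B' (LId \<C> C') b (Act K C B C' B c (LId \<B> B) k)
      = Act K C B' C' B' c (LId \<B> B') (Act K C B C B' (LId \<C> C) b k)"
    using B.linear_category_axioms C.linear_category_axioms ob B b c k
    by (simp add: K.act_co_contra K.act_contra_co)
  ultimately show "tens C' A' B (Act H B A B A' (LId \<B> B) a (Act H B' A B A b (LId \<A> A) h))
        (Act K C B C' B c (LId \<B> B) k)
      = tens C' A' B' (Act H B' A B' A' (LId \<B> B') a h)
        (Act K C B' C' B' c (LId \<B> B') (Act K C B C B' (LId \<C> C) b k))"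
    using tens_balance[OF ob(3,4) B b h' k'] by simp
qed

lemma comp_act_linear:
  "linear_map R (T C A) (T C' A') (Act KH C A C' A' c a)"
  unfolding mod_comp_sel
  by (rule coend_map_linear[OF ob(1,2) coend_module[OF ob(3,4)] comp_act_balanced])

lemma comp_act_tens:
  "\<lbrakk>B \<in> LOb \<B>; h \<in> carrier (Val H B A); k \<in> carrier (Val K C B)\<rbrakk>
    \<Longrightarrow> Act KH C A C' A' c a (tens C A B h k)
      = tens C' A' B (Act H B A B A' (LId \<B> B) a h) (Act K C B C' B c (LId \<B> B) k)"
  unfolding mod_comp_sel
  using coend_map_tens[OF ob(1,2) coend_module[OF ob(3,4)] comp_act_balanced] by simp

end

lemma mod_comp_vmodule: "vmodule R \<A> \<C> KH"
proof (rule vmodule.intro; (unfold mod_comp_sel(1))?)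
  fix C A C' A' a x
  assume ob: "C \<in> LOb \<C>" "A \<in> LOb \<A>" "C' \<in> LOb \<C>" "A' \<in> LOb \<A>"
    and a: "a \<in> LArr \<A> A A'" and x: "x \<in> carrier (T C A)"
  show "linear_map R (LHom \<C> C' C) (T C' A')
      (\<lambda>c. Act KH C A C' A' c a x)"
  proof (rule coend_linear_param[OF ob(1,2) C.hom_module[OF ob(3,1)] coend_module[OF ob(3,4)] _ _ x])
    fix c assume "c \<in> LArr \<C> C' C"
    then show "linear_map R (T C A) (T C' A') (Act KH C A C' A' c a)"
      using ob a by (intro comp_act_linear)
  next
    fix B h k assume B: "B \<in> LOb \<B>" and h: "h \<in> carrier (Val H B A)" and k: "k \<in> carrier (Val K C B)"
    have "linear_map R (LHom \<C> C' C) (T C' A')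
        (\<lambda>c. tens C' A' B (Act H B A B A' (LId \<B> B) a h) (Act K C B C' B c (LId \<B> B) k))"
      using K.act_linear_contra[OF ob(1) B ob(3) B B.id_hom[OF B] k]
        tens_linear_right[OF ob(3,4) B comp_act_closed_left[OF ob(2,4) a B h]]
      by (rule linear_map_comp)
    then show "linear_map R (LHom \<C> C' C) (T C' A')
        (\<lambda>c. Act KH C A C' A' c a (tens C A B h k))"
      by (subst linear_map_cong[OF C.hom_module[OF ob(3,1)] comp_act_tens[OF ob _ a B h k]])
  qed
next
  fix C A C' A' c x
  assume ob: "C \<in> LOb \<C>" "A \<in> LOb \<A>" "C' \<in> LOb \<C>" "A' \<in> LOb \<A>"
    and c: "c \<in> LArr \<C> C' C" and x: "x \<in> carrier (T C A)"
  show "linear_map R (LHom \<A> A A') (T C' A')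
      (\<lambda>a. Act KH C A C' A' c a x)"
  proof (rule coend_linear_param[OF ob(1,2) A.hom_module[OF ob(2,4)] coend_module[OF ob(3,4)] _ _ x])
    fix a assume "a \<in> LArr \<A> A A'"
    then show "linear_map R (T C A) (T C' A') (Act KH C A C' A' c a)"
      using ob c by (intro comp_act_linear)
  next
    fix B h k assume B: "B \<in> LOb \<B>" and h: "h \<in> carrier (Val H B A)" and k: "k \<in> carrier (Val K C B)"
    have "linear_map R (LHom \<A> A A') (T C' A')
        (\<lambda>a. tens C' A' B (Act H B A B A' (LId \<B> B) a h) (Act K C B C' B c (LId \<B> B) k))"
      using H.act_linear_co[OF B ob(2) B ob(4) B.id_hom[OF B] h]
        tens_linear_left[OF ob(3,4) B comp_act_closed_right[OF ob(1,3) c B k]]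
      by (rule linear_map_comp)
    then show "linear_map R (LHom \<A> A A') (T C' A')
        (\<lambda>a. Act KH C A C' A' c a (tens C A B h k))"
      by (subst linear_map_cong[OF A.hom_module[OF ob(2,4)] comp_act_tens[OF ob c _ B h k]])
  qed
next
  fix C A x assume ob: "C \<in> LOb \<C>" "A \<in> LOb \<A>" and x: "x \<in> carrier (T C A)"
  show "Act KH C A C A (LId \<C> C) (LId \<A> A) x = x"
    using ob coend_module[OF ob] comp_act_linear[OF ob ob C.id_hom[OF ob(1)] A.id_hom[OF ob(2)]]
      linear_map_ident _ x
  proof (rule coend_ext)
    fix B h k assume "B \<in> LOb \<B>" "h \<in> carrier (Val H B A)" "k \<in> carrier (Val K C B)"
    then show "Act KH C A C A (LId \<C> C) (LId \<A> A) (tens C A B h k)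
        = tens C A B h k"
      using ob by (simp add: comp_act_tens A.id_hom C.id_hom H.act_id K.act_id)
  qed
next
  fix C A C' A' C'' A'' c c' a a' x
  assume ob: "C \<in> LOb \<C>" "A \<in> LOb \<A>" "C' \<in> LOb \<C>" "A' \<in> LOb \<A>" "C'' \<in> LOb \<C>" "A'' \<in> LOb \<A>"
    and c: "c \<in> LArr \<C> C' C" "c' \<in> LArr \<C> C'' C'"
    and a: "a \<in> LArr \<A> A A'" "a' \<in> LArr \<A> A' A''" and x: "x \<in> carrier (T C A)"
  note cc = C.cmp_closed[OF ob(5,3,1) c(2,1)] and aa = A.cmp_closed[OF ob(2,4,6) a]
  note l1 = comp_act_linear[OF ob(1,2,3,4) c(1) a(1)]
    and l2 = comp_act_linear[OF ob(3,4,5,6) c(2) a(2)]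
  show "Act KH C A C'' A'' (LCmp \<C> C'' C' C c c') (LCmp \<A> A A' A'' a' a) x
      = Act KH C' A' C'' A'' c' a' (Act KH C A C' A' c a x)"
    using ob(1,2) coend_module[OF ob(5,6)] comp_act_linear[OF ob(1,2,5,6) cc aa]
      linear_map_comp[OF l1 l2] _ x
  proof (rule coend_ext)
    fix B h k assume B: "B \<in> LOb \<B>" and h: "h \<in> carrier (Val H B A)" and k: "k \<in> carrier (Val K C B)"
    have "Act H B A B A'' (LId \<B> B) (LCmp \<A> A A' A'' a' a) h
        = Act H B A' B A'' (LId \<B> B) a' (Act H B A B A' (LId \<B> B) a h)"
      using H.act_cmp[OF B ob(2) B ob(4) B ob(6) B.id_hom[OF B] B.id_hom[OF B] a h]
      by (simp add: B.id_left B.id_hom B)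
    moreover have "Act K C B C'' B (LCmp \<C> C'' C' C c c') (LId \<B> B) k
        = Act K C' B C'' B c' (LId \<B> B) (Act K C B C' B c (LId \<B> B) k)"
      using K.act_cmp[OF ob(1) B ob(3) B ob(5) B c B.id_hom[OF B] B.id_hom[OF B] k]
      by (simp add: B.id_left B.id_hom B)
    ultimately show "Act KH C A C'' A'' (LCmp \<C> C'' C' C c c') (LCmp \<A> A A' A'' a' a) (tens C A B h k)
        = Act KH C' A' C'' A'' c' a' (Act KH C A C' A' c a (tens C A B h k))"
      by (simp only: comp_act_tens[OF ob(1,2,5,6) cc aa B h k] comp_act_tens[OF ob(1-4) c(1) a(1) B h k]
          comp_act_tens[OF ob(3-6) c(2) a(2) B
            comp_act_closed_left[OF ob(2,4) a(1) B h] comp_act_closed_right[OF ob(1,3) c(1) B k]])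
  qed
qed (rule coend_module comp_act_linear; assumption)+

end

text \<open>Naturality of the inverse comes for free: pull both sides back along the bijection
  \<open>\<theta>\<close> and use naturality of \<open>\<theta>\<close>.\<close>

lemma invertible_two_cellI:
  assumes "two_cell R \<A> \<B> H H' \<theta>"
    and bij: "\<And>B A. \<lbrakk>B \<in> LOb \<B>; A \<in> LOb \<A>\<rbrakk>
      \<Longrightarrow> bij_betw (\<theta> B A) (carrier (Val H B A)) (carrier (Val H' B A))"
  shows "invertible_two_cell R \<A> \<B> H H' \<theta>"
proof -
  interpret two_cell R \<A> \<B> H H' \<theta> by fact
  define \<theta>' where "\<theta>' B A = inv_into (carrier (Val H B A)) (\<theta> B A)" for B A
  have inv: "\<theta>' B A (\<theta> B A h) = h" if "B \<in> LOb \<B>" "A \<in> LOb \<A>" "h \<in> carrier (Val H B A)" for B A h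
    using bij[OF that(1,2)] that(3) by (simp add: \<theta>'_def bij_betw_inv_into_left)
  have inv': "\<theta> B A (\<theta>' B A k) = k" if "B \<in> LOb \<B>" "A \<in> LOb \<A>" "k \<in> carrier (Val H' B A)" for B A k
    using bij[OF that(1,2)] that(3) by (simp add: \<theta>'_def bij_betw_inv_into_right)
  have lin: "linear_map R (Val H' B A) (Val H B A) (\<theta>' B A)" if "B \<in> LOb \<B>" "A \<in> LOb \<A>" for B A
    using dom.val_module[OF that] cod.val_module[OF that] component_linear[OF that] bij[OF that]
    unfolding \<theta>'_def by (rule linear_map_inverse)
  have "two_cell R \<A> \<B> H' H \<theta>'"
  proof (unfold_locales, rule lin)
    fix B A B' A' b a k
    assume ob: "B \<in> LOb \<B>" "A \<in> LOb \<A>" "B' \<in> LOb \<B>" "A' \<in> LOb \<A>"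
      and ab: "b \<in> LArr \<B> B' B" "a \<in> LArr \<A> A A'" and k: "k \<in> carrier (Val H' B A)"
    have h: "\<theta>' B A k \<in> carrier (Val H B A)"
      using lin[OF ob(1,2)] k by (rule linear_map_closed)
    have "Act H' B A B' A' b a k = \<theta> B' A' (Act H B A B' A' b a (\<theta>' B A k))"
      using naturality[OF ob ab h] inv'[OF ob(1,2) k] by simp
    then show "\<theta>' B' A' (Act H' B A B' A' b a k) = Act H B A B' A' b a (\<theta>' B A k)"
      using inv[OF ob(3,4) linear_map_closed[OF dom.act_linear[OF ob ab] h]] by simp
  qed
  with assms(1) inv inv' show ?thesis
    unfolding invertible_two_cell_def by blast
qed

lemma id_two_cell_eq: "id_two_cell B A = (\<lambda>h. h)"
  by (simp add: id_two_cell_def fun_eq_iff)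

lemma id_two_cell_two_cell:
  assumes "vmodule R \<A> \<B> H"
  shows "two_cell R \<A> \<B> H H id_two_cell"
proof -
  interpret vmodule R \<A> \<B> H by fact
  show ?thesis
    by unfold_locales (simp_all add: id_two_cell_eq linear_map_ident)
qed

section \<open>Horizontal composition of 2-cells\<close>

context
  fixes R :: "('r, 'x) ring_scheme"
    and \<A> :: "('r, 'a, 'ah) lincat" and \<B> :: "('r, 'b, 'bh) lincat" and \<C> :: "('r, 'c, 'ch) lincat"
    and H :: "('r, 'a, 'ah, 'b, 'bh, 'h) vmod" and K :: "('r, 'b, 'bh, 'c, 'ch, 'k) vmod"
    and H' :: "('r, 'a, 'ah, 'b, 'bh, 'h2) vmod" and K' :: "('r, 'b, 'bh, 'c, 'ch, 'k2) vmod"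
    and \<phi> \<psi> C A
  assumes HK: "composable_modules R \<A> \<B> \<C> H K" and HK': "composable_modules R \<A> \<B> \<C> H' K'"
    and \<phi>: "two_cell R \<A> \<B> H H' \<phi>" and \<psi>: "two_cell R \<B> \<C> K K' \<psi>"
    and ob: "C \<in> LOb \<C>" "A \<in> LOb \<A>"
begin

interpretation HK: composable_modules R \<A> \<B> \<C> H K by (rule HK)
interpretation HK': composable_modules R \<A> \<B> \<C> H' K' by (rule HK')
interpretation \<phi>: two_cell R \<A> \<B> H H' \<phi> by (rule \<phi>)
interpretation \<psi>: two_cell R \<B> \<C> K K' \<psi> by (rule \<psi>)

lemma hcomp_balanced: "HK.bal C A (HK'.T C A) (\<lambda>(B, h, k). HK'.tens C A B (\<phi> B A h) (\<psi> C B k))"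
proof (rule balancedI; unfold prod.case)
  fix B k assume B: "B \<in> LOb \<B>" and k: "k \<in> carrier (Val K C B)"
  show "linear_map R (Val H B A) (HK'.T C A) (\<lambda>h. HK'.tens C A B (\<phi> B A h) (\<psi> C B k))"
    using \<phi>.component_linear[OF B ob(2)]
      HK'.tens_linear_left[OF ob B linear_map_closed[OF \<psi>.component_linear[OF ob(1) B] k]]
    by (rule linear_map_comp)
next
  fix B h assume B: "B \<in> LOb \<B>" and h: "h \<in> carrier (Val H B A)"
  show "linear_map R (Val K C B) (HK'.T C A) (\<lambda>k. HK'.tens C A B (\<phi> B A h) (\<psi> C B k))"
    using \<psi>.component_linear[OF ob(1) B]
      HK'.tens_linear_right[OF ob B linear_map_closed[OF \<phi>.component_linear[OF B ob(2)] h]]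
    by (rule linear_map_comp)
next
  fix B B' b h k
  assume B: "B \<in> LOb \<B>" "B' \<in> LOb \<B>" and b: "b \<in> LArr \<B> B B'"
    and h: "h \<in> carrier (Val H B' A)" and k: "k \<in> carrier (Val K C B)"
  have "\<phi> B A (Act H B' A B A b (LId \<A> A) h) = Act H' B' A B A b (LId \<A> A) (\<phi> B' A h)"
    by (rule \<phi>.naturality[OF B(2) ob(2) B(1) ob(2) b HK.A.id_hom[OF ob(2)] h])
  moreover have "\<psi> C B' (Act K C B C B' (LId \<C> C) b k) = Act K' C B C B' (LId \<C> C) b (\<psi> C B k)"
    by (rule \<psi>.naturality[OF ob(1) B(1) ob(1) B(2) HK.C.id_hom[OF ob(1)] b k])
  ultimately show "HK'.tens C A B (\<phi> B A (Act H B' A B A b (LId \<A> A) h)) (\<psi> C B k)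
      = HK'.tens C A B' (\<phi> B' A h) (\<psi> C B' (Act K C B C B' (LId \<C> C) b k))"
    using HK'.tens_balance[OF ob B b linear_map_closed[OF \<phi>.component_linear[OF B(2) ob(2)] h]
        linear_map_closed[OF \<psi>.component_linear[OF ob(1) B(1)] k]]
    by simp
qed

lemma hcomp_linear:
  "linear_map R (HK.T C A) (HK'.T C A) (hcomp R \<A> \<B> \<C> K' H' \<psi> \<phi> C A)"
  unfolding hcomp_def
  by (rule HK.coend_map_linear[OF ob HK'.coend_module[OF ob] hcomp_balanced])

lemma hcomp_tens:
  "\<lbrakk>B \<in> LOb \<B>; h \<in> carrier (Val H B A); k \<in> carrier (Val K C B)\<rbrakk>
    \<Longrightarrow> hcomp R \<A> \<B> \<C> K' H' \<psi> \<phi> C A (HK.tens C A B h k) = HK'.tens C A B (\<phi> B A h) (\<psi> C B k)"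
  unfolding hcomp_def
  using HK.coend_map_tens[OF ob HK'.coend_module[OF ob] hcomp_balanced] by simp

end

section \<open>Unit constraints\<close>

context
  fixes R :: "('r, 'x) ring_scheme"
    and \<A> :: "('r, 'a, 'ah) lincat" and \<B> :: "('r, 'b, 'bh) lincat"
    and H :: "('r, 'a, 'ah, 'b, 'bh, 'h) vmod" and B A
  assumes R: "cring R" and cats: "linear_category R \<A>" "linear_category R \<B>"
    and H: "vmodule R \<A> \<B> H" and ob: "B \<in> LOb \<B>" "A \<in> LOb \<A>"
begin

interpretation A: linear_category R \<A> by (rule cats)
interpretation B: linear_category R \<B> by (rule cats)
interpretation H: vmodule R \<A> \<B> H by (rule H)

lemma composable_id_left: "composable_modules R \<A> \<B> \<B> H (id_mod \<B>)"
  by (intro composable_modules.intro composable_modules_axioms.intro cats H B.id_mod_vmodule R)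

lemma composable_id_right: "composable_modules R \<A> \<A> \<B> (id_mod \<A>) H"
  by (intro composable_modules.intro composable_modules_axioms.intro cats H A.id_mod_vmodule R)

interpretation L: composable_modules R \<A> \<B> \<B> H "id_mod \<B>" by (rule composable_id_left)
interpretation Rt: composable_modules R \<A> \<A> \<B> "id_mod \<A>" H by (rule composable_id_right)

lemma left_unitor_balanced:
  "L.bal B A (Val H B A) (\<lambda>(B', h, b). Act H B' A B A b (LId \<A> A) h)"
proof (rule balancedI; unfold prod.case id_mod_sel)
  fix B' b assume B': "B' \<in> LOb \<B>" and b: "b \<in> LArr \<B> B B'"
  show "linear_map R (Val H B' A) (Val H B A) (\<lambda>h. Act H B' A B A b (LId \<A> A) h)"
    by (rule H.act_linear[OF B' ob(2) ob b A.id_hom[OF ob(2)]])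
next
  fix B' h assume B': "B' \<in> LOb \<B>" and h: "h \<in> carrier (Val H B' A)"
  show "linear_map R (LHom \<B> B B') (Val H B A) (\<lambda>b. Act H B' A B A b (LId \<A> A) h)"
    by (rule H.act_linear_contra[OF B' ob(2) ob A.id_hom[OF ob(2)] h])
next
  fix B1 B2 b h k
  assume B: "B1 \<in> LOb \<B>" "B2 \<in> LOb \<B>" and b: "b \<in> LArr \<B> B1 B2"
    and h: "h \<in> carrier (Val H B2 A)" and k: "k \<in> LArr \<B> B B1"
  show "Act H B1 A B A k (LId \<A> A) (Act H B2 A B1 A b (LId \<A> A) h)
      = Act H B2 A B A (LCmp \<B> B B1 B2 b (LCmp \<B> B B B1 k (LId \<B> B))) (LId \<A> A) h"
    using H.act_cmp[OF B(2) ob(2) B(1) ob(2) ob b k A.id_hom[OF ob(2)] A.id_hom[OF ob(2)] h]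
    by (simp add: A.id_left B.id_right A.id_hom ob B k)
qed

lemma left_unitor_linear: "linear_map R (L.T B A) (Val H B A) (left_unitor R \<A> \<B> H B A)"
  unfolding left_unitor_def
  by (rule L.coend_map_linear[OF ob H.val_module[OF ob] left_unitor_balanced])

lemma left_unitor_tens:
  "\<lbrakk>B' \<in> LOb \<B>; h \<in> carrier (Val H B' A); b \<in> LArr \<B> B B'\<rbrakk>
    \<Longrightarrow> left_unitor R \<A> \<B> H B A (L.tens B A B' h b) = Act H B' A B A b (LId \<A> A) h"
  unfolding left_unitor_def
  using L.coend_map_tens[OF ob H.val_module[OF ob] left_unitor_balanced]
  by (simp add: id_mod_sel)

lemma right_unitor_balanced:
  "Rt.bal B A (Val H B A) (\<lambda>(A', a, h). Act H B A' B A (LId \<B> B) a h)"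
proof (rule balancedI; unfold prod.case id_mod_sel)
  fix A' h assume A': "A' \<in> LOb \<A>" and h: "h \<in> carrier (Val H B A')"
  show "linear_map R (LHom \<A> A' A) (Val H B A) (\<lambda>a. Act H B A' B A (LId \<B> B) a h)"
    by (rule H.act_linear_co[OF ob(1) A' ob B.id_hom[OF ob(1)] h])
next
  fix A' a assume A': "A' \<in> LOb \<A>" and a: "a \<in> LArr \<A> A' A"
  show "linear_map R (Val H B A') (Val H B A) (\<lambda>h. Act H B A' B A (LId \<B> B) a h)"
    by (rule H.act_linear[OF ob(1) A' ob B.id_hom[OF ob(1)] a])
next
  fix A1 A2 a h k
  assume A: "A1 \<in> LOb \<A>" "A2 \<in> LOb \<A>" and a: "a \<in> LArr \<A> A1 A2"
    and h: "h \<in> LArr \<A> A2 A" and k: "k \<in> carrier (Val H B A1)"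
  show "Act H B A1 B A (LId \<B> B) (LCmp \<A> A1 A A (LId \<A> A) (LCmp \<A> A1 A2 A h a)) k
      = Act H B A2 B A (LId \<B> B) h (Act H B A1 B A2 (LId \<B> B) a k)"
    using H.act_cmp[OF ob(1) A(1) ob(1) A(2) ob B.id_hom[OF ob(1)] B.id_hom[OF ob(1)] a h k]
    by (simp add: A.id_left B.id_right B.id_hom A.cmp_closed ob A a h)
qed

lemma right_unitor_linear: "linear_map R (Rt.T B A) (Val H B A) (right_unitor R \<A> \<B> H B A)"
  unfolding right_unitor_def
  by (rule Rt.coend_map_linear[OF ob H.val_module[OF ob] right_unitor_balanced])

lemma right_unitor_tens:
  "\<lbrakk>A' \<in> LOb \<A>; a \<in> LArr \<A> A' A; h \<in> carrier (Val H B A')\<rbrakk>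
    \<Longrightarrow> right_unitor R \<A> \<B> H B A (Rt.tens B A A' a h) = Act H B A' B A (LId \<B> B) a h"
  unfolding right_unitor_def
  using Rt.coend_map_tens[OF ob H.val_module[OF ob] right_unitor_balanced]
  by (simp add: id_mod_sel)

end

section \<open>The associativity constraint and its inverse\<close>

context
  fixes R :: "('r, 'x) ring_scheme"
    and \<A> :: "('r, 'a, 'ah) lincat" and \<B> :: "('r, 'b, 'bh) lincat"
    and \<C> :: "('r, 'c, 'ch) lincat" and \<D> :: "('r, 'd, 'dh) lincat"
    and H :: "('r, 'a, 'ah, 'b, 'bh, 'h) vmod" and K :: "('r, 'b, 'bh, 'c, 'ch, 'k) vmod"
    and L :: "('r, 'c, 'ch, 'd, 'dh, 'l) vmod" and D A
  assumes HK: "composable_modules R \<A> \<B> \<C> H K" and KL: "composable_modules R \<B> \<C> \<D> K L"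
    and ob: "D \<in> LOb \<D>" "A \<in> LOb \<A>"
begin

interpretation HK: composable_modules R \<A> \<B> \<C> H K by (rule HK)
interpretation KL: composable_modules R \<B> \<C> \<D> K L by (rule KL)

lemma composable_comp_left: "composable_modules R \<A> \<C> \<D> (mod_comp R \<A> \<B> \<C> K H) L"
  by (intro composable_modules.intro composable_modules_axioms.intro
      HK.mod_comp_vmodule KL.K.vmodule_axioms HK.A.linear_category_axioms
      HK.C.linear_category_axioms KL.C.linear_category_axioms HK.cring)

lemma composable_comp_right: "composable_modules R \<A> \<B> \<D> H (mod_comp R \<B> \<C> \<D> L K)"
  by (intro composable_modules.intro composable_modules_axioms.intro
      KL.mod_comp_vmodule HK.H.vmodule_axioms HK.A.linear_category_axioms
      HK.B.linear_category_axioms KL.C.linear_category_axioms HK.cring)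

interpretation HKL: composable_modules R \<A> \<C> \<D> "mod_comp R \<A> \<B> \<C> K H" L
  by (rule composable_comp_left)
interpretation HLK: composable_modules R \<A> \<B> \<D> H "mod_comp R \<B> \<C> \<D> L K"
  by (rule composable_comp_right)

text \<open>The inner of the two nested coend maps in \<open>associator\<close>, for fixed
  \<open>B\<close> and \<open>h\<close>. It has to be shown balanced before the outer map can be
  evaluated.\<close>

abbreviation (input) "assoc_gen B h \<equiv>
  (\<lambda>(C, k, l). HKL.tens D A C (HK.tens C A B h k) l)"

abbreviation (input) "assoc_at B h \<equiv> coend_map R (HKL.T D A) (assoc_gen B h)"

lemma associator_inner_balanced:
  assumes B: "B \<in> LOb \<B>" and h: "h \<in> carrier (Val H B A)"
  shows "KL.bal D B (HKL.T D A) (assoc_gen B h)"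
proof (rule balancedI; unfold prod.case)
  fix C l assume C: "C \<in> LOb \<C>" and l: "l \<in> carrier (Val L D C)"
  show "linear_map R (Val K C B) (HKL.T D A) (\<lambda>k. HKL.tens D A C (HK.tens C A B h k) l)"
    using HK.tens_linear_right[OF C ob(2) B h] HKL.tens_linear_left[OF ob C l, unfolded mod_comp_sel]
    by (rule linear_map_comp)
next
  fix C k assume C: "C \<in> LOb \<C>" and k: "k \<in> carrier (Val K C B)"
  show "linear_map R (Val L D C) (HKL.T D A) (\<lambda>l. HKL.tens D A C (HK.tens C A B h k) l)"
    by (rule HKL.tens_linear_right[OF ob C, unfolded mod_comp_sel, OF HK.tens_closed[OF C ob(2) B h k]])
next
  fix C1 C2 c k l
  assume C: "C1 \<in> LOb \<C>" "C2 \<in> LOb \<C>" and c: "c \<in> LArr \<C> C1 C2"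
    and k: "k \<in> carrier (Val K C2 B)" and l: "l \<in> carrier (Val L D C1)"
  have "Act (mod_comp R \<A> \<B> \<C> K H) C2 A C1 A c (LId \<A> A) (HK.tens C2 A B h k)
      = HK.tens C1 A B h (Act K C2 B C1 B c (LId \<B> B) k)"
    using HK.comp_act_tens[OF C(2) ob(2) C(1) ob(2) c HK.A.id_hom[OF ob(2)] B h k]
    by (simp add: HK.H.act_id B ob h)
  then show "HKL.tens D A C1 (HK.tens C1 A B h (Act K C2 B C1 B c (LId \<B> B) k)) l
      = HKL.tens D A C2 (HK.tens C2 A B h k) (Act L D C1 D C2 (LId \<D> D) c l)"
    using HKL.tens_balance[OF ob C c, unfolded mod_comp_sel(1),
        OF HK.tens_closed[OF C(2) ob(2) B h k] l]
    by simp
qed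

lemma associator_inner_tens:
  assumes "B \<in> LOb \<B>" "h \<in> carrier (Val H B A)"
    and "C \<in> LOb \<C>" "k \<in> carrier (Val K C B)" "l \<in> carrier (Val L D C)"
  shows "assoc_at B h (KL.tens D B C k l)
    = HKL.tens D A C (HK.tens C A B h k) l"
  using KL.coend_map_tens[OF ob(1) assms(1) HKL.coend_module[OF ob] associator_inner_balanced[OF assms(1,2)]
      assms(3-5)]
  by simp

lemma associator_inner_linear:
  assumes "B \<in> LOb \<B>" "h \<in> carrier (Val H B A)"
  shows "linear_map R (KL.T D B) (HKL.T D A) (assoc_at B h)"
  using KL.coend_map_linear[OF ob(1) assms(1) HKL.coend_module[OF ob] associator_inner_balanced[OF assms]] .

text \<open>The variable \<open>Y\<close> is itself an element of a coend, so both linearity in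
  \<open>h\<close> and the balance equation are tested on simple tensors: the former by
  \<open>coend_linear_param\<close>, the latter by \<open>coend_ext\<close>, where it becomes
  balance in the coend over \<B>.\<close>

lemma associator_balanced:
  "HLK.bal D A (HKL.T D A) (\<lambda>(B, h, Y). assoc_at B h Y)"
proof (rule balancedI; unfold prod.case mod_comp_sel(1))
  fix B Y assume B: "B \<in> LOb \<B>" and Y: "Y \<in> carrier (KL.T D B)"
  show "linear_map R (Val H B A) (HKL.T D A) (\<lambda>h. assoc_at B h Y)"
  proof (rule KL.coend_linear_param[OF ob(1) B HK.H.val_module[OF B ob(2)] HKL.coend_module[OF ob] _ _ Y])
    fix h assume "h \<in> carrier (Val H B A)"
    with B show "linear_map R (KL.T D B) (HKL.T D A) (assoc_at B h)"
      by (rule associator_inner_linear)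
  next
    fix C k l assume C: "C \<in> LOb \<C>" and k: "k \<in> carrier (Val K C B)" and l: "l \<in> carrier (Val L D C)"
    have "linear_map R (Val H B A) (HKL.T D A) (\<lambda>h. HKL.tens D A C (HK.tens C A B h k) l)"
      using HK.tens_linear_left[OF C ob(2) B k] HKL.tens_linear_left[OF ob C l, unfolded mod_comp_sel]
      by (rule linear_map_comp)
    then show "linear_map R (Val H B A) (HKL.T D A)
        (\<lambda>h. assoc_at B h (KL.tens D B C k l))"
      by (subst linear_map_cong[OF HK.H.val_module[OF B ob(2)] associator_inner_tens[OF B _ C k l]])
  qed
next
  fix B h assume "B \<in> LOb \<B>" "h \<in> carrier (Val H B A)"
  then show "linear_map R (KL.T D B) (HKL.T D A) (\<lambda>Y. assoc_at B h Y)"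
    by (rule associator_inner_linear)
next
  fix B1 B2 b h Y
  assume B: "B1 \<in> LOb \<B>" "B2 \<in> LOb \<B>" and b: "b \<in> LArr \<B> B1 B2"
    and h: "h \<in> carrier (Val H B2 A)" and Y: "Y \<in> carrier (KL.T D B1)"
  let ?h = "Act H B2 A B1 A b (LId \<A> A) h"
  let ?act = "Act (mod_comp R \<B> \<C> \<D> L K) D B1 D B2 (LId \<D> D) b"
  have h': "?h \<in> carrier (Val H B1 A)"
    by (rule HK.act_left_closed[OF ob(2) B b h])
  note act = KL.comp_act_linear[OF ob(1) B(1) ob(1) B(2) KL.C.id_hom[OF ob(1)] b]
  show "assoc_at B1 ?h Y
      = assoc_at B2 h (?act Y)"
    using ob(1) B(1) HKL.coend_module[OF ob] associator_inner_linear[OF B(1) h']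
      linear_map_comp[OF act associator_inner_linear[OF B(2) h]] _ Y
  proof (rule KL.coend_ext)
    fix C k l assume C: "C \<in> LOb \<C>" and k: "k \<in> carrier (Val K C B1)" and l: "l \<in> carrier (Val L D C)"
    have k': "Act K C B1 C B2 (LId \<C> C) b k \<in> carrier (Val K C B2)"
      by (rule HK.act_right_closed[OF C B b k])
    have "?act (KL.tens D B1 C k l) = KL.tens D B2 C (Act K C B1 C B2 (LId \<C> C) b k) l"
      using KL.comp_act_tens[OF ob(1) B(1) ob(1) B(2) KL.C.id_hom[OF ob(1)] b C k l]
      by (simp add: KL.K.act_id ob C l)
    then show "assoc_at B1 ?h (KL.tens D B1 C k l)
        = assoc_at B2 h (?act (KL.tens D B1 C k l))"
      using HK.tens_balance[OF C ob(2) B b h k]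
      by (simp only: associator_inner_tens[OF B(1) h' C k l] associator_inner_tens[OF B(2) h C k' l])
  qed
qed

lemma associator_linear:
  "linear_map R (HLK.T D A) (HKL.T D A) (associator R \<A> \<B> \<C> \<D> L K H D A)"
  unfolding associator_def Let_def
  by (rule HLK.coend_map_linear[OF ob HKL.coend_module[OF ob] associator_balanced])

lemma associator_tens:
  assumes B: "B \<in> LOb \<B>" and C: "C \<in> LOb \<C>"
    and hkl: "h \<in> carrier (Val H B A)" "k \<in> carrier (Val K C B)" "l \<in> carrier (Val L D C)"
  shows "associator R \<A> \<B> \<C> \<D> L K H D A (HLK.tens D A B h (KL.tens D B C k l))
    = HKL.tens D A C (HK.tens C A B h k) l"
  unfolding associator_def Let_def
  using HLK.coend_map_tens[OF ob HKL.coend_module[OF ob] associator_balanced B hkl(1),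
      unfolded mod_comp_sel(1), OF KL.tens_closed[OF ob(1) B C hkl(2,3)]]
    associator_inner_tens[OF B hkl(1) C hkl(2,3)]
  by simp

abbreviation (input) "assoc_inv_gen C l \<equiv>
  (\<lambda>(B, h, k). HLK.tens D A B h (KL.tens D B C k l))"

abbreviation (input) "assoc_inv_at C l \<equiv> coend_map R (HLK.T D A) (assoc_inv_gen C l)"

lemma associator_inv_inner_balanced:
  assumes C: "C \<in> LOb \<C>" and l: "l \<in> carrier (Val L D C)"
  shows "HK.bal C A (HLK.T D A) (assoc_inv_gen C l)"
proof (rule balancedI; unfold prod.case)
  fix B k assume B: "B \<in> LOb \<B>" and k: "k \<in> carrier (Val K C B)"
  show "linear_map R (Val H B A) (HLK.T D A) (\<lambda>h. HLK.tens D A B h (KL.tens D B C k l))"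
    by (rule HLK.tens_linear_left[OF ob B, unfolded mod_comp_sel, OF KL.tens_closed[OF ob(1) B C k l]])
next
  fix B h assume B: "B \<in> LOb \<B>" and h: "h \<in> carrier (Val H B A)"
  show "linear_map R (Val K C B) (HLK.T D A) (\<lambda>k. HLK.tens D A B h (KL.tens D B C k l))"
    using KL.tens_linear_left[OF ob(1) B C l] HLK.tens_linear_right[OF ob B h, unfolded mod_comp_sel]
    by (rule linear_map_comp)
next
  fix B1 B2 b h k
  assume B: "B1 \<in> LOb \<B>" "B2 \<in> LOb \<B>" and b: "b \<in> LArr \<B> B1 B2"
    and h: "h \<in> carrier (Val H B2 A)" and k: "k \<in> carrier (Val K C B1)"
  have "Act (mod_comp R \<B> \<C> \<D> L K) D B1 D B2 (LId \<D> D) b (KL.tens D B1 C k l)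
      = KL.tens D B2 C (Act K C B1 C B2 (LId \<C> C) b k) l"
    using KL.comp_act_tens[OF ob(1) B(1) ob(1) B(2) KL.C.id_hom[OF ob(1)] b C k l]
    by (simp add: KL.K.act_id ob C l)
  then show "HLK.tens D A B1 (Act H B2 A B1 A b (LId \<A> A) h) (KL.tens D B1 C k l)
      = HLK.tens D A B2 h (KL.tens D B2 C (Act K C B1 C B2 (LId \<C> C) b k) l)"
    using HLK.tens_balance[OF ob B b h, unfolded mod_comp_sel(1),
        OF KL.tens_closed[OF ob(1) B(1) C k l]]
    by simp
qed

lemma associator_inv_inner_tens:
  assumes "C \<in> LOb \<C>" "l \<in> carrier (Val L D C)"
    and "B \<in> LOb \<B>" "h \<in> carrier (Val H B A)" "k \<in> carrier (Val K C B)"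
  shows "assoc_inv_at C l (HK.tens C A B h k)
    = HLK.tens D A B h (KL.tens D B C k l)"
  using HK.coend_map_tens[OF assms(1) ob(2) HLK.coend_module[OF ob] associator_inv_inner_balanced[OF assms(1,2)]
      assms(3-5)]
  by simp

lemma associator_inv_inner_linear:
  assumes "C \<in> LOb \<C>" "l \<in> carrier (Val L D C)"
  shows "linear_map R (HK.T C A) (HLK.T D A) (assoc_inv_at C l)"
  using HK.coend_map_linear[OF assms(1) ob(2) HLK.coend_module[OF ob] associator_inv_inner_balanced[OF assms]] .

text \<open>The mirror image of \<open>associator_balanced\<close>: \<open>l\<close> is now the
  parameter, \<open>X\<close> is tested on simple tensors, and balance over \<C> is used.\<close>

lemma associator_inv_balanced:
  "HKL.bal D A (HLK.T D A) (\<lambda>(C, X, l). assoc_inv_at C l X)"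
proof (rule balancedI; unfold prod.case mod_comp_sel(1))
  fix C X assume C: "C \<in> LOb \<C>" and X: "X \<in> carrier (HK.T C A)"
  show "linear_map R (Val L D C) (HLK.T D A) (\<lambda>l. assoc_inv_at C l X)"
  proof (rule HK.coend_linear_param[OF C ob(2) KL.K.val_module[OF ob(1) C] HLK.coend_module[OF ob] _ _ X])
    fix l assume "l \<in> carrier (Val L D C)"
    with C show "linear_map R (HK.T C A) (HLK.T D A) (assoc_inv_at C l)"
      by (rule associator_inv_inner_linear)
  next
    fix B h k assume B: "B \<in> LOb \<B>" and h: "h \<in> carrier (Val H B A)" and k: "k \<in> carrier (Val K C B)"
    have "linear_map R (Val L D C) (HLK.T D A) (\<lambda>l. HLK.tens D A B h (KL.tens D B C k l))"
      using KL.tens_linear_right[OF ob(1) B C k] HLK.tens_linear_right[OF ob B h, unfolded mod_comp_sel]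
      by (rule linear_map_comp)
    then show "linear_map R (Val L D C) (HLK.T D A)
        (\<lambda>l. assoc_inv_at C l (HK.tens C A B h k))"
      by (subst linear_map_cong[OF KL.K.val_module[OF ob(1) C] associator_inv_inner_tens[OF C _ B h k]])
  qed
next
  fix C l assume "C \<in> LOb \<C>" "l \<in> carrier (Val L D C)"
  then show "linear_map R (HK.T C A) (HLK.T D A) (\<lambda>X. assoc_inv_at C l X)"
    by (rule associator_inv_inner_linear)
next
  fix C1 C2 c X l
  assume C: "C1 \<in> LOb \<C>" "C2 \<in> LOb \<C>" and c: "c \<in> LArr \<C> C1 C2"
    and X: "X \<in> carrier (HK.T C2 A)" and l: "l \<in> carrier (Val L D C1)"
  let ?l = "Act L D C1 D C2 (LId \<D> D) c l"
  let ?act = "Act (mod_comp R \<A> \<B> \<C> K H) C2 A C1 A c (LId \<A> A)"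
  have l': "?l \<in> carrier (Val L D C2)"
    by (rule KL.act_right_closed[OF ob(1) C c l])
  note act = HK.comp_act_linear[OF C(2) ob(2) C(1) ob(2) c HK.A.id_hom[OF ob(2)]]
  show "assoc_inv_at C1 l (?act X)
      = assoc_inv_at C2 ?l X"
    using C(2) ob(2) HLK.coend_module[OF ob]
      linear_map_comp[OF act associator_inv_inner_linear[OF C(1) l]]
      associator_inv_inner_linear[OF C(2) l'] _ X
  proof (rule HK.coend_ext)
    fix B h k assume B: "B \<in> LOb \<B>" and h: "h \<in> carrier (Val H B A)" and k: "k \<in> carrier (Val K C2 B)"
    have k': "Act K C2 B C1 B c (LId \<B> B) k \<in> carrier (Val K C1 B)"
      by (rule KL.act_left_closed[OF B C c k])
    have "?act (HK.tens C2 A B h k) = HK.tens C1 A B h (Act K C2 B C1 B c (LId \<B> B) k)"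
      using HK.comp_act_tens[OF C(2) ob(2) C(1) ob(2) c HK.A.id_hom[OF ob(2)] B h k]
      by (simp add: HK.H.act_id ob B h)
    then show "assoc_inv_at C1 l (?act (HK.tens C2 A B h k))
        = assoc_inv_at C2 ?l (HK.tens C2 A B h k)"
      using KL.tens_balance[OF ob(1) B C c k l]
      by (simp only: associator_inv_inner_tens[OF C(1) l B h k'] associator_inv_inner_tens[OF C(2) l' B h k])
  qed
qed

lemma associator_inv_linear:
  "linear_map R (HKL.T D A) (HLK.T D A) (associator_inv R \<A> \<B> \<C> \<D> L K H D A)"
  unfolding associator_inv_def Let_def
  by (rule HKL.coend_map_linear[OF ob HLK.coend_module[OF ob] associator_inv_balanced])

lemma associator_inv_tens:
  assumes B: "B \<in> LOb \<B>" and C: "C \<in> LOb \<C>"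
    and hkl: "h \<in> carrier (Val H B A)" "k \<in> carrier (Val K C B)" "l \<in> carrier (Val L D C)"
  shows "associator_inv R \<A> \<B> \<C> \<D> L K H D A (HKL.tens D A C (HK.tens C A B h k) l)
    = HLK.tens D A B h (KL.tens D B C k l)"
  unfolding associator_inv_def Let_def
  using HKL.coend_map_tens[OF ob HLK.coend_module[OF ob] associator_inv_balanced C,
      unfolded mod_comp_sel(1), OF HK.tens_closed[OF C ob(2) B hkl(1,2)] hkl(3)]
    associator_inv_inner_tens[OF C hkl(3) B hkl(1,2)]
  by simp

end

section \<open>Linearization\<close>

context
  fixes R :: "('r, 'x) ring_scheme" and N :: "('r, 'n) module"
    and Y :: "'a set" and X :: "'b set" and \<psi> :: "'a \<Rightarrow> 'b \<Rightarrow> 'n"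
  assumes R: "cring R" and N: "module R N"
    and \<psi>: "\<And>g f. \<lbrakk>g \<in> Y; f \<in> X\<rbrakk> \<Longrightarrow> \<psi> g f \<in> carrier N"
begin

lemma bilin_ext_linear_left:
  assumes "x \<in> carrier (free_mod R X)"
  shows "linear_map R (free_mod R Y) N (\<lambda>y. lin_ext R N (\<lambda>g. lin_ext R N (\<psi> g) x) y)"
  by (rule lin_ext_linear[OF N]) (rule linear_map_closed[OF lin_ext_linear[OF N \<psi>] assms])

lemma bilin_ext_linear_right:
  assumes "y \<in> carrier (free_mod R Y)"
  shows "linear_map R (free_mod R X) N (\<lambda>x. lin_ext R N (\<lambda>g. lin_ext R N (\<psi> g) x) y)"
  by (rule lin_ext_linear_param[OF free_module[OF R] N _ assms]) (rule lin_ext_linear[OF N \<psi>])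

lemma bilin_ext_gen:
  "\<lbrakk>g \<in> Y; f \<in> X\<rbrakk> \<Longrightarrow> lin_ext R N (\<lambda>g. lin_ext R N (\<psi> g) (gen R f)) (gen R g) = \<psi> g f"
  by (simp add: lin_ext_gen[OF N] \<psi>)

end

context
  fixes R :: "('r, 'x) ring_scheme" and N :: "('r, 'n) module"
    and Y :: "'a set" and X :: "'b set" and Z :: "'c set" and \<psi> :: "'a \<Rightarrow> 'b \<Rightarrow> 'c \<Rightarrow> 'n"
  assumes R: "cring R" and N: "module R N"
    and \<psi>: "\<And>g f m. \<lbrakk>g \<in> Y; f \<in> X; m \<in> Z\<rbrakk> \<Longrightarrow> \<psi> g f m \<in> carrier N"
begin

lemma trilin_ext_linear1:
  assumes "x \<in> carrier (free_mod R X)" "z \<in> carrier (free_mod R Z)"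
  shows "linear_map R (free_mod R Y) N
    (\<lambda>y. lin_ext R N (\<lambda>g. lin_ext R N (\<lambda>f. lin_ext R N (\<psi> g f) z) x) y)"
  by (rule lin_ext_linear[OF N])
    (rule linear_map_closed[OF bilin_ext_linear_left[OF R N \<psi> assms(2)] assms(1)])

lemma trilin_ext_linear2:
  assumes "y \<in> carrier (free_mod R Y)" "z \<in> carrier (free_mod R Z)"
  shows "linear_map R (free_mod R X) N
    (\<lambda>x. lin_ext R N (\<lambda>g. lin_ext R N (\<lambda>f. lin_ext R N (\<psi> g f) z) x) y)"
  by (rule lin_ext_linear_param[OF free_module[OF R] N _ assms(1)])
    (rule bilin_ext_linear_left[OF R N \<psi> assms(2)])

lemma trilin_ext_linear3:
  assumes "y \<in> carrier (free_mod R Y)" "x \<in> carrier (free_mod R X)"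
  shows "linear_map R (free_mod R Z) N
    (\<lambda>z. lin_ext R N (\<lambda>g. lin_ext R N (\<lambda>f. lin_ext R N (\<psi> g f) z) x) y)"
  by (rule lin_ext_linear_param[OF free_module[OF R] N _ assms(1)])
    (rule bilin_ext_linear_right[OF R N \<psi> assms(2)])

lemma trilin_ext_gen:
  "\<lbrakk>g \<in> Y; f \<in> X; m \<in> Z\<rbrakk>
    \<Longrightarrow> lin_ext R N (\<lambda>g. lin_ext R N (\<lambda>f. lin_ext R N (\<psi> g f) (gen R m)) (gen R f)) (gen R g) = \<psi> g f m"
  by (simp add: lin_ext_gen[OF N] \<psi>)

end

lemma linearize_sel:
  "LOb (linearize R C) = Ob C"
  "LHom (linearize R C) A B = free_mod R (Arr C A B)"
  "LId (linearize R C) A = gen R (Idn C A)"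
  by (simp_all add: linearize_def)

context category
begin

lemma arr_ob: "f \<in> Arr C A B \<Longrightarrow> A \<in> Ob C" "f \<in> Arr C A B \<Longrightarrow> B \<in> Ob C"
  using src_ob trg_ob by (auto simp: Arr_def)

context
  fixes R :: "('r, 'x) ring_scheme"
  assumes R: "cring R"
begin

abbreviation "lcmp \<equiv> LCmp (linearize R C)"
abbreviation "fhom A B \<equiv> free_mod R (Arr C A B)"

lemma lcmp_linear_left:
  "f \<in> carrier (fhom A B) \<Longrightarrow> linear_map R (fhom B D) (fhom A D) (\<lambda>g. lcmp A B D g f)"
  unfolding linearize_def Let_def lincat.simps
  by (rule bilin_ext_linear_left[OF R free_module[OF R] gen_closed[OF R cmp_arr]])

lemma lcmp_linear_right:
  "g \<in> carrier (fhom B D) \<Longrightarrow> linear_map R (fhom A B) (fhom A D) (\<lambda>f. lcmp A B D g f)"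
  unfolding linearize_def Let_def lincat.simps
  by (rule bilin_ext_linear_right[OF R free_module[OF R] gen_closed[OF R cmp_arr]])

lemma lcmp_gen:
  "\<lbrakk>f \<in> Arr C A B; g \<in> Arr C B D\<rbrakk> \<Longrightarrow> lcmp A B D (gen R g) (gen R f) = gen R (Cmp C g f)"
  unfolding linearize_def Let_def lincat.simps
  by (rule bilin_ext_gen[OF R free_module[OF R] gen_closed[OF R cmp_arr]])

lemmas lcmp_cl = linear_map_closed[OF lcmp_linear_left]

lemma lcmp_assoc_lin:
  assumes f: "f \<in> carrier (fhom A B)" and g: "g \<in> carrier (fhom B D)" and h: "h \<in> carrier (fhom D D')"
  shows "lcmp A D D' h (lcmp A B D g f) = lcmp A B D' (lcmp B D D' h g) f"
proof (rule trilinear_free_ext[OF R free_module[OF R] _ _ _ _ _ _ _ f g h,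
    where f = "\<lambda>f g h. lcmp A D D' h (lcmp A B D g f)"
      and g = "\<lambda>f g h. lcmp A B D' (lcmp B D D' h g) f"])
  fix a b c assume a: "a \<in> Arr C A B" and b: "b \<in> Arr C B D" and c: "c \<in> Arr C D D'"
  show "lcmp A D D' (gen R c) (lcmp A B D (gen R b) (gen R a))
      = lcmp A B D' (lcmp B D D' (gen R c) (gen R b)) (gen R a)"
    by (simp add: lcmp_gen[OF a b] lcmp_gen[OF cmp_arr[OF a b] c] lcmp_gen[OF b c]
        lcmp_gen[OF a cmp_arr[OF b c]] cmp_assoc[OF a b c])
qed (rule lcmp_linear_left[OF lcmp_cl] lcmp_linear_right[OF lcmp_cl]
    linear_map_comp[OF lcmp_linear_left lcmp_linear_left]
    linear_map_comp[OF lcmp_linear_left lcmp_linear_right]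
    linear_map_comp[OF lcmp_linear_right lcmp_linear_left]
    linear_map_comp[OF lcmp_linear_right lcmp_linear_right]; assumption)+

lemma lcmp_id_left:
  assumes f: "f \<in> carrier (fhom A B)" and B: "B \<in> Ob C"
  shows "lcmp A B B (gen R (Idn C B)) f = f"
  using R free_module[OF R] lcmp_linear_right[OF gen_closed[OF R idn_arr[OF B]]]
    linear_map_ident _ f
  by (rule linear_map_free_ext) (simp add: lcmp_gen idn_arr B idn_left)

lemma lcmp_id_right:
  assumes f: "f \<in> carrier (fhom A B)" and A: "A \<in> Ob C"
  shows "lcmp A A B f (gen R (Idn C A)) = f"
  using R free_module[OF R] lcmp_linear_left[OF gen_closed[OF R idn_arr[OF A]]]
    linear_map_ident _ f
  by (rule linear_map_free_ext) (simp add: lcmp_gen idn_arr A idn_right)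

lemma linearize_linear_category: "linear_category R (linearize R C)"
  by (rule linear_category.intro; unfold linearize_sel)
    (assumption | rule free_module gen_closed R idn_arr lcmp_linear_left lcmp_linear_right
      lcmp_id_left lcmp_id_right lcmp_assoc_lin)+

end

end

section \<open>Wide subcategories and truncated actions\<close>

lemma wide_subcat_sel:
  "Ob (wide_subcat C S) = Ob C" "Ar (wide_subcat C S) = S"
  "Src (wide_subcat C S) = Src C" "Trg (wide_subcat C S) = Trg C"
  "Idn (wide_subcat C S) = Idn C" "Cmp (wide_subcat C S) = Cmp C"
  by (simp_all add: wide_subcat_def)

lemma wide_subcat_Arr: "S \<subseteq> Ar C \<Longrightarrow> Arr (wide_subcat C S) A B = Arr C A B \<inter> S"
  by (auto simp: Arr_def wide_subcat_sel)

text \<open>Lets the whole category be one of the two acting subcategories in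
  \<open>truncated_bimodule\<close>.\<close>

lemma wide_subcat_all: "wide_subcat C (Ar C) = C"
  by (simp add: wide_subcat_def)

lemma (in category) wide_subcat_category:
  assumes "S \<subseteq> Ar C" "\<And>A. A \<in> Ob C \<Longrightarrow> Idn C A \<in> S"
    and "\<And>A B D f g. \<lbrakk>f \<in> Arr C A B; g \<in> Arr C B D; f \<in> S; g \<in> S\<rbrakk> \<Longrightarrow> Cmp C g f \<in> S"
  shows "category (wide_subcat C S)"
  using assms(1,2,3)
  by (unfold_locales; unfold wide_subcat_Arr[OF assms(1)] wide_subcat_sel)
    (auto intro: src_ob trg_ob idn_arr cmp_arr simp: idn_left idn_right cmp_assoc)

text \<open>The two definitions differ only in the names of bound variables.\<close>

lemma E_mod_eq_M_mod: "E_mod R F S = M_mod R F S"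
  by (simp add: E_mod_def M_mod_def)

text \<open>
  Both modules of the adjunction are instances of one construction: a class \<open>S\<close> of morphisms on
  which two wide subcategories act from either side, a composite leaving \<open>S\<close> being set to zero.
  The action is functorial because \<open>stable\<close> prevents a composite outside \<open>S\<close> from returning to \<open>S\<close>.
\<close>

locale truncated_bimodule = category C for C :: "('o, 'm) cat" +
  fixes R :: "('r, 'x) ring_scheme" and S S1 S2 :: "'m set"
  assumes R: "cring R"
    and sub: "S \<subseteq> Ar C" "S1 \<subseteq> Ar C" "S2 \<subseteq> Ar C"
    and cat1: "category (wide_subcat C S1)" and cat2: "category (wide_subcat C S2)"
    and stable: "\<And>A B A' B' a t b. \<lbrakk>b \<in> Arr C B' B \<inter> S2; t \<in> Arr C B A; a \<in> Arr C A A' \<inter> S1;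
      Cmp C a (Cmp C t b) \<in> S\<rbrakk> \<Longrightarrow> t \<in> S"
begin

abbreviation "val B A \<equiv> free_mod R (Arr C B A \<inter> S)"
abbreviation "act \<equiv> Act (M_mod R C S)"
abbreviation "hom1 A B \<equiv> free_mod R (Arr C A B \<inter> S1)"
abbreviation "hom2 A B \<equiv> free_mod R (Arr C A B \<inter> S2)"

definition "trunc B A f = (if f \<in> S then gen R f else \<zero>\<^bsub>val B A\<^esub>)"

lemma trunc_closed: "f \<in> Arr C B A \<Longrightarrow> trunc B A f \<in> carrier (val B A)"
proof -
  interpret V: module R "val B A" by (rule free_module[OF R])
  show "f \<in> Arr C B A \<Longrightarrow> trunc B A f \<in> carrier (val B A)"
    by (simp add: trunc_def gen_closed[OF R])
qed

lemma act_eq: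
  "act B A B' A' y x z = lin_ext R (val B' A') (\<lambda>g. lin_ext R (val B' A') (\<lambda>f.
      lin_ext R (val B' A') (\<lambda>m. trunc B' A' (Cmp C f (Cmp C m g))) z) x) y"
  by (simp add: M_mod_def trunc_def Let_def)

lemma trunc_cmp_closed:
  "\<lbrakk>g \<in> Arr C B' B \<inter> S2; f \<in> Arr C A A' \<inter> S1; m \<in> Arr C B A \<inter> S\<rbrakk>
    \<Longrightarrow> trunc B' A' (Cmp C f (Cmp C m g)) \<in> carrier (val B' A')"
  by (rule trunc_closed) (blast intro: cmp_arr)

lemma act_linear1:
  "\<lbrakk>x \<in> carrier (hom1 A A'); z \<in> carrier (val B A)\<rbrakk>
    \<Longrightarrow> linear_map R (hom2 B' B) (val B' A') (\<lambda>y. act B A B' A' y x z)"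
  unfolding act_eq by (rule trilin_ext_linear1[OF R free_module[OF R] trunc_cmp_closed])

lemma act_linear2:
  "\<lbrakk>y \<in> carrier (hom2 B' B); z \<in> carrier (val B A)\<rbrakk>
    \<Longrightarrow> linear_map R (hom1 A A') (val B' A') (\<lambda>x. act B A B' A' y x z)"
  unfolding act_eq by (rule trilin_ext_linear2[OF R free_module[OF R] trunc_cmp_closed])

lemma act_linear3:
  "\<lbrakk>y \<in> carrier (hom2 B' B); x \<in> carrier (hom1 A A')\<rbrakk>
    \<Longrightarrow> linear_map R (val B A) (val B' A') (\<lambda>z. act B A B' A' y x z)"
  unfolding act_eq by (rule trilin_ext_linear3[OF R free_module[OF R] trunc_cmp_closed])

lemma act_gen:
  assumes "b \<in> Arr C B' B \<inter> S2" "a \<in> Arr C A A' \<inter> S1" "s \<in> Arr C B A \<inter> S"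
  shows "act B A B' A' (gen R b) (gen R a) (gen R s) = trunc B' A' (Cmp C a (Cmp C s b))"
  unfolding act_eq by (rule trilin_ext_gen[OF R free_module[OF R] trunc_cmp_closed assms])

interpretation C1: category "wide_subcat C S1" by (rule cat1)
interpretation C2: category "wide_subcat C S2" by (rule cat2)

abbreviation "lcmp1 \<equiv> LCmp (linearize R (wide_subcat C S1))"
abbreviation "lcmp2 \<equiv> LCmp (linearize R (wide_subcat C S2))"

lemmas lcmp1_linear_left = C1.lcmp_linear_left[OF R, unfolded wide_subcat_Arr[OF sub(2)]]
lemmas lcmp2_linear_left = C2.lcmp_linear_left[OF R, unfolded wide_subcat_Arr[OF sub(3)]]
lemmas lcmp1_linear_right = C1.lcmp_linear_right[OF R, unfolded wide_subcat_Arr[OF sub(2)]]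
lemmas lcmp2_linear_right = C2.lcmp_linear_right[OF R, unfolded wide_subcat_Arr[OF sub(3)]]
lemmas lcmp1_gen = C1.lcmp_gen[OF R, unfolded wide_subcat_Arr[OF sub(2)] wide_subcat_sel]
lemmas lcmp2_gen = C2.lcmp_gen[OF R, unfolded wide_subcat_Arr[OF sub(3)] wide_subcat_sel]
lemmas cmp1 = C1.cmp_arr[unfolded wide_subcat_Arr[OF sub(2)] wide_subcat_sel]
lemmas cmp2 = C2.cmp_arr[unfolded wide_subcat_Arr[OF sub(3)] wide_subcat_sel]
lemmas idn1 = C1.idn_arr[unfolded wide_subcat_Arr[OF sub(2)] wide_subcat_sel]
lemmas idn2 = C2.idn_arr[unfolded wide_subcat_Arr[OF sub(3)] wide_subcat_sel]

text \<open>If \<open>t\<close> lies outside \<open>S\<close>, then \<open>stable\<close> keeps the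
  whole composite outside \<open>S\<close> and both sides vanish. Hence an intermediate truncation
  does not change the final one.\<close>

lemma act_trunc:
  assumes b: "b \<in> Arr C B' B \<inter> S2" and a: "a \<in> Arr C A A' \<inter> S1" and t: "t \<in> Arr C B A"
  shows "act B A B' A' (gen R b) (gen R a) (trunc B A t) = trunc B' A' (Cmp C a (Cmp C t b))"
proof (cases "t \<in> S")
  case True
  with act_gen[OF b a] t show ?thesis by (simp add: trunc_def)
next
  case False
  then have "Cmp C a (Cmp C t b) \<notin> S" using stable[OF b t a] by blast
  with False show ?thesis
    using linear_map_zero[OF free_module[OF R] free_module[OF R]
        act_linear3[OF gen_closed[OF R b] gen_closed[OF R a]]]
    by (simp add: trunc_def)
qed

lemma act_functorial_gen:
  assumes b: "b \<in> Arr C B' B \<inter> S2" and b': "b' \<in> Arr C B'' B' \<inter> S2"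
    and a: "a \<in> Arr C A A' \<inter> S1" and a': "a' \<in> Arr C A' A'' \<inter> S1" and s: "s \<in> Arr C B A \<inter> S"
  shows "act B A B'' A'' (lcmp2 B'' B' B (gen R b) (gen R b')) (lcmp1 A A' A'' (gen R a') (gen R a)) (gen R s)
      = act B' A' B'' A'' (gen R b') (gen R a') (act B A B' A' (gen R b) (gen R a) (gen R s))"
proof -
  note arr = IntD1[OF b] IntD1[OF b'] IntD1[OF a] IntD1[OF a'] IntD1[OF s]
  have asb: "Cmp C a (Cmp C s b) \<in> Arr C B' A'"
    using arr by (blast intro: cmp_arr)
  have "Cmp C (Cmp C a' a) (Cmp C s (Cmp C b b')) = Cmp C a' (Cmp C (Cmp C a (Cmp C s b)) b')"
    using cmp_assoc[OF cmp_arr[OF cmp_arr[OF arr(2,1)] arr(5)] arr(3,4)]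
      cmp_assoc[OF arr(2) cmp_arr[OF arr(1,5)] arr(3)] cmp_assoc[OF arr(2,1,5)] by simp
  then show ?thesis
    by (simp add: lcmp1_gen[OF a a'] lcmp2_gen[OF b' b] act_gen[OF b a s]
        act_gen[OF cmp2[OF b' b] cmp1[OF a a'] s] act_trunc[OF b' a' asb])
qed

text \<open>Five variables are reduced to single morphisms in two rounds: \<open>b\<close> and
  \<open>b'\<close> by bilinearity, then \<open>a\<close>, \<open>a'\<close> and \<open>s\<close> by
  trilinearity.\<close>

lemma act_functorial:
  assumes b: "b \<in> carrier (hom2 B' B)" and b': "b' \<in> carrier (hom2 B'' B')"
    and a: "a \<in> carrier (hom1 A A')" and a': "a' \<in> carrier (hom1 A' A'')"
    and s: "s \<in> carrier (val B A)"
  shows "act B A B'' A'' (lcmp2 B'' B' B b b') (lcmp1 A A' A'' a' a) s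
      = act B' A' B'' A'' b' a' (act B A B' A' b a s)"
proof -
  note g = gen_closed[OF R]
  note cl1 = linear_map_closed[OF lcmp1_linear_left]
  note cl2 = linear_map_closed[OF lcmp2_linear_left]
  note acl = linear_map_closed[OF act_linear3]
  show ?thesis
  proof (rule bilinear_free_ext[OF R free_module[OF R] _ _ _ _ _ b b',
      where f = "\<lambda>b b'. act B A B'' A'' (lcmp2 B'' B' B b b') (lcmp1 A A' A'' a' a) s"
        and g = "\<lambda>b b'. act B' A' B'' A'' b' a' (act B A B' A' b a s)"])
    fix b b' assume b: "b \<in> Arr C B' B \<inter> S2" and b': "b' \<in> Arr C B'' B' \<inter> S2"
    show "act B A B'' A'' (lcmp2 B'' B' B (gen R b) (gen R b')) (lcmp1 A A' A'' a' a) s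
        = act B' A' B'' A'' (gen R b') a' (act B A B' A' (gen R b) a s)"
      by (rule trilinear_free_ext[OF R free_module[OF R] _ _ _ _ _ _ _ a a' s,
          where f = "\<lambda>a a' s. act B A B'' A'' (lcmp2 B'' B' B (gen R b) (gen R b')) (lcmp1 A A' A'' a' a) s"
            and g = "\<lambda>a a' s. act B' A' B'' A'' (gen R b') a' (act B A B' A' (gen R b) a s)"])
        ((rule linear_map_comp[OF lcmp1_linear_right act_linear2[OF cl2[OF g[OF b'] g[OF b]]]]; assumption),
          (rule linear_map_comp[OF lcmp1_linear_left act_linear2[OF cl2[OF g[OF b'] g[OF b]]]]; assumption),
          (rule act_linear3[OF cl2[OF g[OF b'] g[OF b]] cl1]; assumption),
          (rule linear_map_comp[OF act_linear2[OF g[OF b]] act_linear3[OF g[OF b']]]; assumption),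
          (rule act_linear2[OF g[OF b'] acl[OF g[OF b]]]; assumption),
          (rule linear_map_comp[OF act_linear3[OF g[OF b]] act_linear3[OF g[OF b']]]; assumption),
          (rule act_functorial_gen[OF b b']; assumption))
  qed ((rule linear_map_comp[OF lcmp2_linear_left act_linear1[OF cl1[OF a a'] s]]; assumption),
      (rule linear_map_comp[OF lcmp2_linear_right act_linear1[OF cl1[OF a a'] s]]; assumption),
      (rule linear_map_comp[OF act_linear1[OF a s] act_linear3[OF _ a']]; assumption),
      (rule act_linear1[OF a' acl[OF _ a s]]; assumption))
qed

lemma act_identity:
  assumes "B \<in> Ob C" "A \<in> Ob C" and s: "s \<in> carrier (val B A)"
  shows "act B A B A (gen R (Idn C B)) (gen R (Idn C A)) s = s"
  using R free_module[OF R]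
    act_linear3[OF gen_closed[OF R idn2[OF assms(1)]] gen_closed[OF R idn1[OF assms(2)]]]
    linear_map_ident _ s
proof (rule linear_map_free_ext)
  fix s assume s: "s \<in> Arr C B A \<inter> S"
  then show "act B A B A (gen R (Idn C B)) (gen R (Idn C A)) (gen R s) = gen R s"
    by (simp add: act_gen[OF idn2[OF assms(1)] idn1[OF assms(2)] s] trunc_def
        idn_left[of s B A] idn_right[of s B A])
qed

lemma M_mod_Val: "Val (M_mod R C S) B A = val B A"
  by (simp add: M_mod_def)

lemma M_mod_vmodule:
  "vmodule R (linearize R (wide_subcat C S1)) (linearize R (wide_subcat C S2)) (M_mod R C S)"
  by ((rule vmodule.intro;
      unfold linearize_sel wide_subcat_sel wide_subcat_Arr[OF sub(2)] wide_subcat_Arr[OF sub(3)] M_mod_Val),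
    rule free_module[OF R], (rule act_linear3; assumption), (rule act_linear1; assumption),
    (rule act_linear2; assumption), (rule act_identity; assumption), (rule act_functorial; assumption))

end

section \<open>Proper factorization systems\<close>

locale proper_factorization_category = category F + proper_factorization_system F Es Ms
  for F :: "('o, 'm) cat" and Es Ms
begin

abbreviation cmp (infixr "\<bullet>" 70) where "g \<bullet> f \<equiv> Cmp F g f"

section \<open>Cancellation and closure properties of the two classes\<close>

lemma invertible_iff:
  "f \<in> Arr F A B \<Longrightarrow> invertible F f \<longleftrightarrow> (\<exists>g \<in> Arr F B A. g \<bullet> f = Idn F A \<and> f \<bullet> g = Idn F B)"
  by (auto simp: invertible_def Arr_def)

lemma invertibleI:
  "\<lbrakk>f \<in> Arr F A B; g \<in> Arr F B A; g \<bullet> f = Idn F A; f \<bullet> g = Idn F B\<rbrakk> \<Longrightarrow> invertible F f"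
  by (auto simp: invertible_iff)

lemma Ms_cancel:
  "\<lbrakk>m \<in> Ms; m \<in> Arr F A B; u \<in> Arr F X A; v \<in> Arr F X A; m \<bullet> u = m \<bullet> v\<rbrakk> \<Longrightarrow> u = v"
  using Ms_mono[of m] arr_ob(1)[of u X A] by (auto simp: monomorphism_def Arr_def)

lemma Es_cancel:
  "\<lbrakk>e \<in> Es; e \<in> Arr F A B; u \<in> Arr F B X; v \<in> Arr F B X; u \<bullet> e = v \<bullet> e\<rbrakk> \<Longrightarrow> u = v"
  using Es_epi[of e] arr_ob(2)[of u B X] by (auto simp: epimorphism_def Arr_def)

lemma FS0_Ms:
  "\<lbrakk>m \<in> Ms; m \<in> Arr F A B; invertible F w; w \<in> Arr F A' A\<rbrakk> \<Longrightarrow> m \<bullet> w \<in> Ms"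
  using FS0_M by (auto simp: Arr_def)

lemma FS0_Es:
  "\<lbrakk>e \<in> Es; e \<in> Arr F A B; invertible F w; w \<in> Arr F B B'\<rbrakk> \<Longrightarrow> w \<bullet> e \<in> Es"
  using FS0_E by (auto simp: Arr_def)

lemma lift:
  assumes "e \<in> Es" "e \<in> Arr F A B" "h \<in> Arr F A D" "m \<in> Ms" "m \<in> Arr F D D'" "k \<in> Arr F B D'"
    and "m \<bullet> h = k \<bullet> e"
  obtains l where "l \<in> Arr F B D" "l \<bullet> e = h" "m \<bullet> l = k"
  using FS1[OF assms] by blast

lemma factor:
  assumes "f \<in> Arr F A B"
  obtains C m e where "m \<in> Ms" "m \<in> Arr F C B" "e \<in> Es" "e \<in> Arr F A C" "f = m \<bullet> e"
proof -
  have "f \<in> Ar F" using assms by (simp add: Arr_def)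
  from FS2[OF this] show ?thesis
    using assms that Es_arr Ms_arr by (auto simp: Arr_def)
qed

text \<open>From e l e = e and the fact that e is an epimorphism, the left inverse l is two-sided.
  This and its dual \<open>Ms_split_epi\<close> are how properness enters the closure properties
  below.\<close>

lemma Es_split_mono:
  assumes e: "e \<in> Es" "e \<in> Arr F A B" and l: "l \<in> Arr F B A" "l \<bullet> e = Idn F A"
  shows "invertible F e"
proof (rule invertibleI[OF e(2) l])
  have "(e \<bullet> l) \<bullet> e = Idn F B \<bullet> e"
    using cmp_assoc[OF e(2) l(1) e(2)] l(2) idn_left[OF e(2)] idn_right[OF e(2)] by simp
  then show "e \<bullet> l = Idn F B"
    using Es_cancel[OF e cmp_arr[OF l(1) e(2)] idn_arr[OF arr_ob(2)[OF e(2)]]] by blast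
qed

lemma Ms_split_epi:
  assumes m: "m \<in> Ms" "m \<in> Arr F A B" and l: "l \<in> Arr F B A" "m \<bullet> l = Idn F B"
  shows "invertible F m"
proof (rule invertibleI[OF m(2) l(1) _ l(2)])
  have "m \<bullet> (l \<bullet> m) = m \<bullet> Idn F A"
    using cmp_assoc[OF m(2) l(1) m(2)] l(2) idn_left[OF m(2)] idn_right[OF m(2)] by simp
  then show "l \<bullet> m = Idn F A"
    using Ms_cancel[OF m cmp_arr[OF m(2) l(1)] idn_arr[OF arr_ob(1)[OF m(2)]]] by blast
qed

text \<open>In a factorization 1 = m e, the \<M>-part is split epi and the \<E>-part is split mono.
  So both are invertible, and (FS0) puts their composite in both classes.\<close>

lemma Idn_Ms_Es:
  assumes A: "A \<in> Ob F"
  shows "Idn F A \<in> Ms" "Idn F A \<in> Es"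
proof -
  obtain C m e where m: "m \<in> Ms" "m \<in> Arr F C A" and e: "e \<in> Es" "e \<in> Arr F A C"
    and me: "Idn F A = m \<bullet> e"
    using factor[OF idn_arr[OF A]] .
  have im: "invertible F m" by (rule Ms_split_epi[OF m e(2) me[symmetric]])
  have ie: "invertible F e" by (rule Es_split_mono[OF e m(2) me[symmetric]])
  from FS0_Ms[OF m ie e(2)] me show "Idn F A \<in> Ms" by simp
  from FS0_Es[OF e im m(2)] me show "Idn F A \<in> Es" by simp
qed

text \<open>A morphism in both classes lifts against itself: the diagonal of the square f 1 = 1 f is
  its inverse. Conversely, (FS0) is applied to f composed with identities.\<close>

lemma G_iff_invertible:
  assumes f: "f \<in> Arr F A B"
  shows "f \<in> Es \<inter> Ms \<longleftrightarrow> invertible F f"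
proof
  assume *: "f \<in> Es \<inter> Ms"
  have "f \<bullet> Idn F A = Idn F B \<bullet> f" using f by (simp add: idn_left idn_right)
  then obtain l where "l \<in> Arr F B A" "l \<bullet> f = Idn F A" "f \<bullet> l = Idn F B"
    using * f idn_arr[OF arr_ob(1)[OF f]] idn_arr[OF arr_ob(2)[OF f]]
    by (blast elim: lift)
  then show "invertible F f" by (rule invertibleI[OF f])
next
  assume *: "invertible F f"
  note A = arr_ob(1)[OF f] and B = arr_ob(2)[OF f]
  show "f \<in> Es \<inter> Ms"
    using FS0_Ms[OF Idn_Ms_Es(1)[OF B] idn_arr[OF B] * f]
      FS0_Es[OF Idn_Ms_Es(2)[OF A] idn_arr[OF A] * f] f
    by (simp add: idn_left idn_right)
qed

text \<open>Write v = m e. Lifting e against u v, with the identity on top, gives a left inverse of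
  e. So e is invertible and v = m e is in \<M> by (FS0).\<close>

lemma Ms_right_factor:
  assumes u: "u \<in> Arr F B D" and v: "v \<in> Arr F A B" and uv: "u \<bullet> v \<in> Ms"
  shows "v \<in> Ms"
proof -
  obtain C m e where m: "m \<in> Ms" "m \<in> Arr F C B" and e: "e \<in> Es" "e \<in> Arr F A C"
    and me: "v = m \<bullet> e"
    using factor[OF v] .
  note A = arr_ob(1)[OF v]
  have "(u \<bullet> v) \<bullet> Idn F A = (u \<bullet> m) \<bullet> e"
    using idn_right[OF cmp_arr[OF v u]] cmp_assoc[OF e(2) m(2) u] me by simp
  then obtain l where "l \<in> Arr F C A" "l \<bullet> e = Idn F A"
    using lift[OF e idn_arr[OF A] uv cmp_arr[OF v u] cmp_arr[OF m(2) u]] by blast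
  then have "invertible F e" by (rule Es_split_mono[OF e])
  from FS0_Ms[OF m this e(2)] me show ?thesis by simp
qed

text \<open>Dual to \<open>Ms_right_factor\<close>: the \<M>-part of u acquires a right
  inverse.\<close>

lemma Es_left_factor:
  assumes u: "u \<in> Arr F B D" and v: "v \<in> Arr F A B" and uv: "u \<bullet> v \<in> Es"
  shows "u \<in> Es"
proof -
  obtain C m e where m: "m \<in> Ms" "m \<in> Arr F C D" and e: "e \<in> Es" "e \<in> Arr F B C"
    and me: "u = m \<bullet> e"
    using factor[OF u] .
  note D = arr_ob(2)[OF u]
  have "m \<bullet> (e \<bullet> v) = Idn F D \<bullet> (u \<bullet> v)"
    using idn_left[OF cmp_arr[OF v u]] cmp_assoc[OF v e(2) m(2)] me by simp
  then obtain l where "l \<in> Arr F D C" "m \<bullet> l = Idn F D"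
    using lift[OF uv cmp_arr[OF v u] cmp_arr[OF v e(2)] m idn_arr[OF D]] by blast
  then have "invertible F m" by (rule Ms_split_epi[OF m])
  from FS0_Es[OF e this m(2)] me show ?thesis by simp
qed

text \<open>If m1 m2 = m e, then lifting e first against m1 and then against m2 yields a left
  inverse of e, so e is invertible.\<close>

lemma Ms_comp:
  assumes m1: "m1 \<in> Ms" "m1 \<in> Arr F B D" and m2: "m2 \<in> Ms" "m2 \<in> Arr F A B"
  shows "m1 \<bullet> m2 \<in> Ms"
proof -
  note A = arr_ob(1)[OF m2(2)]
  obtain C m e where m: "m \<in> Ms" "m \<in> Arr F C D" and e: "e \<in> Es" "e \<in> Arr F A C"
    and me: "m1 \<bullet> m2 = m \<bullet> e"
    using factor[OF cmp_arr[OF m2(2) m1(2)]] .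
  obtain l where l: "l \<in> Arr F C B" "l \<bullet> e = m2"
    using lift[OF e m2(2) m1 m(2) me] .
  have "m2 \<bullet> Idn F A = l \<bullet> e" using l(2) idn_right[OF m2(2)] by simp
  then obtain l2 where "l2 \<in> Arr F C A" "l2 \<bullet> e = Idn F A"
    using lift[OF e idn_arr[OF A] m2 l(1)] by blast
  then have "invertible F e" by (rule Es_split_mono[OF e])
  from FS0_Ms[OF m this e(2)] me show ?thesis by simp
qed

lemma Es_comp:
  assumes e1: "e1 \<in> Es" "e1 \<in> Arr F A B" and e2: "e2 \<in> Es" "e2 \<in> Arr F B D"
  shows "e2 \<bullet> e1 \<in> Es"
proof -
  note D = arr_ob(2)[OF e2(2)]
  obtain C m e where m: "m \<in> Ms" "m \<in> Arr F C D" and e: "e \<in> Es" "e \<in> Arr F A C"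
    and me: "e2 \<bullet> e1 = m \<bullet> e"
    using factor[OF cmp_arr[OF e1(2) e2(2)]] .
  obtain l where l: "l \<in> Arr F B C" "m \<bullet> l = e2"
    using lift[OF e1 e(2) m e2(2) me[symmetric]] .
  have "m \<bullet> l = Idn F D \<bullet> e2" using l(2) idn_left[OF e2(2)] by simp
  then obtain l2 where "l2 \<in> Arr F D C" "m \<bullet> l2 = Idn F D"
    using lift[OF e2 l(1) m idn_arr[OF D]] by blast
  then have "invertible F m" by (rule Ms_split_epi[OF m])
  from FS0_Es[OF e this m(2)] me show ?thesis by simp
qed

text \<open>Each factorization lifts against the other. The two diagonals are mutually inverse
  because e and e' can be cancelled.\<close>

lemma factor_unique:
  assumes m: "m \<in> Ms" "m \<in> Arr F C B" and e: "e \<in> Es" "e \<in> Arr F A C"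
    and m': "m' \<in> Ms" "m' \<in> Arr F C' B" and e': "e' \<in> Es" "e' \<in> Arr F A C'"
    and eq: "m \<bullet> e = m' \<bullet> e'"
  obtains w where "w \<in> Arr F C C'" "w \<in> Es \<inter> Ms" "w \<bullet> e = e'" "m' \<bullet> w = m"
proof -
  note C = arr_ob(1)[OF m(2)] and C' = arr_ob(1)[OF m'(2)]
  obtain w where w: "w \<in> Arr F C C'" "w \<bullet> e = e'" "m' \<bullet> w = m"
    using lift[OF e e'(2) m' m(2) eq[symmetric]] .
  obtain w' where w': "w' \<in> Arr F C' C" "w' \<bullet> e' = e" "m \<bullet> w' = m'"
    using lift[OF e' e(2) m m'(2) eq] .
  have "(w' \<bullet> w) \<bullet> e = Idn F C \<bullet> e"
    using cmp_assoc[OF e(2) w(1) w'(1)] w w' idn_left[OF e(2)] by simp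
  then have 1: "w' \<bullet> w = Idn F C"
    using Es_cancel[OF e cmp_arr[OF w(1) w'(1)] idn_arr[OF C]] by blast
  have "(w \<bullet> w') \<bullet> e' = Idn F C' \<bullet> e'"
    using cmp_assoc[OF e'(2) w'(1) w(1)] w w' idn_left[OF e'(2)] by simp
  then have 2: "w \<bullet> w' = Idn F C'"
    using Es_cancel[OF e' cmp_arr[OF w'(1) w(1)] idn_arr[OF C']] by blast
  from invertibleI[OF w(1) w'(1) 1 2] show ?thesis
    using that w G_iff_invertible[OF w(1)] by blast
qed

lemma G_inverse:
  assumes "g \<in> Arr F A B" "g \<in> Es \<inter> Ms"
  obtains h where "h \<in> Arr F B A" "h \<in> Es \<inter> Ms" "h \<bullet> g = Idn F A" "g \<bullet> h = Idn F B"
proof -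
  obtain h where h: "h \<in> Arr F B A" "h \<bullet> g = Idn F A" "g \<bullet> h = Idn F B"
    using assms G_iff_invertible invertible_iff by blast
  from invertibleI[OF h(1) assms(1) h(3,2)] show ?thesis
    using that h G_iff_invertible[OF h(1)] by blast
qed

lemma groupoid_category: "category (wide_subcat F (Es \<inter> Ms))"
  using Es_arr by (intro wide_subcat_category) (auto intro: Idn_Ms_Es Es_comp Ms_comp)

text \<open>The factor \<open>a\<close> is removed by \<open>Ms_right_factor\<close>; the factor
  \<open>b\<close> is removed because it is invertible. This is the condition \<open>stable\<close>
  for the module \<open>M\<close>.\<close>

lemma Ms_stable:
  assumes b: "b \<in> Arr F B' B \<inter> (Es \<inter> Ms)" and t: "t \<in> Arr F B A" and a: "a \<in> Arr F A A'"
    and atb: "a \<bullet> (t \<bullet> b) \<in> Ms"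
  shows "t \<in> Ms"
proof -
  have b': "b \<in> Arr F B' B" "b \<in> Es \<inter> Ms" using b by auto
  have tb: "t \<bullet> b \<in> Ms" by (rule Ms_right_factor[OF a cmp_arr[OF b'(1) t] atb])
  obtain h where h: "h \<in> Arr F B B'" "h \<in> Es \<inter> Ms" "b \<bullet> h = Idn F B"
    using G_inverse[OF b'] .
  have "(t \<bullet> b) \<bullet> h \<in> Ms"
    using Ms_comp[OF tb cmp_arr[OF b'(1) t]] h by blast
  then show ?thesis
    using cmp_assoc[OF h(1) b'(1) t] h(3) idn_right[OF t] by simp
qed

text \<open>The mirror image of \<open>Ms_stable\<close>: the invertible factor now stands on the
  left, and \<open>Es_left_factor\<close> removes the arbitrary one on the right.\<close>

lemma Es_stable:
  assumes b: "b \<in> Arr F B' B" and t: "t \<in> Arr F B A" and a: "a \<in> Arr F A A' \<inter> (Es \<inter> Ms)"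
    and atb: "a \<bullet> (t \<bullet> b) \<in> Es"
  shows "t \<in> Es"
proof -
  have a': "a \<in> Arr F A A'" "a \<in> Es \<inter> Ms" using a by auto
  have at: "a \<bullet> t \<in> Es"
    using Es_left_factor[OF cmp_arr[OF t a'(1)] b] atb cmp_assoc[OF b t a'(1)] by simp
  obtain h where h: "h \<in> Arr F A' A" "h \<in> Es \<inter> Ms" "h \<bullet> a = Idn F A"
    using G_inverse[OF a'] .
  have "h \<bullet> (a \<bullet> t) \<in> Es"
    using Es_comp[OF at cmp_arr[OF t a'(1)] _ h(1)] h(2) by blast
  then show ?thesis
    using cmp_assoc[OF t a'(1) h(1)] h(3) idn_left[OF t] by simp
qed

subsection \<open>Rank of a morphism\<close>

abbreviation "Msl B \<equiv> slice_cat (wide_subcat F Ms) B"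

text \<open>Written as the image of a singleton under the relation in \<open>iso_classes\<close>, so
  that it is a member of that quotient by \<open>quotientI\<close>.\<close>

definition subobject_class :: "'o \<Rightarrow> 'm \<Rightarrow> 'm set" where
  "subobject_class B m =
     {(m, m'). m \<in> Ob (Msl B) \<and> m' \<in> Ob (Msl B) \<and> isomorphic_in (Msl B) m m'} `` {m}"

text \<open>The subobjects of \<open>B\<close> contained in \<open>m\<close>, that is, factoring
  through it, up to isomorphism. Their number, the rank, measures the size of an image.\<close>

definition below :: "'o \<Rightarrow> 'm \<Rightarrow> 'm set set" where
  "below B m = {subobject_class B (m \<bullet> k) | k. k \<in> Ms \<and> Trg F k = Src F m}"

definition rank :: "'o \<Rightarrow> 'm \<Rightarrow> nat" where
  "rank B m = card (below B m)"

lemma Msl_Ob: "m \<in> Ob (Msl B) \<longleftrightarrow> m \<in> Ms \<and> Trg F m = B"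
  by (simp add: slice_cat_def wide_subcat_sel)

lemma Ms_Arr: "\<lbrakk>m \<in> Ms; Trg F m = B\<rbrakk> \<Longrightarrow> m \<in> Arr F (Src F m) B"
  using Ms_arr by (auto simp: Arr_def)

text \<open>Of the relation inside a class the rank argument uses two facts: this reflexivity, and
  that members factor through the representative (\<open>subobject_class_factor\<close>).\<close>

lemma subobject_class_self:
  assumes m: "m \<in> Ms" "m \<in> Arr F C B"
  shows "m \<in> subobject_class B m"
proof -
  have C: "C \<in> Ob F" "Src F m = C" "Trg F m = B"
    using m arr_ob by (auto simp: Arr_def)
  note i = Idn_Ms_Es(1)[OF C(1)] idn_arr[OF C(1)] idn_right[OF m(2)] idn_left[OF idn_arr[OF C(1)]]
  have "invertible (Msl B) (m, Idn F C, m)"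
    using i m C unfolding invertible_def
    by (auto simp: slice_cat_def wide_subcat_sel wide_subcat_Arr[OF Ms_arr] Arr_def)
  moreover have "(m, Idn F C, m) \<in> Arr (Msl B) m m"
    using i m C by (auto simp: slice_cat_def wide_subcat_sel wide_subcat_Arr[OF Ms_arr] Arr_def)
  ultimately show ?thesis
    using m C by (auto simp: subobject_class_def isomorphic_in_def Msl_Ob)
qed

lemma subobject_class_factor:
  assumes "n \<in> subobject_class B m"
  obtains v where "v \<in> Arr F (Src F n) (Src F m)" "m \<bullet> v = n"
proof -
  from assms obtain f where f: "f \<in> Arr (Msl B) m n" "invertible (Msl B) f"
    by (auto simp: subobject_class_def isomorphic_in_def)
  \<comment> \<open>The isomorphism runs from \<open>m\<close> to \<open>n\<close>; the factor
    \<open>v\<close> is the middle component of its inverse.\<close>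
  then obtain g where "g \<in> Arr (Msl B) n m"
    by (auto simp: invertible_def Arr_def)
  then show ?thesis
    using that Ms_arr[THEN subsetD]
    by (auto simp: slice_cat_def wide_subcat_sel wide_subcat_Arr[OF Ms_arr] Arr_def)
qed

lemma below_mono:
  assumes m: "m \<in> Ms" "m \<in> Arr F C B" and h: "h \<in> Ms" "h \<in> Arr F D C"
  shows "below B (m \<bullet> h) \<subseteq> below B m"
proof
  fix c assume "c \<in> below B (m \<bullet> h)"
  then obtain k where k: "k \<in> Ms" "Trg F k = Src F (m \<bullet> h)" "c = subobject_class B ((m \<bullet> h) \<bullet> k)"
    by (auto simp: below_def)
  have k': "k \<in> Arr F (Src F k) D"
    using k cmp_arr[OF h(2) m(2)] by (intro Ms_Arr) (auto simp: Arr_def)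
  have "c = subobject_class B (m \<bullet> (h \<bullet> k))" "h \<bullet> k \<in> Ms" "Trg F (h \<bullet> k) = Src F m"
    using k(3) cmp_assoc[OF k' h(2) m(2)] Ms_comp[OF h k(1) k'] cmp_arr[OF k' h(2)] m(2)
    by (auto simp: Arr_def)
  then show "c \<in> below B m" by (auto simp: below_def)
qed

lemma self_below:
  assumes m: "m \<in> Ms" "m \<in> Arr F C B"
  shows "subobject_class B m \<in> below B m"
proof -
  note C = arr_ob(1)[OF m(2)]
  have "subobject_class B m = subobject_class B (m \<bullet> Idn F C)" "Trg F (Idn F C) = Src F m"
    using idn_right[OF m(2)] idn_arr[OF C] m(2) by (auto simp: Arr_def)
  then show ?thesis
    using Idn_Ms_Es(1)[OF C] unfolding below_def by blast
qed

text \<open>Otherwise m = m h k v for some k and v. Cancelling the monomorphism m gives h a right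
  inverse, and a split epi in \<M> is invertible.\<close>

lemma self_not_below:
  assumes m: "m \<in> Ms" "m \<in> Arr F C B" and h: "h \<in> Ms" "h \<in> Arr F D C" and ni: "\<not> invertible F h"
  shows "subobject_class B m \<notin> below B (m \<bullet> h)"
proof
  assume "subobject_class B m \<in> below B (m \<bullet> h)"
  then obtain k where k: "k \<in> Ms" "Trg F k = Src F (m \<bullet> h)"
    "subobject_class B m = subobject_class B ((m \<bullet> h) \<bullet> k)"
    by (auto simp: below_def)
  have k': "k \<in> Arr F (Src F k) D"
    using k cmp_arr[OF h(2) m(2)] by (intro Ms_Arr) (auto simp: Arr_def)
  have mhk: "(m \<bullet> h) \<bullet> k \<in> Arr F (Src F k) B"
    by (rule cmp_arr[OF k' cmp_arr[OF h(2) m(2)]])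
  have "m \<in> subobject_class B ((m \<bullet> h) \<bullet> k)"
    using subobject_class_self[OF m] k(3) by simp
  then obtain v where v: "v \<in> Arr F C (Src F k)" "((m \<bullet> h) \<bullet> k) \<bullet> v = m"
    using mhk m(2) by (auto elim!: subobject_class_factor simp: Arr_def)
  note C = arr_ob(1)[OF m(2)]
  have kv: "k \<bullet> v \<in> Arr F C D" by (rule cmp_arr[OF v(1) k'])
  have "m \<bullet> (h \<bullet> (k \<bullet> v)) = m \<bullet> Idn F C"
    using v(2) cmp_assoc[OF v(1) k' cmp_arr[OF h(2) m(2)]] cmp_assoc[OF kv h(2) m(2)] idn_right[OF m(2)]
    by simp
  then have "h \<bullet> (k \<bullet> v) = Idn F C"
    using Ms_cancel[OF m cmp_arr[OF kv h(2)] idn_arr[OF C]] by blast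
  with Ms_split_epi[OF h kv] ni show False by blast
qed

lemma below_iso_classes:
  assumes m: "m \<in> Ms" "m \<in> Arr F C B"
  shows "below B m \<subseteq> iso_classes (Msl B)"
proof
  fix c assume "c \<in> below B m"
  then obtain k where k: "k \<in> Ms" "Trg F k = Src F m" "c = subobject_class B (m \<bullet> k)"
    by (auto simp: below_def)
  have k': "k \<in> Arr F (Src F k) C"
    using k m by (intro Ms_Arr) (auto simp: Arr_def)
  have "m \<bullet> k \<in> Ob (Msl B)"
    using Ms_comp[OF m k(1) k'] cmp_arr[OF k' m(2)] by (auto simp: Msl_Ob Arr_def)
  then show "c \<in> iso_classes (Msl B)"
    unfolding k(3) iso_classes_def subobject_class_def by (rule quotientI)
qed

section \<open>Chosen factorizations and descent of rank\<close>

definition mono_part :: "'m \<Rightarrow> 'm" where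
  "mono_part f = (SOME m. \<exists>C e. m \<in> Ms \<and> m \<in> Arr F C (Trg F f) \<and> e \<in> Es \<and> e \<in> Arr F (Src F f) C \<and> f = m \<bullet> e)"

text \<open>Chosen after \<open>mono_part f\<close> and relative to it, so that the two choices form
  one factorization.\<close>

definition epi_part :: "'m \<Rightarrow> 'm" where
  "epi_part f = (SOME e. e \<in> Es \<and> e \<in> Arr F (Src F f) (Src F (mono_part f)) \<and> f = mono_part f \<bullet> e)"

abbreviation "img_ob f \<equiv> Src F (mono_part f)"

lemma parts:
  assumes f: "f \<in> Arr F A B"
  shows "mono_part f \<in> Ms" "mono_part f \<in> Arr F (img_ob f) B"
    and "epi_part f \<in> Es" "epi_part f \<in> Arr F A (img_ob f)" "mono_part f \<bullet> epi_part f = f"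
proof -
  have AB: "Src F f = A" "Trg F f = B" using f by (auto simp: Arr_def)
  have "\<exists>m C e. m \<in> Ms \<and> m \<in> Arr F C (Trg F f) \<and> e \<in> Es \<and> e \<in> Arr F (Src F f) C \<and> f = m \<bullet> e"
    using factor[OF f] AB by metis
  from someI_ex[OF this, folded mono_part_def]
  obtain C e where m: "mono_part f \<in> Ms" "mono_part f \<in> Arr F C B"
    and e: "e \<in> Es" "e \<in> Arr F A C" "f = mono_part f \<bullet> e"
    using AB by auto
  have C: "C = img_ob f" using m by (simp add: Arr_def)
  show "mono_part f \<in> Ms" "mono_part f \<in> Arr F (img_ob f) B"
    using m C by auto
  have "\<exists>e. e \<in> Es \<and> e \<in> Arr F (Src F f) (img_ob f) \<and> f = mono_part f \<bullet> e"
    using e C AB by blast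
  from someI_ex[OF this, folded epi_part_def]
  show "epi_part f \<in> Es" "epi_part f \<in> Arr F A (img_ob f)" "mono_part f \<bullet> epi_part f = f"
    using AB by auto
qed

context
  fixes B
  assumes fin: "finite (iso_classes (Msl B))"
begin

lemma rank_mono:
  "\<lbrakk>m \<in> Ms; m \<in> Arr F C B; h \<in> Ms; h \<in> Arr F D C\<rbrakk> \<Longrightarrow> rank B (m \<bullet> h) \<le> rank B m"
  unfolding rank_def
  by (intro card_mono finite_subset[OF below_iso_classes fin] below_mono)

lemma rank_strict:
  assumes "m \<in> Ms" "m \<in> Arr F C B" "h \<in> Ms" "h \<in> Arr F D C" "\<not> invertible F h"
  shows "rank B (m \<bullet> h) < rank B m"
  unfolding rank_def
proof (rule psubset_card_mono)
  show "finite (below B m)" using below_iso_classes[OF assms(1,2)] fin by (rule finite_subset)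
  show "below B (m \<bullet> h) \<subset> below B m"
    using below_mono[OF assms(1-4)] self_below[OF assms(1,2)] self_not_below[OF assms] by blast
qed

text \<open>Strict, with a successor, because the filtration used later is defined by strict
  inequalities on the rank; the bound is the index of its top level.\<close>

lemma rank_bound:
  "\<lbrakk>m \<in> Ms; m \<in> Arr F C B\<rbrakk> \<Longrightarrow> rank B m < Suc (card (iso_classes (Msl B)))"
  unfolding rank_def less_Suc_eq_le by (intro card_mono fin below_iso_classes)

text \<open>By \<open>factor_unique\<close> the chosen \<M>-part of m e is m w with w in \<G>. So
  the rank of the chosen part may be estimated from any factorization.\<close>

lemma rank_mono_part:
  assumes m: "m \<in> Ms" "m \<in> Arr F C B" and e: "e \<in> Es" "e \<in> Arr F A C"
  shows "rank B (mono_part (m \<bullet> e)) \<le> rank B m"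
proof -
  note p = parts[OF cmp_arr[OF e(2) m(2)]]
  obtain w where "w \<in> Arr F (img_ob (m \<bullet> e)) C" "w \<in> Es \<inter> Ms" "m \<bullet> w = mono_part (m \<bullet> e)"
    using factor_unique[OF p(1-4) m e p(5)] .
  then show ?thesis using rank_mono[OF m, of w] by auto
qed

text \<open>Were the \<M>-part of h invertible, h would lie in \<E> by (FS0). So the image of m h e
  is m followed into by a non-invertible \<M>-morphism, a strictly smaller subobject. This is the
  descent that (p4) feeds.\<close>

lemma rank_insert:
  assumes f: "f \<in> Arr F A B" and h: "h \<in> Arr F (img_ob f) (img_ob f)" "h \<notin> Es"
  shows "rank B (mono_part (mono_part f \<bullet> (h \<bullet> epi_part f))) < rank B (mono_part f)"
proof -
  note p = parts[OF f]
  note q = parts[OF h(1)]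
  have ni: "\<not> invertible F (mono_part h)"
    using FS0_Es[OF q(3,4) _ q(2)] q(5) h(2) by auto
  note m = Ms_comp[OF p(1,2) q(1,2)] cmp_arr[OF q(2) p(2)]
  note e = Es_comp[OF p(3,4) q(3,4)] cmp_arr[OF p(4) q(4)]
  have "mono_part f \<bullet> (h \<bullet> epi_part f) = (mono_part f \<bullet> mono_part h) \<bullet> (epi_part h \<bullet> epi_part f)"
    using cmp_assoc[OF p(4) q(4) q(2)] cmp_assoc[OF e(2) q(2) p(2)] q(5) by simp
  then have "rank B (mono_part (mono_part f \<bullet> (h \<bullet> epi_part f))) \<le> rank B (mono_part f \<bullet> mono_part h)"
    using rank_mono_part[OF m e] by simp
  also have "\<dots> < rank B (mono_part f)"
    by (rule rank_strict[OF p(1,2) q(1,2) ni])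
  finally show ?thesis .
qed

end

end

section \<open>The adjunction\<close>

locale idempotent_factorization =
  proper_factorization_category F Es Ms + idempotent_axiom R F Es Ms p
  for R :: "('r, 'x) ring_scheme" and F :: "('o, 'm) cat" and Es Ms p +
  assumes R: "cring R"
begin

section \<open>Notation and calculus of the two modules\<close>

abbreviation "Gr \<equiv> Es \<inter> Ms"
abbreviation "\<F> \<equiv> linearize R F"
abbreviation "\<G> \<equiv> linearize R (groupoid_part F Es Ms)"
abbreviation "E \<equiv> E_mod R F Es"
abbreviation "M \<equiv> M_mod R F Ms"
abbreviation "homF A B \<equiv> free_mod R (Arr F A B)"
abbreviation "homG A B \<equiv> free_mod R (Arr F A B \<inter> Gr)"
abbreviation "homE A B \<equiv> free_mod R (Arr F A B \<inter> Es)"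
abbreviation "homM A B \<equiv> free_mod R (Arr F A B \<inter> Ms)"
abbreviation "fc \<equiv> LCmp \<F>"
abbreviation "gc \<equiv> LCmp \<G>"
abbreviation "oneF A \<equiv> gen R (Idn F A)"

interpretation G: category "groupoid_part F Es Ms"
  unfolding groupoid_part_def by (rule groupoid_category)

interpretation LF: linear_category R \<F>
  by (rule linearize_linear_category[OF R])

interpretation LG: linear_category R \<G>
  by (rule G.linearize_linear_category[OF R])

lemma Arr_Ar: "Arr F A B \<inter> Ar F = Arr F A B"
  by (auto simp: Arr_def)

lemma groupoid_Arr: "Arr (groupoid_part F Es Ms) A B = Arr F A B \<inter> Gr"
  unfolding groupoid_part_def using Es_arr by (intro wide_subcat_Arr) auto

lemma groupoid_sel:
  "Ob (groupoid_part F Es Ms) = Ob F" "Idn (groupoid_part F Es Ms) = Idn F"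
  "Cmp (groupoid_part F Es Ms) = Cmp F"
  by (simp_all add: groupoid_part_def wide_subcat_sel)

text \<open>Here all morphisms of F act by precomposition and only those of \<open>Gr\<close> by
  postcomposition; in \<open>Mb\<close> these are exchanged. The assignment matches
  \<open>Es_stable\<close> and \<open>Ms_stable\<close>.\<close>

interpretation Eb: truncated_bimodule F R Es Gr "Ar F"
proof (rule truncated_bimodule.intro[OF category_axioms], rule truncated_bimodule_axioms.intro)
  show "t \<in> Es" if "b \<in> Arr F B' B \<inter> Ar F" "t \<in> Arr F B A" "a \<in> Arr F A A' \<inter> Gr" "a \<bullet> (t \<bullet> b) \<in> Es"
    for A B A' B' a t b
    using Es_stable[of b B' B t A a A'] that by blast
qed (use Es_arr in \<open>auto simp: wide_subcat_all R groupoid_category category_axioms\<close>)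

interpretation Mb: truncated_bimodule F R Ms "Ar F" Gr
proof (rule truncated_bimodule.intro[OF category_axioms], rule truncated_bimodule_axioms.intro)
  show "t \<in> Ms" if "b \<in> Arr F B' B \<inter> Gr" "t \<in> Arr F B A" "a \<in> Arr F A A' \<inter> Ar F" "a \<bullet> (t \<bullet> b) \<in> Ms"
    for A B A' B' a t b
    using Ms_stable[of b B' B t A a A'] that by blast
qed (use Ms_arr in \<open>auto simp: wide_subcat_all R groupoid_category category_axioms\<close>)

lemma sel:
  "LOb \<F> = Ob F" "LHom \<F> A B = homF A B" "LId \<F> A = oneF A"
  "LOb \<G> = Ob F" "LHom \<G> A B = homG A B" "LId \<G> A = oneF A"
  "Val M A B = homM A B" "Val E A B = homE A B"
  by (simp_all add: linearize_sel groupoid_sel groupoid_Arr M_mod_def E_mod_def)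

lemma E_vmodule: "vmodule R \<G> \<F> E"
  using Eb.M_mod_vmodule by (simp add: wide_subcat_all E_mod_eq_M_mod groupoid_part_def)

lemma M_vmodule: "vmodule R \<F> \<G> M"
  using Mb.M_mod_vmodule by (simp add: wide_subcat_all groupoid_part_def)

interpretation E: vmodule R \<G> \<F> E by (rule E_vmodule)
interpretation M: vmodule R \<F> \<G> M by (rule M_vmodule)

interpretation ME: composable_modules R \<G> \<F> \<G> E M
  by (intro composable_modules.intro composable_modules_axioms.intro R
      LF.linear_category_axioms LG.linear_category_axioms E_vmodule M_vmodule)

interpretation EM: composable_modules R \<F> \<G> \<F> M E
  by (intro composable_modules.intro composable_modules_axioms.intro R
      LF.linear_category_axioms LG.linear_category_axioms E_vmodule M_vmodule)

lemmas E_lin1 = Eb.act_linear1[unfolded Arr_Ar, folded E_mod_eq_M_mod]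
lemmas E_lin2 = Eb.act_linear2[unfolded Arr_Ar, folded E_mod_eq_M_mod]
lemmas E_lin3 = Eb.act_linear3[unfolded Arr_Ar, folded E_mod_eq_M_mod]
lemmas E_gen = Eb.act_gen[unfolded Arr_Ar, folded E_mod_eq_M_mod]
lemmas M_lin1 = Mb.act_linear1[unfolded Arr_Ar]
lemmas M_lin2 = Mb.act_linear2[unfolded Arr_Ar]
lemmas M_lin3 = Mb.act_linear3[unfolded Arr_Ar]
lemmas M_gen = Mb.act_gen[unfolded Arr_Ar]
lemmas E_cl = linear_map_closed[OF E_lin3]
lemmas M_cl = linear_map_closed[OF M_lin3]

lemmas f_left = lcmp_linear_left[OF R]
lemmas f_right = lcmp_linear_right[OF R]
lemmas f_gen = lcmp_gen[OF R]
lemmas f_cl = linear_map_closed[OF f_left]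
lemmas f_assoc = lcmp_assoc_lin[OF R]

lemmas g_left = G.lcmp_linear_left[OF R, unfolded groupoid_Arr]
lemmas g_right = G.lcmp_linear_right[OF R, unfolded groupoid_Arr]
lemmas g_gen = G.lcmp_gen[OF R, unfolded groupoid_Arr groupoid_sel]
lemmas g_cl = linear_map_closed[OF g_left]
lemmas G_comp = G.cmp_arr[unfolded groupoid_Arr groupoid_sel]

lemma genF: "f \<in> Arr F A B \<Longrightarrow> gen R f \<in> carrier (homF A B)"
  by (rule gen_closed[OF R])
lemma genG: "\<lbrakk>f \<in> Arr F A B; f \<in> Gr\<rbrakk> \<Longrightarrow> gen R f \<in> carrier (homG A B)"
  by (rule gen_closed[OF R]) simp
lemma genE: "\<lbrakk>f \<in> Arr F A B; f \<in> Es\<rbrakk> \<Longrightarrow> gen R f \<in> carrier (homE A B)"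
  by (rule gen_closed[OF R]) simp
lemma genM: "\<lbrakk>f \<in> Arr F A B; f \<in> Ms\<rbrakk> \<Longrightarrow> gen R f \<in> carrier (homM A B)"
  by (rule gen_closed[OF R]) simp

lemma idG: "A \<in> Ob F \<Longrightarrow> Idn F A \<in> Arr F A A \<inter> Gr"
  using idn_arr Idn_Ms_Es by blast

lemmas one_F = genF[OF idn_arr]
lemma one_G: "A \<in> Ob F \<Longrightarrow> oneF A \<in> carrier (homG A A)"
  using idG by (intro genG) auto
lemma one_E: "A \<in> Ob F \<Longrightarrow> oneF A \<in> carrier (homE A A)"
  using idG by (intro genE) auto
lemma one_M: "A \<in> Ob F \<Longrightarrow> oneF A \<in> carrier (homM A A)"
  using idG by (intro genM) auto

lemma subE: "x \<in> carrier (homE A B) \<Longrightarrow> x \<in> carrier (homF A B)"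
  using free_mod_mono[of "Arr F A B \<inter> Es" "Arr F A B" R] by blast
lemma subM: "x \<in> carrier (homM A B) \<Longrightarrow> x \<in> carrier (homF A B)"
  using free_mod_mono[of "Arr F A B \<inter> Ms" "Arr F A B" R] by blast

lemma lin_E: "linear_map R (homF A B) N f \<Longrightarrow> linear_map R (homE A B) N f"
  by (erule linear_map_free_mono) simp
lemma lin_M: "linear_map R (homF A B) N f \<Longrightarrow> linear_map R (homM A B) N f"
  by (erule linear_map_free_mono) simp

lemma p_closed: "A \<in> Ob F \<Longrightarrow> p A \<in> carrier (homF A A)"
  using p_hom by (simp add: sel)

lemmas mod = free_module[OF R]

abbreviation "Etr \<equiv> Eb.trunc"
abbreviation "Mtr \<equiv> Mb.trunc"

lemma Etr_simps: "f \<in> Es \<Longrightarrow> Etr A B f = gen R f" "f \<notin> Es \<Longrightarrow> Etr A B f = \<zero>\<^bsub>homE A B\<^esub>"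
  by (simp_all add: Eb.trunc_def)
lemma Mtr_simps: "f \<in> Ms \<Longrightarrow> Mtr A B f = gen R f" "f \<notin> Ms \<Longrightarrow> Mtr A B f = \<zero>\<^bsub>homM A B\<^esub>"
  by (simp_all add: Mb.trunc_def)

lemma E_gen_left:
  assumes "b \<in> Arr F B' B" "e \<in> Arr F B A \<inter> Es"
  shows "Act E B A B' A (gen R b) (oneF A) (gen R e) = Etr B' A (e \<bullet> b)"
proof -
  have e: "e \<in> Arr F B A" using assms by auto
  show ?thesis
    using E_gen[OF assms(1) idG[OF arr_ob(2)[OF e]] assms(2)]
    by (simp add: idn_left[OF cmp_arr[OF assms(1) e]])
qed

lemma E_gen_right:
  assumes "a \<in> Arr F A A' \<inter> Gr" "e \<in> Arr F B A \<inter> Es"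
  shows "Act E B A B A' (oneF B) (gen R a) (gen R e) = gen R (a \<bullet> e)"
proof -
  have e: "e \<in> Arr F B A" "e \<in> Es" and a: "a \<in> Arr F A A'" "a \<in> Es" using assms by auto
  show ?thesis
    using E_gen[OF idn_arr[OF arr_ob(1)[OF e(1)]] assms] Es_comp[OF e(2,1) a(2,1)]
    by (simp add: idn_right[OF e(1)] Etr_simps)
qed

lemma M_gen_right:
  assumes "a \<in> Arr F A A'" "m \<in> Arr F B A \<inter> Ms"
  shows "Act M B A B A' (oneF B) (gen R a) (gen R m) = Mtr B A' (a \<bullet> m)"
proof -
  have m: "m \<in> Arr F B A" using assms by auto
  show ?thesis
    using M_gen[OF idG[OF arr_ob(1)[OF m]] assms] by (simp add: idn_right[OF m])
qed

lemma M_gen_left: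
  assumes "b \<in> Arr F B' B \<inter> Gr" "m \<in> Arr F B A \<inter> Ms"
  shows "Act M B A B' A (gen R b) (oneF A) (gen R m) = gen R (m \<bullet> b)"
proof -
  have m: "m \<in> Arr F B A" "m \<in> Ms" and b: "b \<in> Arr F B' B" "b \<in> Ms" using assms by auto
  note mb = cmp_arr[OF b(1) m(1)]
  show ?thesis
    using M_gen[OF assms(1) idn_arr[OF arr_ob(2)[OF m(1)]] assms(2)] Ms_comp[OF m(2,1) b(2,1)]
    by (simp add: idn_left[OF mb] Mtr_simps)
qed

subsection \<open>The unit\<close>

abbreviation "unit \<equiv> EM_unit R F Es Ms"

lemmas ME_module = ME.coend_module[unfolded sel]
lemmas ME_left = ME.tens_linear_left[unfolded sel]
lemmas ME_right = ME.tens_linear_right[unfolded sel]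
lemmas ME_balance = ME.tens_balance[unfolded sel]
lemmas ME_closed = ME.tens_closed[unfolded sel]

lemma unit_tens_closed:
  "\<lbrakk>C \<in> Ob F; D \<in> Ob F; g \<in> Arr F C D \<inter> Gr\<rbrakk>
    \<Longrightarrow> ME.tens C D C (gen R g) (oneF C) \<in> carrier (ME.T C D)"
  by (rule ME_closed) (auto intro: genE one_M)

lemma unit_linear:
  "\<lbrakk>C \<in> Ob F; D \<in> Ob F\<rbrakk> \<Longrightarrow> linear_map R (homG C D) (ME.T C D) (unit C D)"
  unfolding EM_unit_def Let_def
  by (rule lin_ext_linear[OF ME_module unit_tens_closed])

lemma unit_gen:
  "\<lbrakk>C \<in> Ob F; D \<in> Ob F; g \<in> Arr F C D \<inter> Gr\<rbrakk>
    \<Longrightarrow> unit C D (gen R g) = ME.tens C D C (gen R g) (oneF C)"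
  unfolding EM_unit_def Let_def
  by (rule lin_ext_gen[where \<phi> = "\<lambda>g. ME.tens C D C (gen R g) (oneF C)"])
    (simp_all add: ME_module unit_tens_closed)

lemma ME_tens_gen:
  assumes ob: "C \<in> Ob F" "D \<in> Ob F" "B \<in> Ob F"
    and e: "e \<in> Arr F B D \<inter> Es" and m: "m \<in> Arr F C B \<inter> Ms"
  shows "ME.tens C D B (gen R e) (gen R m)
    = (if e \<bullet> m \<in> Gr then unit C D (gen R (e \<bullet> m)) else \<zero>\<^bsub>ME.T C D\<^esub>)"
proof -
  have e': "e \<in> Arr F B D" "e \<in> Es" and m': "m \<in> Arr F C B" "m \<in> Ms" using e m by auto
  note em = cmp_arr[OF m'(1) e'(1)]
  have M1: "Act M C C C B (oneF C) (gen R m) (oneF C) = gen R m"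
    using M_gen_right[OF m'(1), of "Idn F C" C] idG[OF ob(1)] m'
    by (simp add: idn_right Mtr_simps)
  have E1: "Act E D D B D (gen R e) (oneF D) (oneF D) = gen R e"
    using E_gen_left[OF e'(1), of "Idn F D" D] idG[OF ob(2)] e'
    by (simp add: idn_left Etr_simps)
  have 1: "ME.tens C D B (gen R e) (gen R m) = ME.tens C D C (Etr C D (e \<bullet> m)) (oneF C)"
    using ME_balance[OF ob(1,2,1,3) genF[OF m'(1)] genE[OF e'] one_M[OF ob(1)]]
    by (simp add: M1 E_gen_left[OF m'(1) e])
  have 2: "ME.tens C D B (gen R e) (gen R m) = ME.tens C D D (oneF D) (Mtr C D (e \<bullet> m))"
    using ME_balance[OF ob(1,2,3,2) genF[OF e'(1)] one_E[OF ob(2)] genM[OF m']]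
    by (simp add: E1 M_gen_right[OF e'(1) m])
  show ?thesis
  proof (cases "e \<bullet> m \<in> Gr")
    case True
    with em have "e \<bullet> m \<in> Arr F C D \<inter> Gr" by simp
    with 1 True show ?thesis by (simp add: unit_gen[OF ob(1,2)] Etr_simps)
  next
    \<comment> \<open>Outside \<G> the composite e m misses \<E> or \<M>. If it misses \<M>, form
      \<open>2\<close> of the tensor vanishes; if it misses \<E>, form \<open>1\<close>
      does.\<close>
    case False
    show ?thesis
    proof (cases "e \<bullet> m \<in> Es")
      case True
      with False have "e \<bullet> m \<notin> Ms" by simp
      then show ?thesis
        using 2 False linear_map_zero[OF mod ME_module[OF ob(1,2)] ME_right[OF ob(1,2,2) one_E[OF ob(2)]]]
        by (simp add: Mtr_simps)
    next
      case e: False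
      then show ?thesis
        using 1 False linear_map_zero[OF mod ME_module[OF ob(1,2)] ME_left[OF ob(1,2,1) one_M[OF ob(1)]]]
        by (simp add: Etr_simps)
    qed
  qed
qed

lemma unit_two_cell: "two_cell R \<G> \<G> (id_mod \<G>) (mod_comp R \<G> \<F> \<G> M E) unit"
proof (rule two_cell.intro[OF LG.id_mod_vmodule ME.mod_comp_vmodule], rule two_cell_axioms.intro;
    unfold id_mod_sel mod_comp_sel(1) sel)
  show "linear_map R (homG B A) (ME.T B A) (unit B A)" if "B \<in> Ob F" "A \<in> Ob F" for B A
    by (rule unit_linear[OF that])
  fix C D C' D' c a g
  assume ob: "C \<in> Ob F" "D \<in> Ob F" "C' \<in> Ob F" "D' \<in> Ob F"
    and c: "c \<in> carrier (homG C' C)" and a: "a \<in> carrier (homG D D')" and g: "g \<in> carrier (homG C D)"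
  note ob' = ob[folded sel(4)]
  let ?act = "Act (mod_comp R \<G> \<F> \<G> M E) C D C' D'"
  interpret MEv: vmodule R \<G> \<G> "mod_comp R \<G> \<F> \<G> M E" by (rule ME.mod_comp_vmodule)
  note a1 = MEv.act_linear[OF ob', unfolded sel mod_comp_sel(1)]
    and a2 = MEv.act_linear_contra[OF ob', unfolded sel mod_comp_sel(1)]
    and a3 = MEv.act_linear_co[OF ob', unfolded sel mod_comp_sel(1)]
  note u = unit_linear[OF ob(1,2)] and u' = unit_linear[OF ob(3,4)]
  note ucl = linear_map_closed[OF u]
  show "unit C' D' (gc C' D D' a (gc C' C D g c)) = ?act c a (unit C D g)"
  proof (rule trilinear_free_ext[OF R ME_module[OF ob(3,4)] _ _ _ _ _ _ _ c a g,
      where f = "\<lambda>c a g. unit C' D' (gc C' D D' a (gc C' C D g c))" and g = "\<lambda>c a g. ?act c a (unit C D g)"])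
    fix c a g assume c: "c \<in> Arr F C' C \<inter> Gr" and a: "a \<in> Arr F D D' \<inter> Gr" and g: "g \<in> Arr F C D \<inter> Gr"
    have c': "c \<in> Arr F C' C" "c \<in> Ms" and a': "a \<in> Arr F D D'" and g': "g \<in> Arr F C D" "g \<in> Es"
      using a c g by auto
    note gc = G_comp[OF c g] and ag = G_comp[OF g a]
    have c1: "c \<in> Arr F C' C \<inter> Ms" and ag1: "a \<bullet> g \<in> Arr F C D' \<inter> Es" using c ag by auto
    have agc: "a \<bullet> (g \<bullet> c) = (a \<bullet> g) \<bullet> c" by (rule cmp_assoc[OF c'(1) g'(1) a'])
    have M1: "Act M C C C' C (gen R c) (oneF C) (oneF C) = gen R c"
      using M_gen_left[OF c, of "Idn F C" C] idG[OF ob(1)] idn_left[OF c'(1)] by simp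
    have E1: "Act E C D C D' (oneF C) (gen R a) (gen R g) = gen R (a \<bullet> g)"
      using E_gen_right[OF a] g by simp
    have ago: "(a \<bullet> g) \<bullet> c \<in> Gr" using G_comp[OF c ag] by simp
    \<comment> \<open>The action spreads the class over both factors, as [a g \<otimes> c];
      \<open>ME_tens_gen\<close> gathers it again as [a g c \<otimes> 1].\<close>
    have "?act (gen R c) (gen R a) (unit C D (gen R g)) = ME.tens C' D' C (gen R (a \<bullet> g)) (gen R c)"
      using ME.comp_act_tens[OF ob', unfolded sel, OF gen_closed[OF R c] gen_closed[OF R a] ob(1)
          genE[OF g'] one_M[OF ob(1)]]
      by (simp add: unit_gen[OF ob(1,2) g] M1 E1)
    also have "\<dots> = unit C' D' (gen R ((a \<bullet> g) \<bullet> c))"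
      using ME_tens_gen[OF ob(3,4,1) ag1 c1] ago by simp
    finally show "unit C' D' (gc C' D D' (gen R a) (gc C' C D (gen R g) (gen R c)))
        = ?act (gen R c) (gen R a) (unit C D (gen R g))"
      by (simp add: g_gen[OF c g] g_gen[OF gc a] agc)
  qed (rule linear_map_comp[OF linear_map_comp[OF g_left g_right] u'] linear_map_comp[OF u a1]
      linear_map_comp[OF g_left[OF g_cl] u'] a3[OF _ ucl]
      linear_map_comp[OF linear_map_comp[OF g_right g_right] u'] a2[OF _ ucl]; assumption)+
qed

abbreviation "gtr C D f \<equiv> (if f \<in> Gr then gen R f else \<zero>\<^bsub>homG C D\<^esub>)"

text \<open>The inverse of the unit on representatives; by \<open>retr_balanced\<close> it descends
  to the coend.\<close>

definition "retr C D = (\<lambda>(B :: 'o, h, k).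
  lin_ext R (homG C D) (\<lambda>e. lin_ext R (homG C D) (\<lambda>m. gtr C D (e \<bullet> m)) k) h)"

lemma gtr_closed:
  assumes "f \<in> Arr F C D"
  shows "gtr C D f \<in> carrier (homG C D)"
proof -
  interpret N: module R "homG C D" by (rule mod)
  show ?thesis using assms by (simp add: genG)
qed

lemma gtr_cmp_closed:
  "\<lbrakk>e \<in> Arr F B D \<inter> Es; m \<in> Arr F C B \<inter> Ms\<rbrakk> \<Longrightarrow> gtr C D (e \<bullet> m) \<in> carrier (homG C D)"
  by (rule gtr_closed) (blast intro: cmp_arr)

lemma retr_left:
  "k \<in> carrier (homM C B) \<Longrightarrow> linear_map R (homE B D) (homG C D) (\<lambda>h. retr C D (B, h, k))"
  unfolding retr_def prod.case by (rule bilin_ext_linear_left[OF R mod gtr_cmp_closed])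

lemma retr_right:
  "h \<in> carrier (homE B D) \<Longrightarrow> linear_map R (homM C B) (homG C D) (\<lambda>k. retr C D (B, h, k))"
  unfolding retr_def prod.case by (rule bilin_ext_linear_right[OF R mod gtr_cmp_closed])

lemma retr_gen:
  "\<lbrakk>e \<in> Arr F B D \<inter> Es; m \<in> Arr F C B \<inter> Ms\<rbrakk>
    \<Longrightarrow> retr C D (B, gen R e, gen R m) = gtr C D (e \<bullet> m)"
  unfolding retr_def prod.case by (rule bilin_ext_gen[OF R mod gtr_cmp_closed])

text \<open>On single morphisms both sides are e b m cut down to \<G>. If e b is not in \<E>, or b m
  is not in \<M>, the factor lemmas keep the whole composite out of \<G>, so the truncations in the
  actions do no harm.\<close>

lemma retr_balanced:
  assumes ob: "C \<in> Ob F" "D \<in> Ob F"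
  shows "ME.bal C D (homG C D) (retr C D)"
proof (rule balancedI; unfold sel)
  fix B B' b h k
  assume B: "B \<in> Ob F" "B' \<in> Ob F" and b: "b \<in> carrier (homF B B')"
    and h: "h \<in> carrier (homE B' D)" and k: "k \<in> carrier (homM C B)"
  note iD = one_G[OF ob(2)] and iC = one_G[OF ob(1)]
  show "retr C D (B, Act E B' D B D b (oneF D) h, k) = retr C D (B', h, Act M C B C B' (oneF C) b k)"
  proof (rule trilinear_free_ext[OF R mod _ _ _ _ _ _ _ b h k,
      where f = "\<lambda>b h k. retr C D (B, Act E B' D B D b (oneF D) h, k)"
        and g = "\<lambda>b h k. retr C D (B', h, Act M C B C B' (oneF C) b k)"])
    fix b e m assume b: "b \<in> Arr F B B'" and e: "e \<in> Arr F B' D \<inter> Es" and m: "m \<in> Arr F C B \<inter> Ms"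
    have e': "e \<in> Arr F B' D" and m': "m \<in> Arr F C B" using e m by auto
    note eb = cmp_arr[OF b e'] and bm = cmp_arr[OF m' b]
    have assoc: "e \<bullet> (b \<bullet> m) = (e \<bullet> b) \<bullet> m" by (rule cmp_assoc[OF m' b e'])
    have "retr C D (B, Etr B D (e \<bullet> b), gen R m) = gtr C D ((e \<bullet> b) \<bullet> m)"
    proof (cases "e \<bullet> b \<in> Es")
      case True
      with eb retr_gen[OF _ m, of "e \<bullet> b" D] show ?thesis by (simp add: Etr_simps)
    next
      case False
      then have "(e \<bullet> b) \<bullet> m \<notin> Gr" using Es_left_factor[OF eb m'] by blast
      with False show ?thesis
        using linear_map_zero[OF mod mod retr_left[OF gen_closed[OF R m]]] by (auto simp: Etr_simps)
    qed
    moreover have "retr C D (B', gen R e, Mtr C B' (b \<bullet> m)) = gtr C D (e \<bullet> (b \<bullet> m))"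
    proof (cases "b \<bullet> m \<in> Ms")
      case True
      with bm retr_gen[OF e, of "b \<bullet> m" C] show ?thesis by (simp add: Mtr_simps)
    next
      case False
      then have "e \<bullet> (b \<bullet> m) \<notin> Gr" using Ms_right_factor[OF e' bm] by blast
      with False show ?thesis
        using linear_map_zero[OF mod mod retr_right[OF gen_closed[OF R e]]] by (auto simp: Mtr_simps)
    qed
    ultimately show "retr C D (B, Act E B' D B D (gen R b) (oneF D) (gen R e), gen R m)
        = retr C D (B', gen R e, Act M C B C B' (oneF C) (gen R b) (gen R m))"
      by (simp only: E_gen_left[OF b e] M_gen_right[OF b m] assoc)
  qed (rule retr_right[OF E_cl[OF _ iD]] linear_map_comp[OF M_lin3[OF iC] retr_right]
      linear_map_comp[OF E_lin3[OF _ iD] retr_left] retr_left[OF M_cl[OF iC]]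
      linear_map_comp[OF E_lin1[OF iD] retr_left]
      linear_map_comp[OF M_lin2[OF iC] retr_right]; assumption)+
qed (rule retr_left retr_right; assumption)+

lemma unit_bij:
  assumes ob: "C \<in> Ob F" "D \<in> Ob F"
  shows "bij_betw (unit C D) (carrier (homG C D)) (carrier (ME.T C D))"
proof -
  let ?r = "coend_map R (homG C D) (retr C D)"
  note ob' = ob[folded sel(4)]
  note r = ME.coend_map_linear[OF ob' mod retr_balanced[OF ob]]
    and r_tens = ME.coend_map_tens[OF ob' mod retr_balanced[OF ob], unfolded sel]
  note u = unit_linear[OF ob]
  have ru: "?r (unit C D g) = g" if g: "g \<in> carrier (homG C D)" for g
  proof (rule linear_map_free_ext[OF R mod linear_map_comp[OF u r] linear_map_ident _ g])
    fix g assume g: "g \<in> Arr F C D \<inter> Gr"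
    then have g1: "g \<in> Arr F C D" "g \<in> Es" "g \<in> Arr F C D \<inter> Es" "g \<in> Gr"
      and i: "Idn F C \<in> Arr F C C \<inter> Ms"
      using idG[OF ob(1)] by auto
    show "?r (unit C D (gen R g)) = gen R g"
      using r_tens[OF ob(1) genE[OF g1(1,2)] one_M[OF ob(1)]] retr_gen[OF g1(3) i] g1(4)
      by (simp add: unit_gen[OF ob g] idn_right[OF g1(1)])
  qed
  have ur: "unit C D (?r x) = x" if x: "x \<in> carrier (ME.T C D)" for x
    using ob' ME_module[OF ob] linear_map_comp[OF r u] linear_map_ident _ x
  proof (rule ME.coend_ext; unfold sel)
    fix B h k assume B: "B \<in> Ob F" and h: "h \<in> carrier (homE B D)" and k: "k \<in> carrier (homM C B)"
    show "unit C D (?r (ME.tens C D B h k)) = ME.tens C D B h k"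
      unfolding r_tens[OF B h k]
    proof (rule bilinear_free_ext[OF R ME_module[OF ob] _ _ _ _ _ h k,
        where f = "\<lambda>h k. unit C D (retr C D (B, h, k))" and g = "\<lambda>h k. ME.tens C D B h k"])
      fix e m assume e: "e \<in> Arr F B D \<inter> Es" and m: "m \<in> Arr F C B \<inter> Ms"
      show "unit C D (retr C D (B, gen R e, gen R m)) = ME.tens C D B (gen R e) (gen R m)"
        using linear_map_zero[OF mod ME_module[OF ob] u]
        by (simp add: retr_gen[OF e m] ME_tens_gen[OF ob B e m])
    qed (rule linear_map_comp[OF retr_left u] linear_map_comp[OF retr_right u]
        ME_left[OF ob B] ME_right[OF ob B]; assumption)+
  qed
  show ?thesis
    by (rule bij_betw_byWitness[where f' = ?r])
      (use ru ur linear_map_closed[OF u] linear_map_closed[OF r] in auto)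
qed

subsection \<open>The counit\<close>

abbreviation "counit \<equiv> EM_counit R F p"

lemmas EM_module = EM.coend_module[unfolded sel]
lemmas EM_left = EM.tens_linear_left[unfolded sel]
lemmas EM_right = EM.tens_linear_right[unfolded sel]
lemmas EM_balance = EM.tens_balance[unfolded sel]
lemmas EM_closed = EM.tens_closed[unfolded sel]

section \<open>Well-definedness and naturality of the counit\<close>

lemma gen_p_zero:
  assumes "f \<in> Arr F A B" "f \<notin> Ms"
  shows "fc A A B (gen R f) (p A) = \<zero>\<^bsub>homF A B\<^esub>"
  using p1[OF arr_ob[OF assms(1)] assms] by (simp add: sel)

lemma p_gen_zero:
  assumes "f \<in> Arr F A B" "f \<notin> Es"
  shows "fc A B B (p B) (gen R f) = \<zero>\<^bsub>homF A B\<^esub>"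
  using p2[OF arr_ob[OF assms(1)] assms] by (simp add: sel)

lemma p_gen_commute:
  assumes "g \<in> Arr F A B \<inter> Gr"
  shows "fc A A B (gen R g) (p A) = fc A B B (p B) (gen R g)"
  using p3[of A B g] assms arr_ob[of g A B] by auto

text \<open>Linear extension of (p4). It is used with \<open>V\<close> the zero module in
  \<open>p_eval\<close>, and with \<open>V\<close> a level of the rank filtration in
  \<open>counit_splitting_bij\<close>.\<close>

lemma one_minus_p_image:
  assumes C: "C \<in> Ob F" and N: "module R N" and L: "linear_map R (homF C C) N L"
    and V: "submodule V R N" and "\<And>f. \<lbrakk>f \<in> Arr F C C; f \<notin> Es; f \<notin> Ms\<rbrakk> \<Longrightarrow> L (gen R f) \<in> V"
  shows "L (oneF C) \<ominus>\<^bsub>N\<^esub> L (p C) \<in> V"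
proof -
  let ?X = "{f \<in> Arr F C C. f \<notin> Es \<and> f \<notin> Ms}"
  have LX: "linear_map R (free_mod R ?X) N L"
    by (rule linear_map_free_mono[OF L]) auto
  have "L (oneF C \<ominus>\<^bsub>homF C C\<^esub> p C) \<in> V"
    by (rule linear_map_free_image[OF R N LX V]) (use assms(5) p4[OF C] in \<open>auto simp: sel\<close>)
  then show ?thesis
    using linear_map_minus[OF mod N L one_F[OF C] p_closed[OF C]] by simp
qed

text \<open>Axiom (p4) in the form in which it is used: modulo \<open>\<E>' \<inter> \<M>'\<close> the idempotent is the identity.\<close>

lemma p_eval:
  assumes C: "C \<in> Ob F" and N: "module R N" and L: "linear_map R (homF C C) N L"
    and "\<And>f. \<lbrakk>f \<in> Arr F C C; f \<notin> Es; f \<notin> Ms\<rbrakk> \<Longrightarrow> L (gen R f) = \<zero>\<^bsub>N\<^esub>"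
  shows "L (p C) = L (oneF C)"
proof -
  interpret N: module R N by (rule N)
  have "submodule {\<zero>\<^bsub>N\<^esub>} R N" by (rule N.submoduleI) auto
  then have "L (oneF C) \<ominus>\<^bsub>N\<^esub> L (p C) = \<zero>\<^bsub>N\<^esub>"
    using one_minus_p_image[OF C N L] assms(4) by blast
  then show ?thesis
    using abelian_group_minus_eq_zeroD[OF N.abelian_group_axioms]
      linear_map_closed[OF L one_F[OF C]] linear_map_closed[OF L p_closed[OF C]] by metis
qed

text \<open>When a m leaves \<M>, the action drops it, and (p1) makes (a m) p zero as well. So
  before p the truncated and the full composite agree: this is naturality of the counit in the
  codomain.\<close>

lemma act_M_p:
  assumes C: "C \<in> Ob F" and a: "a \<in> carrier (homF B B')" and m: "m \<in> carrier (homM C B)"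
  shows "fc C C B' (Act M C B C B' (oneF C) a m) (p C) = fc C B B' a (fc C C B m (p C))"
proof (rule bilinear_free_ext[OF R mod _ _ _ _ _ a m,
    where f = "\<lambda>a m. fc C C B' (Act M C B C B' (oneF C) a m) (p C)"
      and g = "\<lambda>a m. fc C B B' a (fc C C B m (p C))"])
  note pC = p_closed[OF C]
  note l = lin_M[OF f_left[OF pC]]
  fix a m assume a: "a \<in> Arr F B B'" and m: "m \<in> Arr F C B \<inter> Ms"
  have m': "m \<in> Arr F C B" using m by simp
  note am = cmp_arr[OF m' a]
  have "fc C C B' (Mtr C B' (a \<bullet> m)) (p C) = fc C C B' (gen R (a \<bullet> m)) (p C)"
  proof (cases "a \<bullet> m \<in> Ms")
    case False
    then show ?thesis
      using gen_p_zero[OF am] linear_map_zero[OF mod mod l] by (simp add: Mtr_simps)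
  qed (simp add: Mtr_simps)
  then show "fc C C B' (Act M C B C B' (oneF C) (gen R a) (gen R m)) (p C)
      = fc C B B' (gen R a) (fc C C B (gen R m) (p C))"
    using f_assoc[OF pC genF[OF m'] genF[OF a]] by (simp add: M_gen_right[OF a m] f_gen[OF m' a])
qed (rule linear_map_comp[OF M_lin2[OF one_G[OF C]] lin_M[OF f_left[OF p_closed[OF C]]]]
    f_left[OF linear_map_closed[OF lin_M[OF f_left[OF p_closed[OF C]]]]]
    linear_map_comp[OF M_lin3[OF one_G[OF C]] lin_M[OF f_left[OF p_closed[OF C]]]]
    linear_map_comp[OF lin_M[OF f_left[OF p_closed[OF C]]] f_right]; assumption)+

lemma pe_linear: "C \<in> Ob F \<Longrightarrow> linear_map R (homE A C) (homF A C) (\<lambda>e. fc A C C (p C) e)"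
  by (rule lin_E[OF f_right[OF p_closed]])

text \<open>The dual of \<open>act_M_p\<close>, with (p2): composites that leave \<E> are killed by
  p on the left.\<close>

lemma p_act_E:
  assumes C: "C \<in> Ob F" and b: "b \<in> carrier (homF A' A)" and e: "e \<in> carrier (homE A C)"
  shows "fc A' C C (p C) (Act E A C A' C b (oneF C) e) = fc A' A C (fc A C C (p C) e) b"
proof (rule bilinear_free_ext[OF R mod _ _ _ _ _ b e,
    where f = "\<lambda>b e. fc A' C C (p C) (Act E A C A' C b (oneF C) e)"
      and g = "\<lambda>b e. fc A' A C (fc A C C (p C) e) b"])
  note pC = p_closed[OF C]
  note l = lin_E[OF f_right[OF pC]]
  fix b e assume b: "b \<in> Arr F A' A" and e: "e \<in> Arr F A C \<inter> Es"
  have e': "e \<in> Arr F A C" using e by simp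
  note eb = cmp_arr[OF b e']
  have "fc A' C C (p C) (Etr A' C (e \<bullet> b)) = fc A' C C (p C) (gen R (e \<bullet> b))"
  proof (cases "e \<bullet> b \<in> Es")
    case False
    then show ?thesis
      using p_gen_zero[OF eb] linear_map_zero[OF mod mod l] by (simp add: Etr_simps)
  qed (simp add: Etr_simps)
  then show "fc A' C C (p C) (Act E A C A' C (gen R b) (oneF C) (gen R e))
      = fc A' A C (fc A C C (p C) (gen R e)) (gen R b)"
    using f_assoc[OF genF[OF b] genF[OF e'] pC] by (simp add: E_gen_left[OF b e] f_gen[OF b e'])
qed (rule linear_map_comp[OF E_lin1[OF one_G[OF C]] pe_linear[OF C]]
    f_right[OF linear_map_closed[OF pe_linear[OF C]]]
    linear_map_comp[OF E_lin3[OF _ one_G[OF C]] pe_linear[OF C]]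
    linear_map_comp[OF pe_linear[OF C] f_left]; assumption)+

abbreviation "mpe A B \<equiv> (\<lambda>(C, m, e). fc A C B m (fc A C C (p C) e))"

lemma mpe_left:
  "\<lbrakk>C \<in> Ob F; e \<in> carrier (homE A C)\<rbrakk>
    \<Longrightarrow> linear_map R (homM C B) (homF A B) (\<lambda>m. fc A C B m (fc A C C (p C) e))"
  by (rule lin_M[OF f_left[OF linear_map_closed[OF pe_linear]]])

lemma mpe_right:
  "\<lbrakk>C \<in> Ob F; m \<in> carrier (homM C B)\<rbrakk>
    \<Longrightarrow> linear_map R (homE A C) (homF A B) (\<lambda>e. fc A C B m (fc A C C (p C) e))"
  by (rule linear_map_comp[OF pe_linear f_right[OF subM]])

text \<open>For g in \<G>, (p3) moves the idempotent past it: (m g) p e = m p' (g e). Neither action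
  truncates here, since \<E> and \<M> are closed under composition with \<G>.\<close>

lemma counit_balanced:
  assumes ob: "A \<in> Ob F" "B \<in> Ob F"
  shows "EM.bal A B (homF A B) (mpe A B)"
proof (rule balancedI; unfold sel prod.case)
  fix C C' g m e
  assume C: "C \<in> Ob F" "C' \<in> Ob F" and g: "g \<in> carrier (homG C C')"
    and m: "m \<in> carrier (homM C' B)" and e: "e \<in> carrier (homE A C)"
  note iA = one_F[OF ob(1)] and iB = one_F[OF ob(2)]
  show "fc A C B (Act M C' B C B g (oneF B) m) (fc A C C (p C) e)
      = fc A C' B m (fc A C' C' (p C') (Act E A C A C' (oneF A) g e))"
  proof (rule trilinear_free_ext[OF R mod _ _ _ _ _ _ _ g m e,
      where f = "\<lambda>g m e. fc A C B (Act M C' B C B g (oneF B) m) (fc A C C (p C) e)"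
        and g = "\<lambda>g m e. fc A C' B m (fc A C' C' (p C') (Act E A C A C' (oneF A) g e))"])
    fix g m e assume g: "g \<in> Arr F C C' \<inter> Gr" and m: "m \<in> Arr F C' B \<inter> Ms" and e: "e \<in> Arr F A C \<inter> Es"
    have arr: "g \<in> Arr F C C'" "m \<in> Arr F C' B" "e \<in> Arr F A C" using g m e by auto
    note G = genF[OF arr(1)] and M = genF[OF arr(2)] and E = genF[OF arr(3)]
    note p = p_closed[OF C(1)] and p' = p_closed[OF C(2)]
    have "fc A C B (gen R (m \<bullet> g)) (fc A C C (p C) (gen R e))
        = fc A C' B (gen R m) (fc A C C' (fc C C C' (gen R g) (p C)) (gen R e))"
      using f_assoc[OF f_cl[OF E p] G M] f_assoc[OF E p G] f_gen[OF arr(1,2)] by simp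
    also have "\<dots> = fc A C' B (gen R m) (fc A C' C' (p C') (gen R (g \<bullet> e)))"
      using f_assoc[OF E G p'] p_gen_commute[OF g] f_gen[OF arr(3,1)] by simp
    finally show "fc A C B (Act M C' B C B (gen R g) (oneF B) (gen R m)) (fc A C C (p C) (gen R e))
        = fc A C' B (gen R m) (fc A C' C' (p C') (Act E A C A C' (oneF A) (gen R g) (gen R e)))"
      by (simp only: M_gen_left[OF g m] E_gen_right[OF g e])
  qed (rule mpe_right[OF C(1) M_cl[OF _ iB]] linear_map_comp[OF E_lin3[OF iA] mpe_right[OF C(2)]]
      linear_map_comp[OF M_lin3[OF _ iB] mpe_left[OF C(1)]] mpe_left[OF C(2) E_cl[OF iA]]
      linear_map_comp[OF M_lin1[OF iB] mpe_left[OF C(1)]]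
      linear_map_comp[OF E_lin2[OF iA] mpe_right[OF C(2)]]; assumption)+
qed (rule mpe_left mpe_right; assumption)+

lemma counit_eq: "counit A B = coend_map R (homF A B) (mpe A B)"
  by (simp add: EM_counit_def Let_def linearize_sel)

lemma counit_linear:
  "\<lbrakk>A \<in> Ob F; B \<in> Ob F\<rbrakk> \<Longrightarrow> linear_map R (EM.T A B) (homF A B) (counit A B)"
  unfolding counit_eq
  by (rule EM.coend_map_linear[unfolded sel, OF _ _ mod counit_balanced])

lemma counit_tens:
  "\<lbrakk>A \<in> Ob F; B \<in> Ob F; C \<in> Ob F; m \<in> carrier (homM C B); e \<in> carrier (homE A C)\<rbrakk>
    \<Longrightarrow> counit A B (EM.tens A B C m e) = fc A C B m (fc A C C (p C) e)"
  unfolding counit_eq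
  using EM.coend_map_tens[unfolded sel, OF _ _ mod counit_balanced] by simp

lemma counit_two_cell: "two_cell R \<F> \<F> (mod_comp R \<F> \<G> \<F> E M) (id_mod \<F>) counit"
proof (rule two_cell.intro[OF EM.mod_comp_vmodule LF.id_mod_vmodule], rule two_cell_axioms.intro;
    unfold id_mod_sel mod_comp_sel(1) sel)
  show "linear_map R (EM.T B A) (homF B A) (counit B A)" if "B \<in> Ob F" "A \<in> Ob F" for B A
    by (rule counit_linear[OF that])
  fix A B A' B' b a x
  assume ob: "A \<in> Ob F" "B \<in> Ob F" "A' \<in> Ob F" "B' \<in> Ob F"
    and b: "b \<in> carrier (homF A' A)" and a: "a \<in> carrier (homF B B')" and x: "x \<in> carrier (EM.T A B)"
  note ob' = ob[folded sel(1)]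
  let ?act = "Act (mod_comp R \<F> \<G> \<F> E M) A B A' B' b a"
  show "counit A' B' (?act x) = fc A' B B' a (fc A' A B (counit A B x) b)"
    using ob'(1,2) mod
      linear_map_comp[OF EM.comp_act_linear[OF ob', unfolded sel, OF b a] counit_linear[OF ob(3,4)]]
      linear_map_comp[OF counit_linear[OF ob(1,2)] linear_map_comp[OF f_left[OF b] f_right[OF a]]] _ x
  proof (rule EM.coend_ext; unfold sel)
    fix C m e assume C: "C \<in> Ob F" and m: "m \<in> carrier (homM C B)" and e: "e \<in> carrier (homE A C)"
    let ?m = "Act M C B C B' (oneF C) a m" and ?e = "Act E A C A' C b (oneF C) e"
    have m': "?m \<in> carrier (homM C B')" by (rule M_cl[OF one_G[OF C] a m])
    have e': "?e \<in> carrier (homE A' C)" by (rule E_cl[OF b one_G[OF C] e])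
    note pC = p_closed[OF C] and mF = subM[OF m] and eF = subE[OF e] and mF' = subM[OF m']
    note pe = f_cl[OF eF pC] and peb = f_cl[OF b f_cl[OF eF pC]]
    have "counit A' B' (?act (EM.tens A B C m e)) = fc A' C B' ?m (fc A' C C (p C) ?e)"
      using EM.comp_act_tens[OF ob', unfolded sel, OF b a C m e] counit_tens[OF ob(3,4) C m' e']
      by simp
    also have "\<dots> = fc A' A B' (fc A C B' ?m (fc A C C (p C) e)) b"
      using p_act_E[OF C b e] f_assoc[OF b pe mF'] by simp
    also have "\<dots> = fc A' A B' (fc A C B' (fc C B B' a (fc C C B m (p C))) e) b"
      using act_M_p[OF C a m] f_assoc[OF eF pC mF'] by simp
    also have "\<dots> = fc A' A B' (fc A B B' a (fc A C B m (fc A C C (p C) e))) b"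
      using f_assoc[OF eF f_cl[OF pC mF] a] f_assoc[OF eF pC mF] by simp
    also have "\<dots> = fc A' B B' a (fc A' A B (fc A C B m (fc A C C (p C) e)) b)"
      using f_assoc[OF b f_cl[OF pe mF] a] by simp
    finally show "counit A' B' (?act (EM.tens A B C m e))
        = fc A' B B' a (fc A' A B (counit A B (EM.tens A B C m e)) b)"
      by (simp add: counit_tens[OF ob(1,2) C m e])
  qed
qed

section \<open>Bijectivity of the counit\<close>

definition "splitting A B =
  lin_ext R (EM.T A B) (\<lambda>f. EM.tens A B (img_ob f) (gen R (mono_part f)) (gen R (epi_part f)))"

lemma splitting_closed:
  assumes f: "f \<in> Arr F A B"
  shows "EM.tens A B (img_ob f) (gen R (mono_part f)) (gen R (epi_part f)) \<in> carrier (EM.T A B)"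
  using parts[OF f] arr_ob[OF f] arr_ob(1)[OF parts(2)[OF f]]
  by (intro EM_closed genM genE) auto

lemma splitting_linear:
  "\<lbrakk>A \<in> Ob F; B \<in> Ob F\<rbrakk> \<Longrightarrow> linear_map R (homF A B) (EM.T A B) (splitting A B)"
  unfolding splitting_def by (rule lin_ext_linear[OF EM_module splitting_closed])

lemma splitting_gen:
  assumes f: "f \<in> Arr F A B"
  shows "splitting A B (gen R f)
    = EM.tens A B (img_ob f) (gen R (mono_part f)) (gen R (epi_part f))"
  unfolding splitting_def
  using lin_ext_gen[OF EM_module[OF arr_ob[OF f]],
      of "\<lambda>f. EM.tens A B (img_ob f) (gen R (mono_part f)) (gen R (epi_part f))"] splitting_closed[OF f]
  by simp

text \<open>The comparison \<open>w\<close> from the given factorization to the chosen one is in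
  \<G>, so the balance relation carries it across the tensor. Hence the class depends only on m
  e.\<close>

lemma EM_tens_gen:
  assumes ob: "A \<in> Ob F" "B \<in> Ob F" "C \<in> Ob F"
    and m: "m \<in> Arr F C B \<inter> Ms" and e: "e \<in> Arr F A C \<inter> Es"
  shows "EM.tens A B C (gen R m) (gen R e) = splitting A B (gen R (m \<bullet> e))"
proof -
  have m': "m \<in> Ms" "m \<in> Arr F C B" and e': "e \<in> Es" "e \<in> Arr F A C" using m e by auto
  note f = cmp_arr[OF e'(2) m'(2)]
  let ?f = "m \<bullet> e"
  note q = parts[OF f]
  note I = arr_ob(1)[OF q(2)]
  obtain w where w: "w \<in> Arr F C (img_ob ?f)" "w \<in> Gr" "w \<bullet> e = epi_part ?f" "mono_part ?f \<bullet> w = m"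
    using factor_unique[OF m' e' q(1-4) q(5)[symmetric]] .
  have w': "w \<in> Arr F C (img_ob ?f) \<inter> Gr" using w by simp
  have M: "Act M (img_ob ?f) B C B (gen R w) (oneF B) (gen R (mono_part ?f)) = gen R m"
    using M_gen_left[OF w', of "mono_part ?f" B] q w by simp
  have E: "Act E A C A (img_ob ?f) (oneF A) (gen R w) (gen R e) = gen R (epi_part ?f)"
    using E_gen_right[OF w' e] w by simp
  show ?thesis
    using EM_balance[OF ob(1,2,3) I gen_closed[OF R w'] genM[OF q(2,1)] genE[OF e'(2,1)]]
    by (simp add: M E splitting_gen[OF f])
qed

lemma splitting_surj:
  assumes ob: "A \<in> Ob F" "B \<in> Ob F"
  shows "splitting A B ` carrier (homF A B) = carrier (EM.T A B)"
proof
  note s = splitting_linear[OF ob]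
  show "splitting A B ` carrier (homF A B) \<subseteq> carrier (EM.T A B)"
    using linear_map_closed[OF s] by blast
  have V: "submodule (splitting A B ` carrier (homF A B)) R (EM.T A B)"
    by (rule image_submodule[OF mod EM_module[OF ob] s])
  show "carrier (EM.T A B) \<subseteq> splitting A B ` carrier (homF A B)"
  proof
    fix x assume x: "x \<in> carrier (EM.T A B)"
    show "x \<in> splitting A B ` carrier (homF A B)"
      using ob[folded sel(1)] x
    proof (rule EM.coend_induct; unfold sel)
      show "\<zero>\<^bsub>EM.T A B\<^esub> \<in> splitting A B ` carrier (homF A B)"
        using V by (simp add: submodule_def subgroup_def)
      show "x \<oplus>\<^bsub>EM.T A B\<^esub> y \<in> splitting A B ` carrier (homF A B)"
        if "x \<in> splitting A B ` carrier (homF A B)" "y \<in> splitting A B ` carrier (homF A B)" for x y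
        using module.submoduleE(5)[OF EM_module[OF ob] V that] .
      show "r \<odot>\<^bsub>EM.T A B\<^esub> x \<in> splitting A B ` carrier (homF A B)"
        if "r \<in> carrier R" "x \<in> splitting A B ` carrier (homF A B)" for r x
        using module.submoduleE(4)[OF EM_module[OF ob] V that] .
      fix C m e assume C: "C \<in> Ob F" and m: "m \<in> carrier (homM C B)" and e: "e \<in> carrier (homE A C)"
      show "EM.tens A B C m e \<in> splitting A B ` carrier (homF A B)"
      proof (rule linear_map_free_image[OF R EM_module[OF ob] EM_left[OF ob C e] V _ m])
        fix m assume m: "m \<in> Arr F C B \<inter> Ms"
        show "EM.tens A B C (gen R m) e \<in> splitting A B ` carrier (homF A B)"
        proof (rule linear_map_free_image[OF R EM_module[OF ob] EM_right[OF ob C gen_closed[OF R m]] V _ e])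
          fix e assume e: "e \<in> Arr F A C \<inter> Es"
          have "m \<bullet> e \<in> Arr F A B" using m e by (blast intro: cmp_arr)
          then show "EM.tens A B C (gen R m) (gen R e) \<in> splitting A B ` carrier (homF A B)"
            using EM_tens_gen[OF ob C m e] genF by blast
        qed
      qed
    qed
  qed
qed

lemma counit_splitting_bij:
  assumes ob: "A \<in> Ob F" "B \<in> Ob F" and fin: "finite (iso_classes (Msl B))"
  shows "bij_betw (\<lambda>x. counit A B (splitting A B x)) (carrier (homF A B)) (carrier (homF A B))"
proof -
  interpret H: module R "homF A B" by (rule mod)
  let ?T = "\<lambda>x. counit A B (splitting A B x)"
  \<comment> \<open>Writes \<open>?T\<close> as 1 + \<open>?D\<close>, the form required by
    \<open>filtered_unipotent_bij\<close>.\<close>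
  let ?D = "\<lambda>x. ?T x \<ominus>\<^bsub>homF A B\<^esub> x"
  \<comment> \<open>Level k is spanned by the morphisms whose image has rank below k. Strictness
    makes level 0 the zero module.\<close>
  define S where "S k = {f \<in> Arr F A B. rank B (mono_part f) < k}" for k
  let ?V = "\<lambda>k. carrier (free_mod R (S k))"
  let ?n = "Suc (card (iso_classes (Msl B)))"
  have T: "linear_map R (homF A B) (homF A B) ?T"
    by (rule linear_map_comp[OF splitting_linear[OF ob] counit_linear[OF ob]])
  have D: "linear_map R (homF A B) (homF A B) ?D"
    by (rule linear_map_minus_fun[OF mod T linear_map_ident])
  have V: "submodule (?V k) R (homF A B)" for k
    by (rule free_mod_submodule[OF R]) (auto simp: S_def)
  have D_gen: "?D (gen R f) \<in> ?V k" if f: "f \<in> S (Suc k)" for f k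
  proof -
    have fA: "f \<in> Arr F A B" using f by (simp add: S_def)
    note q = parts[OF fA]
    let ?C = "img_ob f"
    note C = arr_ob(1)[OF q(2)]
    \<comment> \<open>\<open>?L\<close> inserts an endomorphism of the image between the two parts
      of f: the identity gives back f, and the idempotent gives \<open>?T\<close> of f.\<close>
    let ?L = "\<lambda>c. fc A ?C B (gen R (mono_part f)) (fc A ?C ?C c (gen R (epi_part f)))"
    have L: "linear_map R (homF ?C ?C) (homF A B) ?L"
      by (rule linear_map_comp[OF f_left[OF genF[OF q(4)]] f_right[OF genF[OF q(2)]]])
    have Ld: "?L (oneF ?C) \<ominus>\<^bsub>homF A B\<^esub> ?L (p ?C) \<in> ?V k"
    proof (rule one_minus_p_image[OF C mod L V])
      \<comment> \<open>Every h occurring in 1 - p lowers the rank strictly, which takes f from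
        level k + 1 to level k.\<close>
      fix h assume h: "h \<in> Arr F ?C ?C" "h \<notin> Es"
      have "?L (gen R h) = gen R (mono_part f \<bullet> (h \<bullet> epi_part f))"
        by (simp add: f_gen[OF q(4) h(1)] f_gen[OF cmp_arr[OF q(4) h(1)] q(2)])
      moreover have "mono_part f \<bullet> (h \<bullet> epi_part f) \<in> S k"
        using rank_insert[OF fin fA h] f cmp_arr[OF cmp_arr[OF q(4) h(1)] q(2)]
        by (simp add: S_def)
      ultimately show "?L (gen R h) \<in> ?V k" using gen_closed[OF R] by metis
    qed
    have L1: "?L (oneF ?C) = gen R f"
      by (simp add: f_gen[OF q(4) idn_arr[OF C]] idn_left[OF q(4)] f_gen[OF q(4,2)] q(5))
    have Lp: "?L (p ?C) = ?T (gen R f)"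
      by (simp add: splitting_gen[OF fA] counit_tens[OF ob C genM[OF q(2,1)] genE[OF q(4,3)]])
    \<comment> \<open>Axiom (p4) controls f - T f, whereas \<open>?D\<close> is T f - f; levels are
      closed under negation.\<close>
    have "\<ominus>\<^bsub>homF A B\<^esub> (gen R f \<ominus>\<^bsub>homF A B\<^esub> ?T (gen R f)) \<in> ?V k"
      using H.submoduleE(3)[OF V] Ld L1 Lp by simp
    moreover have "\<ominus>\<^bsub>homF A B\<^esub> (gen R f \<ominus>\<^bsub>homF A B\<^esub> ?T (gen R f)) = ?D (gen R f)"
      using genF[OF fA] linear_map_closed[OF T genF[OF fA]]
      by (simp add: H.minus_eq H.minus_add H.a_comm)
    ultimately show ?thesis by simp
  qed
  have Dbij: "bij_betw (\<lambda>x. x \<oplus>\<^bsub>homF A B\<^esub> ?D x) (carrier (homF A B)) (carrier (homF A B))"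
  proof (rule filtered_unipotent_bij[OF mod D, where V = ?V and n = ?n])
    show "submodule (?V k) R (homF A B)" for k by (rule V)
    show "?V k \<subseteq> ?V (Suc k)" for k
      by (rule free_mod_mono) (auto simp: S_def)
    show "?V 0 = {\<zero>\<^bsub>homF A B\<^esub>}"
      unfolding S_def using free_mod_empty[OF R] by simp
    have "S ?n = Arr F A B"
      using rank_bound[OF fin] parts(1,2) unfolding S_def by blast
    then show "?V ?n = carrier (homF A B)" by simp
    fix k x assume x: "x \<in> ?V (Suc k)"
    have "linear_map R (free_mod R (S (Suc k))) (homF A B) ?D"
      by (rule linear_map_free_mono[OF D]) (auto simp: S_def)
    from linear_map_free_image[OF R mod this V D_gen x] show "?D x \<in> ?V k" .
  qed
  have "x \<oplus>\<^bsub>homF A B\<^esub> ?D x = ?T x" if x: "x \<in> carrier (homF A B)" for x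
    using x linear_map_closed[OF T x]
    by (simp add: H.minus_eq H.a_lcomm[of x "?T x"] H.r_neg)
  then show ?thesis
    using bij_betw_cong[of "carrier (homF A B)"] Dbij by (metis (lifting))
qed

text \<open>Since \<open>splitting\<close> is onto, injectivity of the composite passes to the
  counit; surjectivity of the composite does so in any case.\<close>

lemma counit_bij:
  assumes ob: "A \<in> Ob F" "B \<in> Ob F" and fin: "finite (iso_classes (Msl B))"
  shows "bij_betw (counit A B) (carrier (EM.T A B)) (carrier (homF A B))"
proof -
  have s: "splitting A B ` carrier (homF A B) = carrier (EM.T A B)" by (rule splitting_surj[OF ob])
  have cs: "bij_betw (counit A B \<circ> splitting A B) (carrier (homF A B)) (carrier (homF A B))"
    using counit_splitting_bij[OF assms] by (simp add: comp_def)
  then have "inj_on (counit A B) (splitting A B ` carrier (homF A B))"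
    by (intro inj_on_imageI) (simp add: bij_betw_def)
  then have "inj_on (counit A B) (carrier (EM.T A B))" by (simp only: s)
  moreover have "counit A B ` carrier (EM.T A B) = carrier (homF A B)"
    unfolding s[symmetric] image_comp using cs by (simp only: bij_betw_def)
  ultimately show ?thesis by (simp add: bij_betw_def)
qed

subsection \<open>The triangle identities\<close>

text \<open>On [g \<otimes> e] the left side is g p e with the part outside \<E> removed. A term f
  of 1 - p is not in \<E>, so g f e is not in \<E> either (\<open>Es_stable\<close>) and is removed.
  Thus p may be replaced by 1, and g e remains.\<close>

lemma triangle_E:
  assumes ob: "B \<in> Ob F" "A \<in> Ob F"
    and x: "x \<in> carrier (Val (mod_comp R \<G> \<G> \<F> E (id_mod \<G>)) B A)"
  shows "left_unitor R \<G> \<F> E B A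
      (hcomp R \<G> \<F> \<F> (id_mod \<F>) E counit id_two_cell B A
        (associator_inv R \<G> \<F> \<G> \<F> E M E B A
          (hcomp R \<G> \<G> \<F> E (mod_comp R \<G> \<F> \<G> M E) id_two_cell unit B A x)))
    = right_unitor R \<G> \<F> E B A x"
    (is "?L x = ?R x")
proof -
  note obF = ob[folded sel(1)] and obG = ob[folded sel(4)]
  note ob' = obF(1) obG(2)
  note me = ME.composable_modules_axioms and em = EM.composable_modules_axioms
  note cats = LG.linear_category_axioms LF.linear_category_axioms
  interpret I1: composable_modules R \<G> \<G> \<F> "id_mod \<G>" E
    by (rule composable_id_right[OF R cats E_vmodule ob'])
  interpret I2: composable_modules R \<G> \<G> \<F> "mod_comp R \<G> \<F> \<G> M E" E
    by (rule composable_comp_left[OF me em ob'])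
  interpret I3: composable_modules R \<G> \<F> \<F> E "mod_comp R \<F> \<G> \<F> E M"
    by (rule composable_comp_right[OF me em ob'])
  interpret I4: composable_modules R \<G> \<F> \<F> E "id_mod \<F>"
    by (rule composable_id_left[OF R cats E_vmodule ob'])
  note c1 = I1.composable_modules_axioms and c2 = I2.composable_modules_axioms
    and c3 = I3.composable_modules_axioms and c4 = I4.composable_modules_axioms
  note idE = id_two_cell_two_cell[OF E_vmodule]
  note h1 = hcomp_linear[OF c1 c2 unit_two_cell idE ob']
    and h1_tens = hcomp_tens[OF c1 c2 unit_two_cell idE ob']
  note h2 = hcomp_linear[OF c3 c4 idE counit_two_cell ob']
    and h2_tens = hcomp_tens[OF c3 c4 idE counit_two_cell ob']
  note as = associator_inv_linear[OF me em ob']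
    and as_tens = associator_inv_tens[OF me em ob']
  note lu = left_unitor_linear[OF R cats E_vmodule ob']
    and lu_tens = left_unitor_tens[OF R cats E_vmodule ob']
  note ru = right_unitor_linear[OF R cats E_vmodule ob']
    and ru_tens = right_unitor_tens[OF R cats E_vmodule ob']
  note modE = mod[of "Arr F B A \<inter> Es"]
  note L = linear_map_comp[OF linear_map_comp[OF linear_map_comp[OF h1 as] h2] lu, unfolded sel]
  show ?thesis
    using ob' modE L ru[unfolded sel] _ x[unfolded mod_comp_sel(1)]
  proof (rule I1.coend_ext; unfold sel id_mod_sel(1))
    fix A' g e assume A': "A' \<in> Ob F" and g: "g \<in> carrier (homG A' A)" and e: "e \<in> carrier (homE B A')"
    note A'G = A'[folded sel(4)]
    note tl = I1.tens_linear_left[OF ob' A'G, unfolded sel id_mod_sel(1)]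
      and tr = I1.tens_linear_right[OF ob' A'G, unfolded sel id_mod_sel(1)]
    show "?L (I1.tens B A A' g e) = ?R (I1.tens B A A' g e)"
    proof (rule bilinear_free_ext[OF R modE _ _ _ _ _ g e,
        where f = "\<lambda>g e. ?L (I1.tens B A A' g e)" and g = "\<lambda>g e. ?R (I1.tens B A A' g e)"])
      fix g e assume g: "g \<in> Arr F A' A \<inter> Gr" and e: "e \<in> Arr F B A' \<inter> Es"
      have g': "g \<in> Arr F A' A" "g \<in> Arr F A' A \<inter> Es" and e': "e \<in> Arr F B A'" "e \<in> Es"
        using g e by auto
      note gG = gen_closed[OF R g] and gE = gen_closed[OF R g'(2)] and eE = gen_closed[OF R e]
      note ge = cmp_arr[OF e'(1) g'(1)]
      note iM = one_M[OF A'] and iF = one_F[OF A'] and pA = p_closed[OF A']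
      note pe = f_cl[OF subE[OF eE] pA]
      have c: "counit B A' (EM.tens B A' A' (oneF A') (gen R e)) = fc B A' A' (p A') (gen R e)"
        using counit_tens[OF ob(1) A' A' iM eE] lcmp_id_left[OF R pe A'] by simp
      \<comment> \<open>The four maps send [g \<otimes> e] to [[g \<otimes> 1] \<otimes> e], then [g
        \<otimes> [1 \<otimes> e]], then [g \<otimes> p e], and finally to the action of p e on
        g.\<close>
      have "?L (I1.tens B A A' (gen R g) (gen R e))
          = Act E A' A B A (fc B A' A' (p A') (gen R e)) (oneF A) (gen R g)"
        using h1_tens[unfolded sel id_mod_sel(1), OF A' gG eE] unit_gen[OF A' ob(2) g]
          as_tens[unfolded sel, OF A' A' gE iM eE]
          h2_tens[unfolded sel mod_comp_sel(1), OF A' gE EM_closed[OF ob(1) A' A' iM eE]]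
          lu_tens[unfolded sel, OF A' gE pe] c
        by (simp add: id_two_cell_def[abs_def])
      also have "\<dots> = Act E A' A B A (fc B A' A' (oneF A') (gen R e)) (oneF A) (gen R g)"
      proof (rule p_eval[OF A' modE])
        show "linear_map R (homF A' A') (homE B A)
            (\<lambda>c. Act E A' A B A (fc B A' A' c (gen R e)) (oneF A) (gen R g))"
          by (rule linear_map_comp[OF f_left[OF subE[OF eE]] E_lin1[OF one_G[OF ob(2)] gE]])
        fix f assume f: "f \<in> Arr F A' A'" "f \<notin> Es"
        have "g \<bullet> (f \<bullet> e) \<notin> Es" using Es_stable[OF e'(1) f(1) g] f(2) by blast
        then show "Act E A' A B A (fc B A' A' (gen R f) (gen R e)) (oneF A) (gen R g) = \<zero>\<^bsub>homE B A\<^esub>"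
          by (simp add: f_gen[OF e'(1) f(1)] E_gen_left[OF cmp_arr[OF e'(1) f(1)] g'(2)] Etr_simps)
      qed
      also have "\<dots> = gen R (g \<bullet> e)"
        using lcmp_id_left[OF R subE[OF eE] A'] E_gen_left[OF e'(1) g'(2)] Es_comp[OF e'(2,1) _ g'(1)] g
        by (simp add: Etr_simps)
      also have "\<dots> = ?R (I1.tens B A A' (gen R g) (gen R e))"
        using ru_tens[unfolded sel, OF A' gG eE] E_gen_right[OF g e] by simp
      finally show "?L (I1.tens B A A' (gen R g) (gen R e)) = ?R (I1.tens B A A' (gen R g) (gen R e))" .
    qed (rule linear_map_comp[OF tl L] linear_map_comp[OF tr L]
        linear_map_comp[OF tl ru[unfolded sel]] linear_map_comp[OF tr ru[unfolded sel]]; assumption)+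
  qed
qed

text \<open>Dual to \<open>triangle_E\<close>: the composite m p g is formed in R\<F>, and letting
  it act on the identity removes the part outside \<M>. \<open>Ms_stable\<close> disposes of the
  terms of 1 - p.\<close>

lemma triangle_M:
  assumes ob: "A \<in> Ob F" "B \<in> Ob F"
    and y: "y \<in> carrier (Val (mod_comp R \<F> \<G> \<G> (id_mod \<G>) M) A B)"
  shows "right_unitor R \<F> \<G> M A B
      (hcomp R \<F> \<F> \<G> M (id_mod \<F>) id_two_cell counit A B
        (associator R \<F> \<G> \<F> \<G> M E M A B
          (hcomp R \<F> \<G> \<G> (mod_comp R \<G> \<F> \<G> M E) M unit id_two_cell A B y)))
    = left_unitor R \<F> \<G> M A B y"
    (is "?L y = ?R y")
proof -
  note obF = ob[folded sel(1)] and obG = ob[folded sel(4)]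
  note ob' = obG(1) obF(2)
  note me = ME.composable_modules_axioms and em = EM.composable_modules_axioms
  note cats = LF.linear_category_axioms LG.linear_category_axioms
  interpret J1: composable_modules R \<F> \<G> \<G> M "id_mod \<G>"
    by (rule composable_id_left[OF R cats M_vmodule ob'])
  interpret J2: composable_modules R \<F> \<G> \<G> M "mod_comp R \<G> \<F> \<G> M E"
    by (rule composable_comp_right[OF em me ob'])
  interpret J3: composable_modules R \<F> \<F> \<G> "mod_comp R \<F> \<G> \<F> E M" M
    by (rule composable_comp_left[OF em me ob'])
  interpret J4: composable_modules R \<F> \<F> \<G> "id_mod \<F>" M
    by (rule composable_id_right[OF R cats M_vmodule ob'])
  note c1 = J1.composable_modules_axioms and c2 = J2.composable_modules_axioms
    and c3 = J3.composable_modules_axioms and c4 = J4.composable_modules_axioms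
  note idM = id_two_cell_two_cell[OF M_vmodule]
  note h1 = hcomp_linear[OF c1 c2 idM unit_two_cell ob']
    and h1_tens = hcomp_tens[OF c1 c2 idM unit_two_cell ob']
  note h2 = hcomp_linear[OF c3 c4 counit_two_cell idM ob']
    and h2_tens = hcomp_tens[OF c3 c4 counit_two_cell idM ob']
  note as = associator_linear[OF em me ob']
    and as_tens = associator_tens[OF em me ob']
  note lu = left_unitor_linear[OF R cats M_vmodule ob']
    and lu_tens = left_unitor_tens[OF R cats M_vmodule ob']
  note ru = right_unitor_linear[OF R cats M_vmodule ob']
    and ru_tens = right_unitor_tens[OF R cats M_vmodule ob']
  note modM = mod[of "Arr F A B \<inter> Ms"]
  note L = linear_map_comp[OF linear_map_comp[OF linear_map_comp[OF h1 as] h2] ru, unfolded sel]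
  show ?thesis
    using ob' modM L lu[unfolded sel] _ y[unfolded mod_comp_sel(1)]
  proof (rule J1.coend_ext; unfold sel id_mod_sel(1))
    fix A' m g assume A': "A' \<in> Ob F" and m: "m \<in> carrier (homM A' B)" and g: "g \<in> carrier (homG A A')"
    note A'G = A'[folded sel(4)]
    note tl = J1.tens_linear_left[OF ob' A'G, unfolded sel id_mod_sel(1)]
      and tr = J1.tens_linear_right[OF ob' A'G, unfolded sel id_mod_sel(1)]
    show "?L (J1.tens A B A' m g) = ?R (J1.tens A B A' m g)"
    proof (rule bilinear_free_ext[OF R modM _ _ _ _ _ m g,
        where f = "\<lambda>m g. ?L (J1.tens A B A' m g)" and g = "\<lambda>m g. ?R (J1.tens A B A' m g)"])
      fix m g assume m: "m \<in> Arr F A' B \<inter> Ms" and g: "g \<in> Arr F A A' \<inter> Gr"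
      have g': "g \<in> Arr F A A'" "g \<in> Arr F A A' \<inter> Es" "g \<in> Ms" and m': "m \<in> Arr F A' B" "m \<in> Ms"
        using g m by auto
      note gG = gen_closed[OF R g] and gE = gen_closed[OF R g'(2)] and mM = gen_closed[OF R m]
      note mg = cmp_arr[OF g'(1) m'(1)]
      note iM = one_M[OF ob(1)] and pA = p_closed[OF A']
      have iA: "Idn F A \<in> Arr F A A \<inter> Ms" using idG[OF ob(1)] by blast
      note mpg = f_cl[OF f_cl[OF genF[OF g'(1)] pA] genF[OF m'(1)]]
      have act: "Act M A A A B (oneF A) (gen R k) (oneF A) = Mtr A B k" if k: "k \<in> Arr F A B" for k
        using M_gen_right[OF k iA] by (simp add: idn_right[OF k])
      \<comment> \<open>The four maps send [m \<otimes> g] to [m \<otimes> [g \<otimes> 1]], then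
        [[m \<otimes> g] \<otimes> 1], then [m p g \<otimes> 1], and finally to the action of m p g
        on 1.\<close>
      have "?L (J1.tens A B A' (gen R m) (gen R g))
          = Act M A A A B (oneF A) (fc A A' B (gen R m) (fc A A' A' (p A') (gen R g))) (oneF A)"
        using h1_tens[unfolded sel id_mod_sel(1), OF A' mM gG] unit_gen[OF ob(1) A' g]
          as_tens[unfolded sel, OF A' ob(1) mM gE iM]
          h2_tens[unfolded sel mod_comp_sel(1), OF ob(1) EM_closed[OF ob A' mM gE] iM]
          counit_tens[OF ob A' mM gE] ru_tens[unfolded sel, OF ob(1) mpg iM]
        by (simp add: id_two_cell_def[abs_def])
      also have "\<dots> = Act M A A A B (oneF A) (fc A A' B (gen R m) (fc A A' A' (oneF A') (gen R g))) (oneF A)"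
      proof (rule p_eval[OF A' modM])
        show "linear_map R (homF A' A') (homM A B)
            (\<lambda>c. Act M A A A B (oneF A) (fc A A' B (gen R m) (fc A A' A' c (gen R g))) (oneF A))"
          by (rule linear_map_comp[OF linear_map_comp[OF f_left[OF genF[OF g'(1)]] f_right[OF genF[OF m'(1)]]]
                M_lin2[OF one_G[OF ob(1)] iM]])
        fix f assume f: "f \<in> Arr F A' A'" "f \<notin> Ms"
        note fg = cmp_arr[OF g'(1) f(1)]
        have "m \<bullet> (f \<bullet> g) \<notin> Ms" using Ms_stable[OF g f(1) m'(1)] f(2) by blast
        then show "Act M A A A B (oneF A) (fc A A' B (gen R m) (fc A A' A' (gen R f) (gen R g))) (oneF A)
            = \<zero>\<^bsub>homM A B\<^esub>"
          by (simp add: f_gen[OF g'(1) f(1)] f_gen[OF fg m'(1)] act[OF cmp_arr[OF fg m'(1)]] Mtr_simps)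
      qed
      also have "\<dots> = gen R (m \<bullet> g)"
        using lcmp_id_left[OF R genF[OF g'(1)] A'] Ms_comp[OF m'(2,1) g'(3,1)]
        by (simp add: f_gen[OF g'(1) m'(1)] act[OF mg] Mtr_simps)
      also have "\<dots> = ?R (J1.tens A B A' (gen R m) (gen R g))"
        using lu_tens[unfolded sel, OF A' mM gG] M_gen_left[OF g m] by simp
      finally show "?L (J1.tens A B A' (gen R m) (gen R g)) = ?R (J1.tens A B A' (gen R m) (gen R g))" .
    qed (rule linear_map_comp[OF tl L] linear_map_comp[OF tr L]
        linear_map_comp[OF tl lu[unfolded sel]] linear_map_comp[OF tr lu[unfolded sel]]; assumption)+
  qed
qed

section \<open>The adjunction and the equivalence\<close>

theorem adjunction: "mod_adjunction R \<G> \<F> E M unit counit"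
  by (intro mod_adjunction.intro mod_adjunction_axioms.intro LG.linear_category_axioms
      LF.linear_category_axioms E_vmodule M_vmodule unit_two_cell counit_two_cell
      triangle_E triangle_M; simp add: sel)

theorem adjoint_equivalence:
  assumes fin: "\<forall>A \<in> Ob F. finite (iso_classes (Msl A))"
  shows "mod_adjoint_equivalence R \<G> \<F> E M unit counit"
proof (rule mod_adjoint_equivalence.intro[OF adjunction], rule mod_adjoint_equivalence_axioms.intro)
  show "invertible_two_cell R \<G> \<G> (id_mod \<G>) (mod_comp R \<G> \<F> \<G> M E) unit"
    using unit_two_cell by (rule invertible_two_cellI)
      (unfold id_mod_sel(1) mod_comp_sel(1) sel, rule unit_bij)
  show "invertible_two_cell R \<F> \<F> (mod_comp R \<F> \<G> \<F> E M) (id_mod \<F>) counit"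
    using counit_two_cell by (rule invertible_two_cellI)
      (unfold id_mod_sel(1) mod_comp_sel(1) sel, rule counit_bij, simp_all add: fin)
qed

end

theorem theorem3p10:
  fixes R :: "('r, 'x) ring_scheme" and F :: "('o, 'm) cat" and Es Ms :: "'m set"
    and p :: "'o \<Rightarrow> 'm \<Rightarrow> 'r"
  assumes "cring R"
    and "category F"
    and "proper_factorization_system F Es Ms"
    and "idempotent_axiom R F Es Ms p"
    and "\<forall>A \<in> Ob F. finite (iso_classes (slice_cat (wide_subcat F Ms) A))"
  shows "mod_adjoint_equivalence R
    (linearize R (groupoid_part F Es Ms)) (linearize R F)
    (E_mod R F Es) (M_mod R F Ms)
    (EM_unit R F Es Ms) (EM_counit R F p)"
proof -
  interpret idempotent_factorization R F Es Ms p
    by (intro idempotent_factorization.intro proper_factorization_category.intro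
        idempotent_factorization_axioms.intro assms(1-4))
  show ?thesis by (rule adjoint_equivalence[OF assms(5)])
qed

end
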